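(* Let $f:(\pi,\sigma)\mapsto f(\pi,\sigma)$ be a multiplicative function. For $p\ge1$ and $\lambda_1,\dots,\lambda_p\ge1$, with $n=\sum_i\lambda_i$ and $\gamma_\lambda=\gamma_{\lambda_1,\dots,\lambda_p}$, let $$\beta_{\lambda_1,\dots,\lambda_p}=\sum_{\substack{\tau\in S_n\\ g(\gamma_\lambda,\tau^{-1})=0}}\ \sum_{\substack{\pi'\in\mathcal P(n),\ \pi'\ge\Pi(\tau)\\ \pi'\vee\Pi(\gamma_\lambda)=1_n\\ L[\pi',\,\Pi(\gamma_\lambda)\vee\Pi(\tau)\,;\,\Pi(\tau)]=0}}f(\pi',\tau).$$ Then $$\beta_{\lambda_1,\dots,\lambda_p}=\sum_{\substack{\tau=\tau_1\times\cdots\times\tau_p\\ \tau_i\in\mathrm{NC}(\lambda_i)}}\ \sum_{\substack{\pi'\in\mathcal P(n),\ \pi'\ge\Pi(\tau)\\ \pi'\vee\Pi(\gamma_\lambda)=1_n\\ L[\pi',\,\Pi(\gamma_\lambda)\,;\,\Pi(\tau)]=0}}\ \mathsf g(\pi',\tau),$$ where $\mathsf g(\pi',\tau)=\prod_{B\in\pi'}\mathsf g(1_{|B|},\tau_{|B})$ is multiplicative over the blocks of $\pi'$ and, for $B\in\pi'$, $$\mathsf g(1_{|B|},\tau_{|B})=f(1_{|B|},\tau_{|B})+\sum_{\bar\pi\in\mathcal P^*(I_B)}\bar g_{\bar\pi}(\tau_{|B}),$$ with, for $\bar\pi\in\mathcal P^*(I_B)$ and $\tau_G=\prod_{i\in G}(\tau_i)_{|B}$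 for each $G\in\bar\pi$, $$\bar g_{\bar\pi}(\tau_{|B})=\sum_{\substack{\nu=\prod_{G\in\bar\pi}\nu_G\\ \nu_G\in\mathrm{NS}(\tau_G)}}\ \sum_{\substack{\pi''\ge\Pi(\nu)\\ \pi''\vee\Pi(\tau_{|B})=1_{|B|}\\ L[\pi'',\,\Pi(\tau_{|B})\vee\Pi(\nu)\,;\,\Pi(\nu)]=0}}f(\pi'',\nu),$$ the inner sum being over partitions $\pi''$ of the set $B$.
   Context: $\mathcal P(n)$ is the set of partitions of $\{1,\dots,n\}$, ordered by refinement $\le$, with join $\vee$; $\#(\pi)$ is the number of blocks, $1_n$ the one-block partition (and $1_{|B|}$ the one-block partition of the set $B$). For a permutation $\sigma$, $\#(\sigma)$ is its number of cycles (fixed points included), $\Pi(\sigma)$ the partition into cycles, $\sigma_{|G}$ its restriction to a union $G$ of cycles. $\gamma_{\lambda_1,\dots,\lambda_p}=(1\cdots\lambda_1)(\lambda_1+1\cdots\lambda_1+\lambda_2)\cdots$. The genus of a pair of permutations of a set of $m$ elements is defined by $\#(\sigma_1)+\#(\sigma_2)+\#(\sigma_1\sigma_2)-m=2\#(\Pi(\sigma_1)\vee\Pi(\sigma_2))-2g(\sigma_1,\sigma_2)$. For $\pi_1,\pi_2\ge\rho$: $L[\pi_1,\pi_2;\rho]=\#(\rho)-\#(\pi_1)-\#(\pi_2)+\#(\pi_1\vee\pi_2)$. A function $f$ of pairs $(\pi,\sigma)$ with $\pi\ge\Pi(\sigma)$ is multiplicative if $f(\pi,\sigma)=\prod_{G\in\pi}f(1_{|G|},\sigma_{|G})$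 and $f(1_n,\sigma)$ depends only on the multiset of cycle lengths of $\sigma$ (so it makes sense for permutations of any finite set). $\tau=\tau_1\times\cdots\times\tau_p$ with $\tau_i\in\mathrm{NC}(\lambda_i)$ means: $\tau\in S_n$, $\Pi(\tau)\le\Pi(\gamma_\lambda)$, and for each $i$ the restrictions $\tau_i,\gamma_i$ of $\tau,\gamma_\lambda$ to the support of the $i$-th cycle of $\gamma_\lambda$ satisfy $g(\tau_i,\gamma_i^{-1})=0$. Products $\prod_{i\in G}(\tau_i)_{|B}$ and $\prod_{G\in\bar\pi}\nu_G$ of permutations of pairwise disjoint sets denote the permutation of the union of these sets whose restriction to each of them is the corresponding factor. For a block $B$ of $\pi'\ge\Pi(\tau)$, $I_B=\{i\in\{1,\dots,p\}: B\text{ intersects the support of the $i$-th cycle of }\gamma_\lambda\}$, and $(\tau_i)_{|B}$ is the restriction of $\tau_i$ to the intersection of $B$ with that support. For a finite set $I$, $\mathcal P^*(I)$ is the set of partitions of $I$ with fewer than $|I|$ blocks, i.e. all partitions other than the one into singletons. For a permutation $\tau$ of a finite set $E$, $\mathrm{NS}(\tau)$ (planar non-separable hypermaps, with white vertices the cycles of $\tau$ and black vertices the cycles of $\nu$) is the set of permutations $\nu$ of $E$ such that $g(\nu,\tau)=0$, $\Pi(\tau)\vee\Pi(\nu)$ is the one-block partition of $E$, and there is no white cut-vertex: for any two distinct elements $b,d$ of $E$ in the same cycle of $\tau$, splitting that cycle does not disconnect the map, i.e. $\Pi(\tau\circ(b\,d))\vee\Pi(\nu)$ is still the one-block partition of $E$,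 where $(b\,d)$ is the transposition. *)

theory Defs
  imports
    Complex_Main
    "HOL-Library.Disjoint_Sets"
    "HOL-Library.Multiset"
    "HOL-Combinatorics.Permutations"
    "HOL-Combinatorics.Cycles"
    "HOL-Combinatorics.Orbits"
begin

text \<open>
  Throughout, a permutation of a finite set \<open>E\<close> is a function \<open>\<sigma>\<close> with \<^term>\<open>\<sigma> permutes E\<close>; it is the
  identity outside \<open>E\<close>, so \<open>E\<close> has to be passed explicitly for fixed points to be counted as
  cycles. Partitions of \<open>E\<close> are sets of sets satisfying \<^const>\<open>partition_on\<close>, and
  \<^term>\<open>refines E P Q\<close> is the refinement order \<open>P \<le> Q\<close>. The one-block partition of \<open>E\<close> is
  \<^term>\<open>{E}\<close>, and the restriction of \<open>\<sigma>\<close> to \<open>G\<close> is \<^term>\<open>perm_restrict \<sigma> G\<close>.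
\<close>

section \<open>Partitions\<close>

text \<open>The classes of the transitive closure of ``lying in a common block of \<open>P\<close> or of \<open>Q\<close>''; see
  \<open>part_join_is_join\<close> below for the fact that this is the least upper bound.\<close>

definition part_join :: "'a set \<Rightarrow> 'a set set \<Rightarrow> 'a set set \<Rightarrow> 'a set set" where
  "part_join E P Q = E // ({(x, y). \<exists>B \<in> P \<union> Q. x \<in> B \<and> y \<in> B}\<^sup>+)"

lemma part_join_is_join:
  assumes P: "partition_on E P" and Q: "partition_on E Q"
  shows "refines E P (part_join E P Q)" "refines E Q (part_join E P Q)"
    and "\<And>R. refines E P R \<Longrightarrow> refines E Q R \<Longrightarrow> refines E (part_join E P Q) R"
proof -
  define r where "r = {(x, y). \<exists>B \<in> P \<union> Q. x \<in> B \<and> y \<in> B}"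
  have sub: "r \<subseteq> E \<times> E" using P Q unfolding r_def partition_on_def by blast
  have "\<forall>x\<in>E. (x, x) \<in> r"
    using P unfolding r_def partition_on_def by blast
  then have "refl_on E (r\<^sup>+)" by (simp add: refl_on_def r_into_trancl')
  moreover have "sym r" unfolding sym_def r_def by blast
  then have "sym (r\<^sup>+)" by (rule sym_trancl)
  ultimately have eq: "equiv E (r\<^sup>+)"
    using trancl_subset_Sigma[OF sub] by (intro equivI) auto
  have J: "part_join E P Q = E // r\<^sup>+" unfolding part_join_def r_def ..
  have pJ: "partition_on E (part_join E P Q)"
    unfolding J by (rule partition_on_quotient[OF eq])
  have up: "\<exists>Y \<in> part_join E P Q. B \<subseteq> Y" if B: "B \<in> P \<union> Q" for B
  proof -
    have "B \<noteq> {}" "B \<subseteq> E" using B P Q unfolding partition_on_def by auto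
    then obtain x where x: "x \<in> B" "x \<in> E" by blast
    have "B \<subseteq> r\<^sup>+ `` {x}" 
    proof
      fix y assume "y \<in> B"
      then have "(x, y) \<in> r" using B x unfolding r_def by blast
      then show "y \<in> r\<^sup>+ `` {x}" by (simp add: r_into_trancl')
    qed
    then show ?thesis unfolding J using x by (auto intro: quotientI)
  qed
  show "refines E P (part_join E P Q)" "refines E Q (part_join E P Q)"
    unfolding refines_def using P Q pJ up by auto
  fix R assume PR: "refines E P R" and QR: "refines E Q R"
  then have pR: "partition_on E R" unfolding refines_def by blast
  define s where "s = {(x, y). \<exists>B \<in> R. x \<in> B \<and> y \<in> B}"
  have eqs: "equiv E s" unfolding s_def by (rule equiv_partition_on[OF pR])
  have "(x, y) \<in> s" if B: "B \<in> P \<union> Q" and xy: "x \<in> B" "y \<in> B" for B x y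
  proof -
    obtain Y where "Y \<in> R" "B \<subseteq> Y" using PR QR B unfolding refines_def by auto
    then show ?thesis using xy unfolding s_def by auto
  qed
  then have "r \<subseteq> s" unfolding r_def by auto
  then have "r\<^sup>+ \<subseteq> s\<^sup>+" by (rule trancl_mono_subset)
  moreover have "s\<^sup>+ = s" using eqs by (simp add: equiv_def)
  ultimately have rs: "r\<^sup>+ \<subseteq> s" by simp
  have "\<exists>Y \<in> R. X \<subseteq> Y" if X: "X \<in> part_join E P Q" for X
  proof -
    obtain x where x: "x \<in> E" "X = r\<^sup>+ `` {x}" using X unfolding J by (auto elim: quotientE)
    obtain Y where Y: "Y \<in> R" "x \<in> Y" using x partition_onD1[OF pR] by blast
    have "y \<in> Y" if xy: "(x, y) \<in> s" for y
    proof -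
      obtain B where "B \<in> R" "x \<in> B" "y \<in> B" using xy unfolding s_def by blast
      moreover from this have "B = Y" using Y disjointD[OF partition_onD2[OF pR]] by blast
      ultimately show ?thesis by simp
    qed
    then have "X \<subseteq> Y" using x rs by auto
    then show ?thesis using Y by blast
  qed
  then show "refines E (part_join E P Q) R"
    unfolding refines_def using pJ pR by blast
qed

text \<open>The number \<open>L[\<pi>\<^sub>1, \<pi>\<^sub>2; \<rho>]\<close>, for partitions of \<open>E\<close>.\<close>

definition L_defect :: "'a set \<Rightarrow> 'a set set \<Rightarrow> 'a set set \<Rightarrow> 'a set set \<Rightarrow> int" where
  "L_defect E \<pi>1 \<pi>2 \<rho> =
     int (card \<rho>) - int (card \<pi>1) - int (card \<pi>2) + int (card (part_join E \<pi>1 \<pi>2))"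

text \<open>\<open>\<P>\<^sup>*(I)\<close>.\<close>

definition nontriv_partitions :: "'a set \<Rightarrow> 'a set set set" where
  "nontriv_partitions I = {P. partition_on I P \<and> card P < card I}"

section \<open>Permutations and their genus\<close>

definition cycle_partition :: "'a set \<Rightarrow> ('a \<Rightarrow> 'a) \<Rightarrow> 'a set set" where
  "cycle_partition E \<sigma> = orbit \<sigma> ` E"

definition num_cycles :: "'a set \<Rightarrow> ('a \<Rightarrow> 'a) \<Rightarrow> nat" where
  "num_cycles E \<sigma> = card (cycle_partition E \<sigma>)"

definition cycle_lengths :: "'a set \<Rightarrow> ('a \<Rightarrow> 'a) \<Rightarrow> nat multiset" where
  "cycle_lengths E \<sigma> = image_mset card (mset_set (cycle_partition E \<sigma>))"

text \<open>
  The solution \<open>g\<close> of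
  \<open>#(\<sigma>\<^sub>1) + #(\<sigma>\<^sub>2) + #(\<sigma>\<^sub>1 \<sigma>\<^sub>2) - |E| = 2 #(\<Pi>(\<sigma>\<^sub>1) \<or> \<Pi>(\<sigma>\<^sub>2)) - 2 g\<close>.
  It is rational-valued so that the equation is solved exactly, without presupposing that \<open>g\<close>
  is an integer.
\<close>

definition genus :: "'a set \<Rightarrow> ('a \<Rightarrow> 'a) \<Rightarrow> ('a \<Rightarrow> 'a) \<Rightarrow> rat" where
  "genus E \<sigma>1 \<sigma>2 =
     of_nat (card (part_join E (cycle_partition E \<sigma>1) (cycle_partition E \<sigma>2)))
     - (of_nat (num_cycles E \<sigma>1) + of_nat (num_cycles E \<sigma>2) + of_nat (num_cycles E (\<sigma>1 \<circ> \<sigma>2))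
        - of_nat (card E)) / 2"

text \<open>Non-crossing permutations relative to a cyclic permutation \<open>\<gamma>\<close> of \<open>E\<close>.\<close>

definition NC :: "'a set \<Rightarrow> ('a \<Rightarrow> 'a) \<Rightarrow> ('a \<Rightarrow> 'a) set" where
  "NC E \<gamma> = {\<tau>. \<tau> permutes E \<and> genus E \<tau> (inv \<gamma>) = 0}"

text \<open>Planar non-separable hypermaps.\<close>

definition NS :: "'a set \<Rightarrow> ('a \<Rightarrow> 'a) \<Rightarrow> ('a \<Rightarrow> 'a) set" where
  "NS E \<tau> = {\<nu>. \<nu> permutes E \<and> genus E \<nu> \<tau> = 0
     \<and> part_join E (cycle_partition E \<tau>) (cycle_partition E \<nu>) = {E}
     \<and> (\<forall>b\<in>E. \<forall>d\<in>E. b \<noteq> d \<and> d \<in> orbit \<tau> b \<longrightarrow>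
          part_join E (cycle_partition E (\<tau> \<circ> transpose b d)) (cycle_partition E \<nu>) = {E})}"

section \<open>Multiplicative functions\<close>

text \<open>
  The ground sets are the nonempty finite sets of natural numbers. A partition determines its
  ground set, so \<open>f\<close> takes just the partition and the permutation; its values on other arguments
  are irrelevant. The second clause says that \<open>f\<close> on a one-block partition depends only on the
  cycle lengths, which is also how its values on different ground sets are related.
\<close>

definition multiplicative :: "(nat set set \<Rightarrow> (nat \<Rightarrow> nat) \<Rightarrow> 'c::comm_ring_1) \<Rightarrow> bool" where
  "multiplicative f \<longleftrightarrow>
     (\<forall>E \<pi> \<sigma>. finite E \<and> E \<noteq> {} \<and> \<sigma> permutes E \<and> refines E (cycle_partition E \<sigma>) \<pi> \<longrightarrow>
        f \<pi> \<sigma> = (\<Prod>G\<in>\<pi>. f {G} (perm_restrict \<sigma> G)))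
   \<and> (\<forall>E E' \<sigma> \<sigma>'. finite E \<and> E \<noteq> {} \<and> \<sigma> permutes E \<and> finite E' \<and> E' \<noteq> {} \<and> \<sigma>' permutes E'
        \<and> cycle_lengths E \<sigma> = cycle_lengths E' \<sigma>' \<longrightarrow> f {E} \<sigma> = f {E'} \<sigma>')"

section \<open>The permutation \<open>\<gamma>\<^sub>\<lambda>\<close> and the two sums\<close>

text \<open>The lengths \<open>\<lambda>\<^sub>1, \<dots>, \<lambda>\<^sub>p\<close> are the values at \<open>1, \<dots>, p\<close> of a function \<open>l\<close>.\<close>

definition cycle_supp :: "(nat \<Rightarrow> nat) \<Rightarrow> nat \<Rightarrow> nat set" where
  "cycle_supp l i = {(\<Sum>j=1..<i. l j)<..(\<Sum>j=1..i. l j)}"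

definition gamma :: "nat \<Rightarrow> (nat \<Rightarrow> nat) \<Rightarrow> nat \<Rightarrow> nat" where
  "gamma p l =
     foldr (\<circ>) (map (\<lambda>i. cycle_of_list (sorted_list_of_set (cycle_supp l i))) [1..<Suc p]) id"

definition beta ::
  "(nat set set \<Rightarrow> (nat \<Rightarrow> nat) \<Rightarrow> 'c::comm_ring_1) \<Rightarrow> nat \<Rightarrow> (nat \<Rightarrow> nat) \<Rightarrow> 'c" where
  "beta f p l =
    (let E = {1..(\<Sum>i=1..p. l i)}; \<gamma> = gamma p l; cyc = cycle_partition E in
     \<Sum>\<tau> | \<tau> permutes E \<and> genus E \<gamma> (inv \<tau>) = 0.
     \<Sum>\<pi>' | refines E (cyc \<tau>) \<pi>' \<and> part_join E \<pi>' (cyc \<gamma>) = {E}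
           \<and> L_defect E \<pi>' (part_join E (cyc \<gamma>) (cyc \<tau>)) (cyc \<tau>) = 0.
       f \<pi>' \<tau>)"

text \<open>The products \<open>\<tau>\<^sub>1 \<times> \<cdots> \<times> \<tau>\<^sub>p\<close> with \<open>\<tau>\<^sub>i \<in> NC(\<lambda>\<^sub>i)\<close>.\<close>

definition NC_product :: "nat \<Rightarrow> (nat \<Rightarrow> nat) \<Rightarrow> (nat \<Rightarrow> nat) set" where
  "NC_product p l =
    (let E = {1..(\<Sum>i=1..p. l i)} in
     {\<tau>. \<tau> permutes E \<and> refines E (cycle_partition E \<tau>) (cycle_partition E (gamma p l))
       \<and> (\<forall>i\<in>{1..p}. perm_restrict \<tau> (cycle_supp l i)
                        \<in> NC (cycle_supp l i) (perm_restrict (gamma p l) (cycle_supp l i)))})"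

definition met_cycles :: "nat \<Rightarrow> (nat \<Rightarrow> nat) \<Rightarrow> nat set \<Rightarrow> nat set" where
  "met_cycles p l B = {i \<in> {1..p}. B \<inter> cycle_supp l i \<noteq> {}}"

text \<open>
  \<open>\<bar>g\<^sub>\<pi>\<^sub>b(\<tau>\<^sub>B)\<close>, where \<open>\<tau>B\<close> stands for \<open>\<tau>\<close> restricted to \<open>B\<close> and \<open>\<pi>b\<close> for the partition of the set
  of cycles met by \<open>B\<close>. The ground set of \<open>\<tau>\<^sub>G\<close> is \<open>S G\<close>, the union over \<open>i \<in> G\<close> of the sets
  \<open>B \<inter> cycle_supp l i\<close>; since the restriction of \<open>\<tau>\<^sub>G\<close> to each of them is that of \<open>\<tau>\<close>, the product
  \<open>\<tau>\<^sub>G\<close> is \<open>perm_restrict \<tau>B (S G)\<close>. A product of permutations \<open>\<nu>\<^sub>G\<close> of the disjoint sets \<open>S G\<close> is a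
  permutation of \<open>B\<close> whose restriction to each \<open>S G\<close> is \<open>\<nu>\<^sub>G\<close>.
\<close>

definition g_bar ::
  "(nat set set \<Rightarrow> (nat \<Rightarrow> nat) \<Rightarrow> 'c::comm_ring_1) \<Rightarrow> (nat \<Rightarrow> nat) \<Rightarrow> nat set
    \<Rightarrow> nat set set \<Rightarrow> (nat \<Rightarrow> nat) \<Rightarrow> 'c" where
  "g_bar f l B \<pi>b \<tau>B =
    (let S = (\<lambda>G. \<Union>i\<in>G. B \<inter> cycle_supp l i); cyc = cycle_partition B in
     \<Sum>\<nu> | \<nu> permutes B \<and> (\<forall>G\<in>\<pi>b. perm_restrict \<nu> (S G) \<in> NS (S G) (perm_restrict \<tau>B (S G))).
     \<Sum>\<pi>'' | refines B (cyc \<nu>) \<pi>'' \<and> part_join B \<pi>'' (cyc \<tau>B) = {B}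
            \<and> L_defect B \<pi>'' (part_join B (cyc \<tau>B) (cyc \<nu>)) (cyc \<nu>) = 0.
       f \<pi>'' \<nu>)"

text \<open>\<open>g(1\<^sub>B, \<tau>\<^sub>B)\<close>; it depends on \<open>l\<close> through the way the cycles of \<open>\<gamma>\<^sub>\<lambda>\<close> cut \<open>B\<close>.\<close>

definition g_block ::
  "(nat set set \<Rightarrow> (nat \<Rightarrow> nat) \<Rightarrow> 'c::comm_ring_1) \<Rightarrow> nat \<Rightarrow> (nat \<Rightarrow> nat) \<Rightarrow> nat set
    \<Rightarrow> (nat \<Rightarrow> nat) \<Rightarrow> 'c" where
  "g_block f p l B \<tau>B =
     f {B} \<tau>B + (\<Sum>\<pi>b \<in> nontriv_partitions (met_cycles p l B). g_bar f l B \<pi>b \<tau>B)"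

definition g_fun ::
  "(nat set set \<Rightarrow> (nat \<Rightarrow> nat) \<Rightarrow> 'c::comm_ring_1) \<Rightarrow> nat \<Rightarrow> (nat \<Rightarrow> nat) \<Rightarrow> nat set set
    \<Rightarrow> (nat \<Rightarrow> nat) \<Rightarrow> 'c" where
  "g_fun f p l \<pi>' \<tau> = (\<Prod>B\<in>\<pi>'. g_block f p l B (perm_restrict \<tau> B))"

end

theory Submission
  imports Defs
begin

text \<open>
  Both sides are sums of \<open>f(\<pi>'', \<nu>)\<close> over pairs \<open>(\<nu>, \<pi>'')\<close>, and the proof compares the index sets.
  Write \<open>\<gamma>\<close> for \<open>\<gamma>\<^sub>\<lambda>\<close>.

  On the left, \<open>\<nu>\<close> is the inverse of the summation variable \<open>\<tau>\<close>; this changes neither the cycle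
  partition nor the value of \<open>f\<close>. So the left side runs over the planar hypermaps \<open>(\<gamma>, \<nu>)\<close>, with
  the cycles of \<open>\<gamma>\<close> as white vertices, together with suitable \<open>\<pi>'' \<ge> \<Pi>(\<nu>)\<close>.

  On the right, the summand \<open>f(1\<^sub>B, \<tau>\<^sub>B)\<close> is the term of the sum over \<open>\<pi>\<^sub>b\<close> that belongs to the
  partition of \<open>I\<^sub>B\<close> into singletons: a single cycle \<open>c\<close> admits only the non-separable hypermap
  \<open>c\<^sup>-\<^sup>1\<close> (\<open>NS_single_cycle\<close>). Also, \<open>\<pi>\<^sub>b\<close> is determined by \<open>\<nu>\<close>, because its blocks are read off
  from \<open>\<Pi>(\<tau>) \<or> \<Pi>(\<nu>)\<close>. Hence each factor is a single sum over the non-separable data of the block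
  (\<open>g_block_eq_sum\<close>), and multiplying out over the blocks of \<open>\<pi>'\<close> glues these data to permutations
  and partitions of the whole set (\<open>sum_glued_data\<close>). The right side becomes a sum over quadruples
  \<open>(\<tau>, \<pi>', \<nu>, \<pi>'')\<close> in which \<open>\<tau>\<close> cuts each cycle of \<open>\<gamma>\<close> into non-crossing pieces such that every
  component of \<open>(\<tau>, \<nu>)\<close> is planar and non-separable, and \<open>\<pi>' = \<pi>'' \<or> \<Pi>(\<tau>)\<close>.

  The theorem thus says that a planar hypermap \<open>(\<gamma>, \<nu>)\<close> decomposes in exactly one way into
  non-separable components, by cutting its white vertices. Existence
  (\<open>nonseparable_cutting_exists\<close>) is the process of splitting a cycle of \<open>\<gamma>\<close> whenever this
  disconnects the map. For uniqueness (\<open>nonseparable_cutting_unique\<close>), a split of \<open>\<gamma>\<close> that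
  disconnects the map must be refined by every non-separable cutting \<open>\<tau>\<close>, since otherwise it would
  disconnect some component of \<open>(\<tau>, \<nu>)\<close>; and if no such split exists then \<open>\<tau> = \<gamma>\<close>.

  Everything numerical rests on two inequalities. Semimodularity of the partition lattice
  (\<open>partition_semimodular\<close>) says \<open>L \<ge> 0\<close>, where \<open>L[\<pi>\<^sub>1, \<pi>\<^sub>2; \<rho>]\<close> is the number of independent cycles
  of the bipartite graph whose vertices are the blocks of \<open>\<pi>\<^sub>1\<close> and \<open>\<pi>\<^sub>2\<close> and whose edges are the blocks
  of \<open>\<rho>\<close>, so that \<open>L = 0\<close> means that this graph is a forest. Nonnegativity of the genus
  (\<open>genus_inequality\<close>) supplies the opposite bound whenever subadditivity of the length
  \<open>|E| - #\<close> bounds a number of cycles from one side. With these, the defect conditions of the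
  two sides translate into each other (\<open>cutting_defects\<close>, \<open>cutting_from_defects\<close>).
\<close>

section \<open>Blocks, refinement and joins\<close>

text \<open>For a partition \<open>P\<close> of a set containing \<open>x\<close> this is the block of \<open>x\<close>. As a union it
  is a total function, and it depends on \<open>P\<close> monotonically.\<close>

definition block :: "'a set set \<Rightarrow> 'a \<Rightarrow> 'a set" where
  "block P x = \<Union>{B \<in> P. x \<in> B}"

lemma block_eq: "partition_on E P \<Longrightarrow> B \<in> P \<Longrightarrow> x \<in> B \<Longrightarrow> block P x = B"
  unfolding block_def partition_on_def disjoint_def by blast

lemma block_in:
  assumes "partition_on E P" "x \<in> E"
  shows "block P x \<in> P" "x \<in> block P x"
proof -
  obtain B where "B \<in> P" "x \<in> B" using assms unfolding partition_on_def by blast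
  then show "block P x \<in> P" "x \<in> block P x" using block_eq[OF assms(1)] by auto
qed

lemma block_subset: "partition_on E P \<Longrightarrow> block P x \<subseteq> E"
  unfolding block_def partition_on_def by blast

lemma block_eq_of_mem: "partition_on E P \<Longrightarrow> y \<in> block P x \<Longrightarrow> block P y = block P x"
  unfolding block_def partition_on_def disjoint_def by blast

lemma block_sym: "partition_on E P \<Longrightarrow> x \<in> E \<Longrightarrow> y \<in> block P x \<Longrightarrow> x \<in> block P y"
  by (simp add: block_eq_of_mem block_in)

lemma refines_partition:
  assumes "refines E P Q" shows "partition_on E P" "partition_on E Q"
  using assms unfolding refines_def by auto

lemma refines_block_subset: "refines E P Q \<Longrightarrow> block P x \<subseteq> block Q x"
  unfolding block_def refines_def by blast

lemma refines_blockI: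
  assumes "partition_on E P" "partition_on E Q"
    and "\<And>x y. x \<in> E \<Longrightarrow> y \<in> block P x \<Longrightarrow> y \<in> block Q x"
  shows "refines E P Q"
  unfolding refines_def
proof (intro conjI ballI assms(1,2))
  fix X assume X: "X \<in> P"
  then obtain x where x: "x \<in> X" "x \<in> E"
    using assms(1) unfolding partition_on_def by (metis Union_iff ex_in_conv)
  then have "X \<subseteq> block Q x" using assms(3)[of x] block_eq[OF assms(1) X] by auto
  then show "\<exists>Y\<in>Q. X \<subseteq> Y" using block_in[OF assms(2) x(2)] by blast
qed

lemma refines_subset_block:
  assumes "refines E P Q" "B \<in> P" "C \<in> Q" "x \<in> B" "x \<in> C"
  shows "B \<subseteq> C"
  using assms block_eq refines_block_subset refines_partition by metis

lemma partition_on_part_join: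
  assumes "partition_on E P" "partition_on E Q"
  shows "partition_on E (part_join E P Q)"
  using part_join_is_join(1)[OF assms] refines_partition by blast

lemma part_join_eqI:
  assumes "refines E P J" "refines E Q J"
    and "\<And>R. refines E P R \<Longrightarrow> refines E Q R \<Longrightarrow> refines E J R"
  shows "part_join E P Q = J"
proof -
  note PQ = refines_partition(1)[OF assms(1)] refines_partition(1)[OF assms(2)]
  show ?thesis
    by (rule refines_asym)
       (use part_join_is_join[OF PQ] assms in blast)+
qed

lemma part_join_absorb: "refines E P Q \<Longrightarrow> part_join E P Q = Q"
  by (rule part_join_eqI) (auto intro: refines_refl refines_partition)

lemma part_join_commute: "part_join E P Q = part_join E Q P"
  unfolding part_join_def by (simp add: Un_commute)

lemma part_join_assoc:
  assumes P: "partition_on E P" and Q: "partition_on E Q" and R: "partition_on E R"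
  shows "part_join E (part_join E P Q) R = part_join E P (part_join E Q R)"
proof (rule part_join_eqI)
  note PQ = part_join_is_join[OF P Q] and QR = part_join_is_join[OF Q R]
  note J = part_join_is_join[OF P partition_on_part_join[OF Q R]]
  have "refines E Q (part_join E P (part_join E Q R))"
    using refines_trans[OF QR(1) J(2)] .
  then show "refines E (part_join E P Q) (part_join E P (part_join E Q R))"
    using PQ(3)[OF J(1)] by blast
  show "refines E R (part_join E P (part_join E Q R))" using refines_trans[OF QR(2) J(2)] .
  fix S assume S: "refines E (part_join E P Q) S" "refines E R S"
  show "refines E (part_join E P (part_join E Q R)) S"
    by (intro J(3) QR(3) S) (use S PQ refines_trans in blast)+
qed

lemma refines_one_block: "partition_on E P \<Longrightarrow> E \<noteq> {} \<Longrightarrow> refines E P {E}"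
  unfolding refines_def partition_on_def by auto

lemma refines_singletons: "partition_on E P \<Longrightarrow> refines E ((\<lambda>x. {x}) ` E) P"
  unfolding refines_def using partition_on_singletons by (auto simp: partition_on_def)

lemma one_blockI:
  assumes "partition_on E P" "E \<in> P"
  shows "P = {E}"
proof -
  have "X = E" if "X \<in> P" for X
  proof -
    have "X \<noteq> {}" "X \<subseteq> E" using that assms(1) unfolding partition_on_def by auto
    then obtain x where "x \<in> X" "x \<in> E" by blast
    then show ?thesis using block_eq[OF assms(1) that] block_eq[OF assms] by blast
  qed
  then show ?thesis using assms(2) by blast
qed

text \<open>A set that is a union of blocks of \<open>P\<close> and of \<open>Q\<close>, together with its complement, is a common
  upper bound of \<open>P\<close> and \<open>Q\<close>. This is how connectedness of a hypermap is refuted later.\<close>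

lemma block_join_invariant:
  assumes P: "partition_on E P" and Q: "partition_on E Q" and S: "S \<subseteq> E"
    and inv: "\<And>x. x \<in> S \<Longrightarrow> block P x \<subseteq> S" "\<And>x. x \<in> S \<Longrightarrow> block Q x \<subseteq> S"
    and x: "x \<in> S"
  shows "block (part_join E P Q) x \<subseteq> S"
proof -
  define R where "R = {S, E - S} - {{}}"
  have R: "partition_on E R" unfolding R_def partition_on_def disjoint_def using S by auto
  have bR: "block R x = S" if "x \<in> S" for x
    using block_eq[OF R, of S x] that unfolding R_def by auto
  have bR': "block R x = E - S" if "x \<in> E - S" for x
    using block_eq[OF R, of "E - S" x] that unfolding R_def by auto
  have *: "refines E T R" if T: "partition_on E T" and i: "\<And>x. x \<in> S \<Longrightarrow> block T x \<subseteq> S" for T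
  proof (rule refines_blockI[OF T R])
    fix x y assume x: "x \<in> E" and y: "y \<in> block T x"
    have yE: "y \<in> E" using block_subset[OF T] y by blast
    show "y \<in> block R x"
    proof (cases "x \<in> S")
      case True then show ?thesis using i y bR by blast
    next
      case False
      then have "y \<notin> S" using i[of y] block_sym[OF T x y] by blast
      then show ?thesis using bR' False x yE by simp
    qed
  qed
  have "refines E (part_join E P Q) R"
    using part_join_is_join(3)[OF P Q] * P Q inv by blast
  then have "block (part_join E P Q) x \<subseteq> block R x" by (rule refines_block_subset)
  also have "block R x = S" using bR x .
  finally show ?thesis .
qed

section \<open>Merging two blocks\<close>

text \<open>Merging two distinct blocks gives the covers in the partition lattice, and inductions on
  partitions climb along such steps. For \<open>x\<close> and \<open>y\<close> in a common block the union is that block, so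
  the partition stays the same.\<close>

definition merge :: "'a set set \<Rightarrow> 'a \<Rightarrow> 'a \<Rightarrow> 'a set set" where
  "merge P x y = insert (block P x \<union> block P y) (P - {block P x, block P y})"

lemma merge_same: "partition_on E P \<Longrightarrow> x \<in> E \<Longrightarrow> y \<in> block P x \<Longrightarrow> merge P x y = P"
  unfolding merge_def using block_in block_eq_of_mem by fastforce

lemma partition_on_merge:
  assumes P: "partition_on E P" and "x \<in> E" "y \<in> E"
  shows "partition_on E (merge P x y)"
proof -
  note b = block_in[OF P assms(2)] block_in[OF P assms(3)]
  let ?U = "block P x \<union> block P y" and ?Q = "P - {block P x, block P y}"
  have D: "X \<inter> Y = {}" if "X \<in> P" "Y \<in> P" "X \<noteq> Y" for X Y
    using disjointD[OF partition_onD2[OF P] that] .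
  have QU: "Z \<inter> ?U = {}" if "Z \<in> ?Q" for Z
    using D[of Z "block P x"] D[of Z "block P y"] that b by blast
  have "\<Union>(merge P x y) = \<Union>(insert (block P x) (insert (block P y) P))"
    unfolding merge_def by blast
  also have "\<dots> = E" using partition_onD1[OF P] b by (simp add: insert_absorb)
  finally have "\<Union>(merge P x y) = E" .
  moreover have "{} \<notin> merge P x y" using partition_onD3[OF P] b(2) unfolding merge_def by auto
  moreover have "disjoint (merge P x y)"
  proof (rule disjointI)
    fix X Y assume "X \<in> merge P x y" "Y \<in> merge P x y" "X \<noteq> Y"
    then consider "X = ?U" "Y \<in> ?Q" | "Y = ?U" "X \<in> ?Q" | "X \<in> P" "Y \<in> P"
      unfolding merge_def by blast
    then show "X \<inter> Y = {}"
      using QU[of X] QU[of Y] D[of X Y] \<open>X \<noteq> Y\<close> by cases auto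
  qed
  ultimately show ?thesis unfolding partition_on_def by blast
qed

lemma block_merge:
  assumes P: "partition_on E P" and xy: "x \<in> E" "y \<in> E" and z: "z \<in> E"
  shows "block (merge P x y) z =
    (if z \<in> block P x \<union> block P y then block P x \<union> block P y else block P z)"
proof (cases "z \<in> block P x \<union> block P y")
  case True
  then show ?thesis using block_eq[OF partition_on_merge[OF P xy], of "block P x \<union> block P y" z]
    unfolding merge_def by auto
next
  case False
  then have "block P z \<in> merge P x y" using block_in[OF P z] unfolding merge_def by blast
  then show ?thesis using block_eq[OF partition_on_merge[OF P xy], of "block P z" z] False
    block_in[OF P z] by auto
qed

lemma refines_merge:
  assumes P: "partition_on E P" and xy: "x \<in> E" "y \<in> E"
  shows "refines E P (merge P x y)"
proof (rule refines_blockI[OF P partition_on_merge[OF assms]])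
  fix z w assume "z \<in> E" "w \<in> block P z"
  moreover from this have "block P z = block P x \<or> block P z = block P y"
    if "z \<in> block P x \<union> block P y"
    using that block_eq_of_mem[OF P] by blast
  ultimately show "w \<in> block (merge P x y) z"
    by (auto simp: block_merge[OF P xy])
qed

lemma merge_least:
  assumes PR: "refines E P R" and xy: "x \<in> E" "y \<in> block R x"
  shows "refines E (merge P x y) R"
proof -
  note P = refines_partition[OF PR]
  have y: "y \<in> E" using xy block_subset[OF P(2)] by blast
  have 1: "block P x \<union> block P y \<subseteq> block R x"
    using refines_block_subset[OF PR] block_eq_of_mem[OF P(2) xy(2)] by blast
  show ?thesis
  proof (rule refines_blockI[OF partition_on_merge[OF P(1) xy(1) y] P(2)])
    fix z w assume z: "z \<in> E" "w \<in> block (merge P x y) z"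
    show "w \<in> block R z"
    proof (cases "z \<in> block P x \<union> block P y")
      case True
      then have "z \<in> block R x" "w \<in> block R x"
        using 1 z by (auto simp: block_merge[OF P(1) xy(1) y])
      then show ?thesis using block_eq_of_mem[OF P(2)] by blast
    next
      case False
      then show ?thesis using z refines_block_subset[OF PR]
        by (auto simp: block_merge[OF P(1) xy(1) y])
    qed
  qed
qed

lemma merge_joined: 
  assumes "partition_on E P" "x \<in> E" "y \<in> E"
  shows "y \<in> block (merge P x y) x"
  using assms by (simp add: block_merge block_in)

lemma part_join_merge:
  assumes P: "partition_on E P" and Q: "partition_on E Q" and xy: "x \<in> E" "y \<in> E"
  shows "part_join E (merge P x y) Q = merge (part_join E P Q) x y"
proof (rule part_join_eqI)
  note J = part_join_is_join[OF P Q] and pJ = partition_on_part_join[OF P Q]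
  note m = refines_merge[OF pJ xy]
  show "refines E (merge P x y) (merge (part_join E P Q) x y)"
    by (intro merge_least refines_trans[OF J(1) m] xy merge_joined[OF pJ])
  show "refines E Q (merge (part_join E P Q) x y)" by (rule refines_trans[OF J(2) m])
  fix R assume R: "refines E (merge P x y) R" "refines E Q R"
  have "refines E P R" using refines_trans[OF refines_merge[OF P xy] R(1)] .
  moreover have "y \<in> block R x"
    using refines_block_subset[OF R(1)] merge_joined[OF P xy] by blast
  ultimately show "refines E (merge (part_join E P Q) x y) R"
    by (intro merge_least J(3) R xy)
qed

lemma card_merge:
  assumes fin: "finite E" and P: "partition_on E P" and xy: "x \<in> E" "y \<in> E"
  shows "card P = card (merge P x y) + (if y \<in> block P x then 0 else 1)"
proof (cases "y \<in> block P x")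
  case True then show ?thesis using merge_same[OF P xy(1)] by simp
next
  case False
  have fP: "finite P" using fin P finite_elements by blast
  note b = block_in[OF P xy(1)] block_in[OF P xy(2)]
  have ne: "block P x \<noteq> block P y" using False b by blast
  have "block P x \<union> block P y \<notin> P - {block P x, block P y}"
    using block_eq[OF P, of "block P x \<union> block P y" x] b by blast
  then have "card (merge P x y) = Suc (card (P - {block P x, block P y}))"
    unfolding merge_def using fP by simp
  moreover have "card (P - {block P x, block P y}) = card P - 2"
    using b ne by (subst card_Diff_subset) auto
  moreover have "card P \<ge> 2"
    using card_mono[OF fP, of "{block P x, block P y}"] b ne by auto
  ultimately show ?thesis using False by auto
qed

lemma refines_card_le:
  assumes fin: "finite E" and PQ: "refines E P Q"
  shows "card Q \<le> card P"
proof -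
  note p = refines_partition[OF PQ]
  have fP: "finite P" using fin p finite_elements by blast
  have "Q \<subseteq> (\<lambda>X. block Q (SOME x. x \<in> X)) ` P"
  proof
    fix Y assume Y: "Y \<in> Q"
    then obtain y where y: "y \<in> Y" "y \<in> E" using p(2) unfolding partition_on_def by (metis Union_iff ex_in_conv)
    have "(SOME x. x \<in> block P y) \<in> block P y" using block_in(2)[OF p(1) y(2)] by (metis someI)
    then have "(SOME x. x \<in> block P y) \<in> Y"
      using refines_block_subset[OF PQ] block_eq[OF p(2) Y y(1)] by blast
    then show "Y \<in> (\<lambda>X. block Q (SOME x. x \<in> X)) ` P"
      using block_eq[OF p(2) Y] block_in(1)[OF p(1) y(2)] by (metis image_eqI)
  qed
  then show ?thesis using fP by (meson card_image_le card_mono finite_imageI le_trans)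
qed

lemma refines_merge_step:
  assumes PQ: "refines E P Q" and ne: "P \<noteq> Q"
  obtains x y where "x \<in> E" "y \<in> block Q x" "y \<notin> block P x"
proof -
  note p = refines_partition[OF PQ]
  have "\<not> refines E Q P" using refines_asym[OF PQ] ne by blast
  then show ?thesis using refines_blockI[OF p(2,1)] that by blast
qed

text \<open>A strict refinement can be coarsened by a merge that strictly lowers the number of blocks; this
  turns numerical equalities into equalities of partitions.\<close>

lemma refines_card_eq:
  assumes fin: "finite E" and PQ: "refines E P Q" and c: "card P \<le> card Q"
  shows "P = Q"
proof (rule ccontr)
  assume "P \<noteq> Q"
  then obtain x y where xy: "x \<in> E" "y \<in> block Q x" "y \<notin> block P x"
    using refines_merge_step[OF PQ] by blast
  note p = refines_partition[OF PQ]
  have y: "y \<in> E" using xy block_subset[OF p(2)] by blast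
  have "card Q \<le> card (merge P x y)" using refines_card_le[OF fin merge_least[OF PQ xy(1,2)]] .
  then show False using card_merge[OF fin p(1) xy(1) y] xy(3) c by simp
qed

section \<open>Semimodularity and the defect\<close>

text \<open>Induction on \<open>R\<close>, climbing towards \<open>P\<close>: a merge inside a block of \<open>P\<close> lowers \<open>card R\<close> by one,
  lowers \<open>card Q\<close> by at most one when performed on \<open>Q\<close> as well, and leaves \<open>P \<or> Q\<close> as it is.\<close>

lemma partition_semimodular:
  assumes fin: "finite E" and "refines E R P" "refines E R Q"
  shows "card P + card Q \<le> card R + card (part_join E P Q)"
  using assms(2,3)
proof (induction "card R" arbitrary: R Q rule: less_induct)
  case less
  note p = refines_partition[OF less.prems(1)] refines_partition[OF less.prems(2)]
  show ?case
  proof (cases "R = P")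
    case True
    then show ?thesis using part_join_absorb less.prems(2) by fastforce
  next
    case False
    then obtain x y where xy: "x \<in> E" "y \<in> block P x" "y \<notin> block R x"
      using refines_merge_step[OF less.prems(1)] by blast
    have y: "y \<in> E" using xy block_subset[OF p(2)] by blast
    have cR: "card R = card (merge R x y) + 1" using card_merge[OF fin p(1) xy(1) y] xy(3) by simp
    have 1: "refines E (merge R x y) P" using merge_least[OF less.prems(1) xy(1,2)] .
    have 2: "refines E (merge R x y) (merge Q x y)"
      using merge_least[OF refines_trans[OF less.prems(2) refines_merge[OF p(4) xy(1) y]] xy(1)
          merge_joined[OF p(4) xy(1) y]] .
    have j: "y \<in> block (part_join E P Q) x"
      using refines_block_subset[OF part_join_is_join(1)[OF p(2,4)]] xy(2) by blast
    have "part_join E P (merge Q x y) = part_join E P Q"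
      using part_join_merge[OF p(4,2) xy(1) y] merge_same[OF partition_on_part_join[OF p(2,4)] xy(1) j]
      by (simp add: part_join_commute)
    then have "card P + card (merge Q x y) \<le> card (merge R x y) + card (part_join E P Q)"
      using less.hyps[OF _ 1 2] cR by simp
    moreover have "card Q \<le> card (merge Q x y) + 1" using card_merge[OF fin p(4) xy(1) y] by simp
    ultimately show ?thesis using cR by linarith
  qed
qed

lemma L_defect_nonneg:
  assumes "finite E" "refines E R P" "refines E R Q"
  shows "0 \<le> L_defect E P Q R"
  using partition_semimodular[OF assms] unfolding L_defect_def by linarith

lemma L_defect_commute: "L_defect E P Q R = L_defect E Q P R"
  unfolding L_defect_def by (simp add: part_join_commute)

text \<open>Splitting vertices of a forest leaves a forest: the defects satisfy
  \<open>L[P, Q; R] = L[S, Q; R] + L[P, S \<or> Q; S]\<close> for \<open>R \<le> S \<le> P\<close>, and both summands are nonnegative.\<close>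

lemma L_defect_refine:
  assumes fin: "finite E" and RS: "refines E R S" and SP: "refines E S P" and RQ: "refines E R Q"
    and L: "L_defect E P Q R = 0"
  shows "L_defect E S Q R = 0"
proof -
  note p = refines_partition[OF RS] refines_partition[OF SP] refines_partition[OF RQ]
  have "refines E S (part_join E S Q)" using part_join_is_join(1)[OF p(2,6)] .
  then have "0 \<le> L_defect E P (part_join E S Q) S" by (rule L_defect_nonneg[OF fin SP])
  moreover have "part_join E P (part_join E S Q) = part_join E P Q"
    using part_join_assoc[OF p(4,2,6)] part_join_absorb[OF SP] by (simp add: part_join_commute)
  moreover have "0 \<le> L_defect E S Q R" by (rule L_defect_nonneg[OF fin RS RQ])
  ultimately show ?thesis using L unfolding L_defect_def by simp
qed

text \<open>A forest has no double edges: if two blocks of \<open>R\<close> joined the same two vertices, merging them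
  would make the defect negative.\<close>

lemma L_defect_0_unique_edge:
  assumes fin: "finite E" and RP: "refines E R P" and RQ: "refines E R Q"
    and L: "L_defect E P Q R = 0" and x: "x \<in> E" and y: "y \<in> block P x" "y \<in> block Q x"
  shows "y \<in> block R x"
proof (rule ccontr)
  assume n: "y \<notin> block R x"
  note p = refines_partition[OF RP]
  have yE: "y \<in> E" using y(1) block_subset[OF p(2)] by blast
  have "0 \<le> L_defect E P Q (merge R x y)"
    by (intro L_defect_nonneg fin merge_least RP RQ x y)
  then show False using L card_merge[OF fin p(1) x yE] n unfolding L_defect_def by simp
qed

section \<open>Restriction to a block of a coarser partition\<close>

definition blocks_in :: "'a set set \<Rightarrow> 'a set \<Rightarrow> 'a set set" where
  "blocks_in P B = {X \<in> P. X \<subseteq> B}"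

lemma partition_on_blocks_in: "refines E P R \<Longrightarrow> B \<in> R \<Longrightarrow> partition_on B (blocks_in P B)"
  unfolding blocks_in_def by (rule refines_obtains_subset)

lemma block_blocks_in:
  assumes PR: "refines E P R" and B: "B \<in> R" and x: "x \<in> B"
  shows "block (blocks_in P B) x = block P x"
proof -
  have xE: "x \<in> E" using refines_partition(2)[OF PR] B x unfolding partition_on_def by blast
  have "block P x \<subseteq> B"
    using refines_block_subset[OF PR] block_eq[OF refines_partition(2)[OF PR] B x] by blast
  then have "block P x \<in> blocks_in P B"
    unfolding blocks_in_def using block_in[OF refines_partition(1)[OF PR] xE] by blast
  then show ?thesis
    using block_eq[OF partition_on_blocks_in[OF PR B]] block_in(2)[OF refines_partition(1)[OF PR] xE]
    by blast
qed

lemma Union_blocks_in: "refines E P R \<Longrightarrow> (\<Union>B\<in>R. blocks_in P B) = P"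
  unfolding blocks_in_def refines_def by blast

lemma disjoint_blocks_in:
  assumes "refines E P R" "B \<in> R" "C \<in> R" "B \<noteq> C"
  shows "blocks_in P B \<inter> blocks_in P C = {}"
proof (rule ccontr)
  note p = refines_partition[OF assms(1)]
  assume "blocks_in P B \<inter> blocks_in P C \<noteq> {}"
  then obtain X where X: "X \<in> P" "X \<subseteq> B \<inter> C" unfolding blocks_in_def by blast
  moreover have "X \<noteq> {}" using X(1) partition_onD3[OF p(1)] by blast
  ultimately show False using disjointD[OF partition_onD2[OF p(2)] assms(2-4)] by blast
qed

lemma card_blocks_in:
  assumes fin: "finite E" and PR: "refines E P R"
  shows "card P = (\<Sum>B\<in>R. card (blocks_in P B))"
proof -
  note p = refines_partition[OF PR]
  have fR: "finite R" and fP: "finite P" using fin p finite_elements by blast+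
  then have fb: "finite (blocks_in P B)" for B by (simp add: blocks_in_def)
  have "card (\<Union>B\<in>R. blocks_in P B) = (\<Sum>B\<in>R. card (blocks_in P B))"
    by (rule card_UN_disjoint) (use fR fb disjoint_blocks_in[OF PR] in auto)
  then show ?thesis using Union_blocks_in[OF PR] by simp
qed

lemma refines_blocks_in:
  assumes PQ: "refines E P Q" and QR: "refines E Q R" and B: "B \<in> R"
  shows "refines B (blocks_in P B) (blocks_in Q B)"
proof (rule refines_blockI)
  note PR = refines_trans[OF PQ QR]
  show "partition_on B (blocks_in P B)" "partition_on B (blocks_in Q B)"
    using partition_on_blocks_in PR QR B by blast+
  fix x y assume "x \<in> B" "y \<in> block (blocks_in P B) x"
  then show "y \<in> block (blocks_in Q B) x"
    using refines_block_subset[OF PQ] block_blocks_in[OF PR B] block_blocks_in[OF QR B] by blast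
qed

lemma blocks_in_self: "partition_on E R \<Longrightarrow> B \<in> R \<Longrightarrow> blocks_in R B = {B}"
  using partition_on_blocks_in[OF refines_refl, of E R B] unfolding blocks_in_def
  by (intro one_blockI) auto

text \<open>A common upper bound of the two restrictions to \<open>B\<close> has blocks that are closed in the whole
  set as well, since no block of \<open>P\<close> or \<open>Q\<close> leaves \<open>B\<close>.\<close>

lemma part_join_blocks_in:
  assumes PR: "refines E P R" and QR: "refines E Q R" and B: "B \<in> R"
  shows "part_join B (blocks_in P B) (blocks_in Q B) = blocks_in (part_join E P Q) B"
proof (rule part_join_eqI)
  note p = refines_partition(1)[OF PR] refines_partition(1)[OF QR] refines_partition(2)[OF PR]
  note J = part_join_is_join[OF p(1,2)]
  note JR = J(3)[OF PR QR]
  show "refines B (blocks_in P B) (blocks_in (part_join E P Q) B)"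
    "refines B (blocks_in Q B) (blocks_in (part_join E P Q) B)"
    using refines_blocks_in[OF J(1) JR B] refines_blocks_in[OF J(2) JR B] .
  fix S assume S: "refines B (blocks_in P B) S" "refines B (blocks_in Q B) S"
  have BE: "B \<subseteq> E" using p(3) B unfolding partition_on_def by blast
  have inv: "block T x \<subseteq> block S z" 
    if T: "refines E T R" and TS: "refines B (blocks_in T B) S" and x: "z \<in> B" "x \<in> block S z" for T x z
  proof -
    have xB: "x \<in> B" using x block_subset[OF refines_partition(2)[OF S(1)]] by blast
    have "block T x = block (blocks_in T B) x" using block_blocks_in[OF T B xB] by simp
    also have "\<dots> \<subseteq> block S x" by (rule refines_block_subset[OF TS])
    also have "\<dots> = block S z" using block_eq_of_mem[OF refines_partition(2)[OF S(1)] x(2)] .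
    finally show ?thesis .
  qed
  show "refines B (blocks_in (part_join E P Q) B) S"
  proof (rule refines_blockI)
    show "partition_on B (blocks_in (part_join E P Q) B)" "partition_on B S"
      using partition_on_blocks_in[OF JR B] refines_partition[OF S(1)] by blast+
    fix z y assume z: "z \<in> B" and y: "y \<in> block (blocks_in (part_join E P Q) B) z"
    have "block (part_join E P Q) z \<subseteq> block S z"
    proof (rule block_join_invariant[OF p(1,2)])
      show "block S z \<subseteq> E" using BE block_subset[OF refines_partition(2)[OF S(1)]] by blast
      show "z \<in> block S z" using block_in(2)[OF refines_partition(2)[OF S(1)] z] .
    qed (use inv PR QR S z in blast)+
    then show "y \<in> block S z" using y block_blocks_in[OF JR B z] by blast
  qed
qed

section \<open>Cycle partitions\<close>

lemma finite_partition_block: "partition_on E R \<Longrightarrow> finite E \<Longrightarrow> B \<in> R \<Longrightarrow> finite B"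
  by (rule finite_subset[of B E]) (auto simp: partition_on_def)

lemma orbit_eq_of_mem:
  assumes "\<sigma> permutes E" "finite E" "y \<in> orbit \<sigma> x"
  shows "orbit \<sigma> y = orbit \<sigma> x"
  using orbit_cyclic_eq3[OF cyclic_on_orbit[OF assms(1,2)] assms(3)] .

lemma self_in_orbit:
  assumes "\<sigma> permutes E" "finite E" shows "x \<in> orbit \<sigma> x"
  using permutation_self_in_orbit assms permutation_permutes by metis

lemma cycle_partition_partition:
  assumes s: "\<sigma> permutes E" and fin: "finite E"
  shows "partition_on E (cycle_partition E \<sigma>)"
proof (rule partition_onI)
  show "\<Union>(cycle_partition E \<sigma>) = E"
    unfolding cycle_partition_def
    using self_in_orbit[OF s fin] permutes_orbit_subset[OF s] by blast
  show "{} \<notin> cycle_partition E \<sigma>"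
    using orbit_nonempty[of \<sigma>] unfolding cycle_partition_def by fastforce
  fix X Y assume XY: "X \<in> cycle_partition E \<sigma>" "Y \<in> cycle_partition E \<sigma>" "X \<noteq> Y"
  then obtain x y where "X = orbit \<sigma> x" "Y = orbit \<sigma> y" unfolding cycle_partition_def by blast
  then show "disjnt X Y" unfolding disjnt_def using orbit_eq_of_mem[OF s fin] XY(3) by blast
qed

lemma block_cycle_partition:
  assumes "\<sigma> permutes E" "finite E" "x \<in> E"
  shows "block (cycle_partition E \<sigma>) x = orbit \<sigma> x"
  using block_eq[OF cycle_partition_partition[OF assms(1,2)]] self_in_orbit[OF assms(1,2)] assms(3)
  unfolding cycle_partition_def by blast

lemma orbit_subset_closed:
  assumes "x \<in> S" "\<And>y. y \<in> S \<Longrightarrow> \<sigma> y \<in> S"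
  shows "orbit \<sigma> x \<subseteq> S"
proof
  fix y assume "y \<in> orbit \<sigma> x"
  then show "y \<in> S" by induct (use assms in auto)
qed

lemma refines_cycle_partitionI:
  assumes s: "\<sigma> permutes E" and fin: "finite E" and R: "partition_on E R"
    and "\<And>x. x \<in> E \<Longrightarrow> \<sigma> x \<in> block R x"
  shows "refines E (cycle_partition E \<sigma>) R"
proof (rule refines_blockI[OF cycle_partition_partition[OF s fin] R])
  fix x y assume x: "x \<in> E" and y: "y \<in> block (cycle_partition E \<sigma>) x"
  have "orbit \<sigma> x \<subseteq> block R x"
  proof (rule orbit_subset_closed)
    show "x \<in> block R x" using block_in(2)[OF R x] .
    fix z assume z: "z \<in> block R x"
    then have "z \<in> E" using block_subset[OF R] by blast
    then show "\<sigma> z \<in> block R x" using assms(4) block_eq_of_mem[OF R z] by blast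
  qed
  then show "y \<in> block R x" using y block_cycle_partition[OF s fin x] by blast
qed

lemma refines_cycle_partitionD:
  assumes "\<sigma> permutes E" "finite E" "refines E (cycle_partition E \<sigma>) R" "x \<in> E"
  shows "\<sigma> x \<in> block R x" "orbit \<sigma> x \<subseteq> block R x"
  using refines_block_subset[OF assms(3), of x] block_cycle_partition[OF assms(1,2,4)]
    orbit.base[of \<sigma> x] by auto

lemma cycle_partition_inv:
  assumes "\<sigma> permutes E" "finite E"
  shows "cycle_partition E (inv \<sigma>) = cycle_partition E \<sigma>"
proof -
  have "permutation \<sigma>" using assms permutation_permutes by blast
  then show ?thesis by (simp add: cycle_partition_def orbit_inv_eq)
qed

lemma num_cycles_inv:
  assumes "\<sigma> permutes E" "finite E"
  shows "num_cycles E (inv \<sigma>) = num_cycles E \<sigma>"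
  unfolding num_cycles_def using cycle_partition_inv[OF assms] by simp

lemma orbit_id: "orbit id x = {x}"
  by (simp add: orbit_eq_singleton_iff)

lemma cycle_partition_id: "cycle_partition E id = (\<lambda>x. {x}) ` E"
  unfolding cycle_partition_def by (simp add: orbit_id)

lemma num_cycles_id: "num_cycles E id = card E"
  unfolding num_cycles_def cycle_partition_id by (simp add: card_image)

lemma refines_comp:
  assumes a: "a permutes E" and b: "b permutes E" and fin: "finite E"
    and aR: "refines E (cycle_partition E a) R" and bR: "refines E (cycle_partition E b) R"
  shows "refines E (cycle_partition E (a \<circ> b)) R"
proof (rule refines_cycle_partitionI[OF permutes_compose[OF b a] fin])
  show R: "partition_on E R" using refines_partition(2)[OF aR] .
  fix x assume x: "x \<in> E"
  have bx: "b x \<in> E" using x permutes_in_image[OF b] by simp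
  have "b x \<in> block R x" using refines_cycle_partitionD(1)[OF b fin bR x] .
  then show "(a \<circ> b) x \<in> block R x"
    using refines_cycle_partitionD(1)[OF a fin aR bx] block_eq_of_mem[OF R] by auto
qed

text \<open>The permutation \<open>b \<circ> a\<close> is the conjugate of \<open>a \<circ> b\<close> by \<open>b\<close>.\<close>

lemma num_cycles_comp_commute:
  assumes a: "a permutes E" and b: "b permutes E" and fin: "finite E"
  shows "num_cycles E (a \<circ> b) = num_cycles E (b \<circ> a)"
proof -
  have eq: "b ` orbit (a \<circ> b) x = orbit (b \<circ> a) (b x)" for x
    by (rule orbit_inverse) (use self_in_orbit[OF permutes_compose[OF b a] fin] in auto)
  have "(\<lambda>X. b ` X) ` cycle_partition E (a \<circ> b) = (\<lambda>x. orbit (b \<circ> a) (b x)) ` E"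
    unfolding cycle_partition_def image_image eq ..
  also have "\<dots> = orbit (b \<circ> a) ` (b ` E)" by (simp add: image_image)
  also have "\<dots> = cycle_partition E (b \<circ> a)"
    unfolding cycle_partition_def permutes_image[OF b] ..
  finally have "card (cycle_partition E (b \<circ> a)) = card ((\<lambda>X. b ` X) ` cycle_partition E (a \<circ> b))"
    by simp
  also have "\<dots> = card (cycle_partition E (a \<circ> b))"
    by (intro card_image inj_onI) (use permutes_inj[OF b] inj_image_eq_iff in blast)
  finally show ?thesis unfolding num_cycles_def by simp
qed

text \<open>Subadditivity of the reflection length \<open>|E| - #\<close>. It is semimodularity above the partition into
  singletons, because the cycles of \<open>a \<circ> b\<close> refine \<open>\<Pi>(a) \<or> \<Pi>(b)\<close>.\<close>

lemma num_cycles_comp_ge: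
  assumes a: "a permutes E" and b: "b permutes E" and fin: "finite E"
  shows "num_cycles E a + num_cycles E b \<le> card E + num_cycles E (a \<circ> b)"
proof -
  note pa = cycle_partition_partition[OF a fin] and pb = cycle_partition_partition[OF b fin]
  let ?J = "part_join E (cycle_partition E a) (cycle_partition E b)"
  note J = part_join_is_join[OF pa pb]
  have "refines E (cycle_partition E (a \<circ> b)) ?J" using refines_comp[OF a b fin J(1,2)] .
  then have "card ?J \<le> num_cycles E (a \<circ> b)"
    unfolding num_cycles_def using refines_card_le[OF fin] by blast
  moreover have "num_cycles E a + num_cycles E b \<le> card ((\<lambda>x. {x}) ` E) + card ?J"
    unfolding num_cycles_def
    by (intro partition_semimodular fin refines_singletons pa pb)
  moreover have "card ((\<lambda>x. {x}) ` E) = card E" by (simp add: card_image)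
  ultimately show ?thesis by linarith
qed

section \<open>Multiplication by a transposition\<close>

lemma permutes_comp_transpose:
  "\<sigma> permutes E \<Longrightarrow> b \<in> E \<Longrightarrow> d \<in> E \<Longrightarrow> (\<sigma> \<circ> transpose b d) permutes E"
  by (intro permutes_compose permutes_swap_id)

lemma comp_transpose_involutory: "(\<sigma> \<circ> transpose b d) \<circ> transpose b d = \<sigma>"
  by (simp add: comp_assoc)

lemma merge_comp_transpose:
  assumes s: "\<sigma> permutes E" and fin: "finite E" and bd: "b \<in> E" "d \<in> E"
  shows "merge (cycle_partition E (\<sigma> \<circ> transpose b d)) b d = merge (cycle_partition E \<sigma>) b d"
proof -
  have *: "refines E (merge (cycle_partition E (\<rho> \<circ> transpose b d)) b d) (merge (cycle_partition E \<rho>) b d)"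
    if r: "\<rho> permutes E" for \<rho>
  proof (rule merge_least[OF _ bd(1)])
    note P = cycle_partition_partition[OF r fin]
    note M = partition_on_merge[OF P bd]
    note j = merge_joined[OF P bd]
    show "d \<in> block (merge (cycle_partition E \<rho>) b d) b" by (rule j)
    have r1: "\<rho> x \<in> block (merge (cycle_partition E \<rho>) b d) x" if "x \<in> E" for x
      using refines_cycle_partitionD(1)[OF r fin refines_merge[OF P bd] that] .
    show "refines E (cycle_partition E (\<rho> \<circ> transpose b d)) (merge (cycle_partition E \<rho>) b d)"
    proof (rule refines_cycle_partitionI[OF permutes_comp_transpose[OF r bd] fin M])
      fix x assume x: "x \<in> E"
      consider "x = b" | "x = d" | "x \<noteq> b" "x \<noteq> d" by blast
      then show "(\<rho> \<circ> transpose b d) x \<in> block (merge (cycle_partition E \<rho>) b d) x"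
      proof cases
        case 1 then show ?thesis using r1[OF bd(2)] block_eq_of_mem[OF M j] by simp
      next
        case 2 then show ?thesis using r1[OF bd(1)] block_eq_of_mem[OF M j] by simp
      next
        case 3 then show ?thesis using r1[OF x] by simp
      qed
    qed
  qed
  show ?thesis
    using refines_asym[OF *[OF s]] *[OF permutes_comp_transpose[OF s bd]] comp_transpose_involutory
    by metis
qed

text \<open>Follow \<open>\<sigma>\<close> around the cycle of \<open>d\<close>, starting at \<open>\<sigma> d\<close>, the image of \<open>b\<close> under the product:
  before \<open>d\<close> is reached no point is affected by the transposition.\<close>

lemma orbit_comp_transpose_joins:
  assumes s: "\<sigma> permutes E" and fin: "finite E" and n: "d \<notin> orbit \<sigma> b"
  shows "d \<in> orbit (\<sigma> \<circ> transpose b d) b"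
proof -
  obtain k0 where k0: "0 < k0" "(\<sigma> ^^ k0) d = d"
    using self_in_orbit[OF s fin, of d] unfolding orbit_altdef by auto
  define k where "k = (LEAST k. 0 < k \<and> (\<sigma> ^^ k) d = d)"
  have k: "0 < k" "(\<sigma> ^^ k) d = d"
    unfolding k_def using LeastI[of "\<lambda>k. 0 < k \<and> (\<sigma> ^^ k) d = d" k0] k0 by auto
  have kmin: "(\<sigma> ^^ j) d \<noteq> d" if "0 < j" "j < k" for j
    using not_less_Least[of j "\<lambda>k. 0 < k \<and> (\<sigma> ^^ k) d = d"] that unfolding k_def by blast
  have nb: "(\<sigma> ^^ j) d \<noteq> b" for j
  proof
    assume "(\<sigma> ^^ j) d = b"
    then have "b \<in> orbit \<sigma> d" using funpow_in_orbit[OF self_in_orbit[OF s fin, of d], of j] by simp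
    then have "orbit \<sigma> b = orbit \<sigma> d" by (rule orbit_eq_of_mem[OF s fin])
    then show False using n self_in_orbit[OF s fin, of d] by simp
  qed
  have "(\<sigma> ^^ j) d \<in> orbit (\<sigma> \<circ> transpose b d) b" if "0 < j" "j \<le> k" for j
    using that
  proof (induction j)
    case (Suc j)
    show ?case
    proof (cases "j = 0")
      case True
      then show ?thesis using orbit.base[of "\<sigma> \<circ> transpose b d" b] by (simp add: comp_def)
    next
      case False
      then have "(\<sigma> ^^ j) d \<in> orbit (\<sigma> \<circ> transpose b d) b" using Suc.IH Suc.prems by linarith
      from orbit.step[OF this] show ?thesis
        using kmin[of j] nb[of j] False Suc.prems by (simp add: comp_def)
    qed
  qed simp
  from this[of k] k show ?thesis by simp
qed

text \<open>The arc \<open>\<sigma> b, \<dots>, d\<close> of the cycle is closed under the product, which sends \<open>d\<close> back to \<open>\<sigma> b\<close>,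
  and does not contain \<open>b\<close>.\<close>

lemma orbit_comp_transpose_splits:
  assumes s: "\<sigma> permutes E" and fin: "finite E" and o: "d \<in> orbit \<sigma> b" and ne: "b \<noteq> d"
  shows "d \<notin> orbit (\<sigma> \<circ> transpose b d) b"
proof
  assume a: "d \<in> orbit (\<sigma> \<circ> transpose b d) b"
  obtain k0 where k0: "0 < k0" "(\<sigma> ^^ k0) b = d" using o unfolding orbit_altdef by auto
  define k where "k = (LEAST k. 0 < k \<and> (\<sigma> ^^ k) b = d)"
  have k: "0 < k" "(\<sigma> ^^ k) b = d"
    unfolding k_def using LeastI[of "\<lambda>k. 0 < k \<and> (\<sigma> ^^ k) b = d" k0] k0 by auto
  have kmin: "(\<sigma> ^^ j) b \<noteq> d" if "0 < j" "j < k" for j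
    using not_less_Least[of j "\<lambda>k. 0 < k \<and> (\<sigma> ^^ k) b = d"] that unfolding k_def by blast
  have nb: "(\<sigma> ^^ j) b \<noteq> b" if "0 < j" "j \<le> k" for j
  proof
    assume e: "(\<sigma> ^^ j) b = b"
    have "(\<sigma> ^^ (k - j)) b = (\<sigma> ^^ (k - j)) ((\<sigma> ^^ j) b)" using e by simp
    also have "\<dots> = (\<sigma> ^^ k) b" using that by (metis comp_apply funpow_add le_add_diff_inverse2)
    finally have "(\<sigma> ^^ (k - j)) b = d" using k by simp
    moreover have "j \<noteq> k" using e k ne by auto
    ultimately show False using kmin[of "k - j"] that by simp
  qed
  let ?S = "{(\<sigma> ^^ j) b | j. 0 < j \<and> j \<le> k}"
  have "orbit (\<sigma> \<circ> transpose b d) d \<subseteq> ?S"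
  proof (rule orbit_subset_closed)
    show "d \<in> ?S" using k by blast
    fix y assume "y \<in> ?S"
    then obtain j where j: "y = (\<sigma> ^^ j) b" "0 < j" "j \<le> k" by blast
    show "(\<sigma> \<circ> transpose b d) y \<in> ?S"
    proof (cases "j = k")
      case True
      then have "(\<sigma> \<circ> transpose b d) y = (\<sigma> ^^ 1) b" using j k by simp
      moreover have "0 < (1::nat)" "1 \<le> k" using k(1) by auto
      ultimately show ?thesis by blast
    next
      case False
      then have "(\<sigma> \<circ> transpose b d) y = (\<sigma> ^^ (Suc j)) b" using j kmin[of j] nb[of j] by simp
      moreover have "0 < Suc j" "Suc j \<le> k" using j False by auto
      ultimately show ?thesis by blast
    qed
  qed
  moreover have "b \<notin> ?S"
  proof
    assume "b \<in> ?S"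
    then obtain j where "b = (\<sigma> ^^ j) b" "0 < j" "j \<le> k" by blast
    then show False using nb[of j] by simp
  qed
  moreover have "b \<in> orbit (\<sigma> \<circ> transpose b d) d"
  proof -
    have E: "b \<in> E \<and> d \<in> E"
    proof (rule ccontr)
      assume "\<not> (b \<in> E \<and> d \<in> E)"
      moreover have "b \<in> E"
      proof (rule ccontr)
        assume "b \<notin> E"
        then have "\<sigma> b = b" using permutes_not_in[OF s] by blast
        then have "orbit \<sigma> b = {b}" by (simp add: orbit_eq_singleton_iff)
        then show False using o ne by simp
      qed
      ultimately show False using permutes_orbit_subset[OF s] o by blast
    qed
    have p: "(\<sigma> \<circ> transpose b d) permutes E" using permutes_comp_transpose[OF s] E by blast
    show ?thesis using orbit_eq_of_mem[OF p fin a] self_in_orbit[OF p fin, of b] by simp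
  qed
  ultimately show False by blast
qed

lemma cycles_join:
  assumes s: "\<sigma> permutes E" and fin: "finite E" and bd: "b \<in> E" "d \<in> E" and n: "d \<notin> orbit \<sigma> b"
  shows "cycle_partition E (\<sigma> \<circ> transpose b d) = merge (cycle_partition E \<sigma>) b d"
    and "num_cycles E \<sigma> = num_cycles E (\<sigma> \<circ> transpose b d) + 1"
proof -
  note p = permutes_comp_transpose[OF s bd]
  have "d \<in> block (cycle_partition E (\<sigma> \<circ> transpose b d)) b"
    using block_cycle_partition[OF p fin bd(1)] orbit_comp_transpose_joins[OF s fin n] by simp
  then show 1: "cycle_partition E (\<sigma> \<circ> transpose b d) = merge (cycle_partition E \<sigma>) b d"
    using merge_same[OF cycle_partition_partition[OF p fin] bd(1)] merge_comp_transpose[OF s fin bd]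
    by simp
  show "num_cycles E \<sigma> = num_cycles E (\<sigma> \<circ> transpose b d) + 1"
    using card_merge[OF fin cycle_partition_partition[OF s fin] bd] n
      block_cycle_partition[OF s fin bd(1)] unfolding num_cycles_def 1 by simp
qed

lemma cycles_split:
  assumes s: "\<sigma> permutes E" and fin: "finite E" and bd: "b \<in> E" "d \<in> E"
    and o: "d \<in> orbit \<sigma> b" and ne: "b \<noteq> d"
  shows "cycle_partition E \<sigma> = merge (cycle_partition E (\<sigma> \<circ> transpose b d)) b d"
    and "num_cycles E (\<sigma> \<circ> transpose b d) = num_cycles E \<sigma> + 1"
    and "refines E (cycle_partition E (\<sigma> \<circ> transpose b d)) (cycle_partition E \<sigma>)"
proof -
  note p = permutes_comp_transpose[OF s bd]
  note c = cycles_join[OF p fin bd orbit_comp_transpose_splits[OF s fin o ne],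
      unfolded comp_transpose_involutory]
  show "cycle_partition E \<sigma> = merge (cycle_partition E (\<sigma> \<circ> transpose b d)) b d"
    "num_cycles E (\<sigma> \<circ> transpose b d) = num_cycles E \<sigma> + 1"
    using c .
  then show "refines E (cycle_partition E (\<sigma> \<circ> transpose b d)) (cycle_partition E \<sigma>)"
    using refines_merge[OF cycle_partition_partition[OF p fin] bd] by simp
qed

lemma num_cycles_comp_transpose_ge:
  assumes s: "\<sigma> permutes E" and fin: "finite E" and bd: "b \<in> E" "d \<in> E"
  shows "num_cycles E \<sigma> \<le> num_cycles E (\<sigma> \<circ> transpose b d) + 1"
proof -
  have "card (merge (cycle_partition E (\<sigma> \<circ> transpose b d)) b d) \<le> num_cycles E (\<sigma> \<circ> transpose b d)"
    using card_merge[OF fin cycle_partition_partition[OF permutes_comp_transpose[OF s bd] fin] bd]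
    unfolding num_cycles_def by simp
  then show ?thesis using card_merge[OF fin cycle_partition_partition[OF s fin] bd]
    unfolding num_cycles_def merge_comp_transpose[OF s fin bd] by (simp split: if_splits)
qed

section \<open>Nonnegativity of the genus\<close>

text \<open>Induction on the reflection length of \<open>a\<close>. Write \<open>a = c \<circ> (x y)\<close> with \<open>c\<close> shorter; then
  \<open>a \<circ> b\<close> is \<open>c \<circ> b\<close> times a transposition. If the step merges two blocks of the join, the two
  points swapped lie in different cycles of \<open>c \<circ> b\<close>, so a cycle of the product is lost too.\<close>

lemma genus_inequality:
  assumes a: "a permutes E" and b: "b permutes E" and fin: "finite E"
  shows "num_cycles E a + num_cycles E b + num_cycles E (a \<circ> b)
    \<le> card E + 2 * card (part_join E (cycle_partition E a) (cycle_partition E b))"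
  using a
proof (induction "card E - num_cycles E a" arbitrary: a rule: less_induct)
  case less
  note a = less.prems
  note pb = cycle_partition_partition[OF b fin]
  show ?case
  proof (cases "a = id")
    case True
    have "part_join E (cycle_partition E a) (cycle_partition E b) = cycle_partition E b"
      by (rule part_join_absorb)
        (simp add: True cycle_partition_id refines_singletons[OF pb])
    then show ?thesis using True num_cycles_id[of E] by (simp add: num_cycles_def)
  next
    case False
    then obtain x where x: "a x \<noteq> x" by (auto simp: fun_eq_iff)
    define y where "y = a x"
    have xE: "x \<in> E" using x permutes_not_in[OF a] by blast
    have yE: "y \<in> E" unfolding y_def using xE permutes_in_image[OF a] by simp
    have ne: "x \<noteq> y" using x y_def by simp
    have yo: "y \<in> orbit a x" unfolding y_def by (rule orbit.base)
    define c where "c = a \<circ> transpose x y"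
    have c: "c permutes E" unfolding c_def by (rule permutes_comp_transpose[OF a xE yE])
    note sp = cycles_split[OF a fin xE yE yo ne, folded c_def]
    have "num_cycles E c \<le> card E" unfolding num_cycles_def cycle_partition_def
      by (rule card_image_le[OF fin])
    then have IH: "num_cycles E c + num_cycles E b + num_cycles E (c \<circ> b)
      \<le> card E + 2 * card (part_join E (cycle_partition E c) (cycle_partition E b))"
      using less.hyps[OF _ c] sp(2) by simp
    \<comment> \<open>Conjugation by \<open>b\<close> moves the transposition past \<open>b\<close>.\<close>
    define x' y' where "x' = inv b x" and "y' = inv b y"
    have bi: "b (inv b z) = z" "inv b (b z) = z" for z using permutes_inverses[OF b] by auto
    have x'E: "x' \<in> E" and y'E: "y' \<in> E"
      unfolding x'_def y'_def using xE yE permutes_in_image[OF permutes_inv[OF b]] by auto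
    have ab: "a \<circ> b = (c \<circ> b) \<circ> transpose x' y'"
    proof
      fix z
      have "transpose x y (b z) = b (transpose x' y' z)"
        using bi unfolding x'_def y'_def transpose_def by auto
      then have "transpose x y (b (transpose x' y' z)) = b z"
        by (metis transpose_involutory)
      then show "(a \<circ> b) z = ((c \<circ> b) \<circ> transpose x' y') z"
        unfolding c_def by simp
    qed
    have cb: "(c \<circ> b) permutes E" by (rule permutes_compose[OF b c])
    let ?J = "part_join E (cycle_partition E c) (cycle_partition E b)"
    note pc = cycle_partition_partition[OF c fin]
    note J = part_join_is_join[OF pc pb] and pJ = partition_on_part_join[OF pc pb]
    have Ja: "part_join E (cycle_partition E a) (cycle_partition E b) = merge ?J x y"
      using part_join_merge[OF pc pb xE yE] sp(1) by simp
    note cm = card_merge[OF fin pJ xE yE]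
    show ?thesis
    proof (cases "y \<in> block ?J x")
      case True
      have "num_cycles E (a \<circ> b) \<le> num_cycles E (c \<circ> b) + 1"
        using num_cycles_comp_transpose_ge[OF permutes_comp_transpose[OF cb x'E y'E] fin x'E y'E]
        unfolding ab comp_transpose_involutory .
      then show ?thesis using IH sp(2) cm True unfolding Ja by simp
    next
      case n: False
      have cbJ: "refines E (cycle_partition E (c \<circ> b)) ?J" by (rule refines_comp[OF c b fin J(1,2)])
      have "y' \<notin> orbit (c \<circ> b) x'"
      proof
        assume "y' \<in> orbit (c \<circ> b) x'"
        then have 1: "y' \<in> block ?J x'" using refines_cycle_partitionD(2)[OF cb fin cbJ x'E] by blast
        have "x \<in> block ?J x'" "y \<in> block ?J y'"
          using refines_cycle_partitionD(1)[OF b fin J(2) x'E] refines_cycle_partitionD(1)[OF b fin J(2) y'E]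
          unfolding x'_def y'_def bi .
        then show False using n 1 block_eq_of_mem[OF pJ] by metis
      qed
      from cycles_join(2)[OF cb fin x'E y'E this] show ?thesis
        using IH sp(2) cm n unfolding Ja ab by simp
    qed
  qed
qed

lemma genus_0_iff:
  "genus E a b = 0 \<longleftrightarrow> num_cycles E a + num_cycles E b + num_cycles E (a \<circ> b)
    = card E + 2 * card (part_join E (cycle_partition E a) (cycle_partition E b))"
  unfolding genus_def by (simp add: field_simps) linarith

lemma genus_nonneg:
  assumes "a permutes E" "b permutes E" "finite E"
  shows "0 \<le> genus E a b"
proof -
  have "of_nat (num_cycles E a + num_cycles E b + num_cycles E (a \<circ> b))
    \<le> (of_nat (card E + 2 * card (part_join E (cycle_partition E a) (cycle_partition E b))) :: rat)"
    using genus_inequality[OF assms] of_nat_mono by blast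
  then show ?thesis unfolding genus_def by (simp add: field_simps)
qed

section \<open>Restriction of permutations and additivity of the genus\<close>

lemma perm_restrict_closed:
  assumes s: "\<sigma> permutes E" and fin: "finite E" and R: "refines E (cycle_partition E \<sigma>) R"
    and B: "B \<in> R" and x: "x \<in> B"
  shows "\<sigma> x \<in> B" "orbit \<sigma> x \<subseteq> B"
proof -
  note pR = refines_partition(2)[OF R]
  have "x \<in> E" using B x partition_onD1[OF pR] by blast
  then show "\<sigma> x \<in> B" "orbit \<sigma> x \<subseteq> B"
    using refines_cycle_partitionD[OF s fin R] block_eq[OF pR B x] by auto
qed

lemma perm_restrict_permutes:
  assumes s: "\<sigma> permutes E" and fin: "finite E" and R: "refines E (cycle_partition E \<sigma>) R"
    and B: "B \<in> R"
  shows "perm_restrict \<sigma> B permutes B"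
proof (rule bij_imp_permutes)
  have fB: "finite B"
    using finite_partition_block[OF refines_partition(2)[OF R] fin B] .
  have inj: "inj_on \<sigma> B" using permutes_inj[OF s] by (meson inj_on_subset subset_UNIV)
  have "\<sigma> ` B = B"
    by (rule endo_inj_surj[OF fB _ inj]) (use perm_restrict_closed(1)[OF assms] in blast)
  then have "bij_betw \<sigma> B B" using inj unfolding bij_betw_def by blast
  then show "bij_betw (perm_restrict \<sigma> B) B B"
    by (rule bij_betw_cong[THEN iffD1, rotated]) (simp add: perm_restrict_def)
qed (simp add: perm_restrict_def)

lemma orbit_perm_restrict:
  assumes "\<sigma> permutes E" "finite E" "refines E (cycle_partition E \<sigma>) R" "B \<in> R" "x \<in> B"
  shows "orbit (perm_restrict \<sigma> B) x = orbit \<sigma> x"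
  by (rule orbit_cong0[where A = B, symmetric])
    (use assms perm_restrict_closed(1)[OF assms(1-4)] in \<open>auto simp: perm_restrict_def\<close>)

lemma cycle_partition_perm_restrict:
  assumes s: "\<sigma> permutes E" and fin: "finite E" and R: "refines E (cycle_partition E \<sigma>) R"
    and B: "B \<in> R"
  shows "cycle_partition B (perm_restrict \<sigma> B) = blocks_in (cycle_partition E \<sigma>) B"
proof -
  have "cycle_partition B (perm_restrict \<sigma> B) = orbit \<sigma> ` B"
    unfolding cycle_partition_def using orbit_perm_restrict[OF assms] by (intro image_cong) auto
  also have "\<dots> = blocks_in (cycle_partition E \<sigma>) B"
  proof
    show "orbit \<sigma> ` B \<subseteq> blocks_in (cycle_partition E \<sigma>) B"
      unfolding blocks_in_def cycle_partition_def
      using perm_restrict_closed(2)[OF assms] B partition_onD1[OF refines_partition(2)[OF R]] by blast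
    show "blocks_in (cycle_partition E \<sigma>) B \<subseteq> orbit \<sigma> ` B"
      unfolding blocks_in_def cycle_partition_def using self_in_orbit[OF s fin] by blast
  qed
  finally show ?thesis .
qed

lemma perm_restrict_comp_closed:
  assumes "\<And>x. x \<in> B \<Longrightarrow> b x \<in> B"
  shows "perm_restrict (a \<circ> b) B = perm_restrict a B \<circ> perm_restrict b B"
  using assms by (auto simp: fun_eq_iff perm_restrict_def)

lemma perm_restrict_inv:
  assumes s: "\<sigma> permutes E" and fin: "finite E" and R: "refines E (cycle_partition E \<sigma>) R"
    and B: "B \<in> R"
  shows "perm_restrict (inv \<sigma>) B = inv (perm_restrict \<sigma> B)"
proof -
  have "perm_restrict (inv \<sigma>) B \<circ> perm_restrict \<sigma> B = perm_restrict (inv \<sigma> \<circ> \<sigma>) B"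
    by (rule perm_restrict_comp_closed[symmetric]) (rule perm_restrict_closed(1)[OF assms])
  also have "\<dots> = id" using permutes_inv_o(2)[OF s] by (auto simp: perm_restrict_def fun_eq_iff)
  finally have 1: "perm_restrict (inv \<sigma>) B \<circ> perm_restrict \<sigma> B = id" .
  have "surj (perm_restrict \<sigma> B)" by (rule permutes_surj[OF perm_restrict_permutes[OF assms]])
  then have 2: "perm_restrict \<sigma> B \<circ> inv (perm_restrict \<sigma> B) = id" by (simp add: surj_iff)
  have "perm_restrict (inv \<sigma>) B
    = (perm_restrict (inv \<sigma>) B \<circ> perm_restrict \<sigma> B) \<circ> inv (perm_restrict \<sigma> B)"
    by (simp only: comp_assoc 2 comp_id)
  then show ?thesis using 1 by simp
qed

lemma part_join_perm_restrict:
  assumes a: "a permutes E" and b: "b permutes E" and fin: "finite E"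
    and aR: "refines E (cycle_partition E a) R" and bR: "refines E (cycle_partition E b) R"
    and B: "B \<in> R"
  shows "part_join B (cycle_partition B (perm_restrict a B)) (cycle_partition B (perm_restrict b B))
    = blocks_in (part_join E (cycle_partition E a) (cycle_partition E b)) B"
  unfolding cycle_partition_perm_restrict[OF a fin aR B] cycle_partition_perm_restrict[OF b fin bR B]
  by (rule part_join_blocks_in[OF aR bR B])

lemma genus_sum_blocks:
  assumes a: "a permutes E" and b: "b permutes E" and fin: "finite E"
    and aR: "refines E (cycle_partition E a) R" and bR: "refines E (cycle_partition E b) R"
  shows "genus E a b = (\<Sum>B\<in>R. genus B (perm_restrict a B) (perm_restrict b B))"
proof -
  note pR = refines_partition(2)[OF aR]
  note pa = cycle_partition_partition[OF a fin] and pb = cycle_partition_partition[OF b fin]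
  have ab: "(a \<circ> b) permutes E" by (rule permutes_compose[OF b a])
  have abR: "refines E (cycle_partition E (a \<circ> b)) R" by (rule refines_comp[OF a b fin aR bR])
  have c: "num_cycles E s = (\<Sum>B\<in>R. num_cycles B (perm_restrict s B))"
    if s: "s permutes E" and sR: "refines E (cycle_partition E s) R" for s
    unfolding num_cycles_def card_blocks_in[OF fin sR]
    by (rule sum.cong) (use cycle_partition_perm_restrict[OF s fin sR] in auto)
  have j: "card (part_join E (cycle_partition E a) (cycle_partition E b))
    = (\<Sum>B\<in>R. card (part_join B (cycle_partition B (perm_restrict a B)) (cycle_partition B (perm_restrict b B))))"
    using card_blocks_in[OF fin part_join_is_join(3)[OF pa pb aR bR]]
      part_join_perm_restrict[OF a b fin aR bR] by simp
  have e: "card E = (\<Sum>B\<in>R. card B)"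
    using card_Union_disjoint[of R] finite_partition_block[OF pR fin] pR
    unfolding partition_on_def by simp
  have comp: "perm_restrict (a \<circ> b) B = perm_restrict a B \<circ> perm_restrict b B" if "B \<in> R" for B
    by (rule perm_restrict_comp_closed) (rule perm_restrict_closed(1)[OF b fin bR that])
  show ?thesis
    unfolding genus_def j c[OF a aR] c[OF b bR] c[OF ab abR] e
    by (simp add: comp sum_subtractf sum.distrib sum_divide_distrib
        diff_divide_distrib add_divide_distrib)
qed

text \<open>The genus is additive over the blocks of \<open>R\<close> and nonnegative on each of them.\<close>

lemma genus_0_blocks:
  assumes a: "a permutes E" and b: "b permutes E" and fin: "finite E"
    and aR: "refines E (cycle_partition E a) R" and bR: "refines E (cycle_partition E b) R"
  shows "genus E a b = 0 \<longleftrightarrow> (\<forall>B\<in>R. genus B (perm_restrict a B) (perm_restrict b B) = 0)"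
proof -
  note pR = refines_partition(2)[OF aR]
  have fR: "finite R" using fin pR finite_elements by blast
  have "0 \<le> genus B (perm_restrict a B) (perm_restrict b B)" if "B \<in> R" for B
    by (intro genus_nonneg perm_restrict_permutes[OF a fin aR that]
        perm_restrict_permutes[OF b fin bR that])
      (rule finite_partition_block[OF pR fin that])
  then show ?thesis
    by (subst genus_sum_blocks[OF assms]) (rule sum_nonneg_eq_0_iff[OF fR])
qed

section \<open>The noncrossing order\<close>

lemma genus_commute:
  assumes "a permutes E" "b permutes E" "finite E"
  shows "genus E a b = genus E b a"
  unfolding genus_def using num_cycles_comp_commute[OF assms]
    part_join_commute[of E "cycle_partition E a"] by simp

text \<open>The permutation \<open>\<tau>\<close> lies on a geodesic from the identity to \<open>\<gamma>\<close> in the Cayley graph generated by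
  the transpositions, that is, \<open>\<tau>\<close> is non-crossing inside every cycle of \<open>\<gamma>\<close>.\<close>

definition nc_le :: "'a set \<Rightarrow> ('a \<Rightarrow> 'a) \<Rightarrow> ('a \<Rightarrow> 'a) \<Rightarrow> bool" where
  "nc_le E \<tau> \<gamma> \<longleftrightarrow> refines E (cycle_partition E \<tau>) (cycle_partition E \<gamma>)
     \<and> num_cycles E \<tau> + num_cycles E (inv \<tau> \<circ> \<gamma>) = card E + num_cycles E \<gamma>"

lemma num_cycles_comp_inv:
  assumes t: "\<tau> permutes E" and g: "\<gamma> permutes E" and fin: "finite E"
  shows "num_cycles E (\<tau> \<circ> inv \<gamma>) = num_cycles E (inv \<tau> \<circ> \<gamma>)"
proof -
  have "inv (\<tau> \<circ> inv \<gamma>) = \<gamma> \<circ> inv \<tau>"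
    using permutes_bij[OF t] permutes_bij[OF permutes_inv[OF g]] permutes_inv_inv[OF g]
    by (simp add: o_inv_distrib)
  then have "num_cycles E (\<tau> \<circ> inv \<gamma>) = num_cycles E (\<gamma> \<circ> inv \<tau>)"
    using num_cycles_inv[OF permutes_compose[OF permutes_inv[OF g] t] fin] by simp
  then show ?thesis using num_cycles_comp_commute[OF g permutes_inv[OF t] fin] by simp
qed

lemma nc_le_iff_genus:
  assumes t: "\<tau> permutes E" and g: "\<gamma> permutes E" and fin: "finite E"
    and r: "refines E (cycle_partition E \<tau>) (cycle_partition E \<gamma>)"
  shows "nc_le E \<tau> \<gamma> \<longleftrightarrow> genus E \<tau> (inv \<gamma>) = 0"
  unfolding genus_0_iff nc_le_def cycle_partition_inv[OF g fin] part_join_absorb[OF r]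
    num_cycles_inv[OF g fin] num_cycles_comp_inv[OF t g fin]
  using r by (auto simp: num_cycles_def)

lemma nc_le_refl:
  assumes g: "\<gamma> permutes E" and fin: "finite E"
  shows "nc_le E \<gamma> \<gamma>"
  unfolding nc_le_def permutes_inv_o(2)[OF g] num_cycles_id
  using refines_refl[OF cycle_partition_partition[OF g fin]] by simp

text \<open>If \<open>b\<close> and \<open>d\<close> share a cycle of the Kreweras complement \<open>\<tau>\<^sup>-\<^sup>1 \<gamma>\<close>, splitting \<open>\<gamma>\<close> at \<open>b\<close> and \<open>d\<close>
  cuts no cycle of \<open>\<tau>\<close>: the counts stay balanced, and then nonnegativity of the genus leaves room
  only for \<open>\<Pi>(\<tau>) \<or> \<Pi>(\<gamma>') = \<Pi>(\<gamma>')\<close>, where \<open>\<gamma>'\<close> is the split permutation.\<close>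

lemma nc_le_step:
  assumes t: "\<tau> permutes E" and g: "\<gamma> permutes E" and fin: "finite E" and nc: "nc_le E \<tau> \<gamma>"
    and bd: "b \<in> E" "d \<in> E" "b \<noteq> d" and o: "d \<in> orbit (inv \<tau> \<circ> \<gamma>) b"
  shows "d \<in> orbit \<gamma> b" "nc_le E \<tau> (\<gamma> \<circ> transpose b d)"
proof -
  note it = permutes_inv[OF t]
  note r = nc[unfolded nc_le_def, THEN conjunct1]
  have K: "(inv \<tau> \<circ> \<gamma>) permutes E" by (rule permutes_compose[OF g it])
  have "refines E (cycle_partition E (inv \<tau> \<circ> \<gamma>)) (cycle_partition E \<gamma>)"
    by (rule refines_comp[OF it g fin]) 
      (use r cycle_partition_inv[OF t fin] refines_refl[OF cycle_partition_partition[OF g fin]] in auto)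
  from refines_cycle_partitionD(2)[OF K fin this bd(1)]
  show og: "d \<in> orbit \<gamma> b" using o block_cycle_partition[OF g fin bd(1)] by auto
  let ?g = "\<gamma> \<circ> transpose b d"
  have g': "?g permutes E" by (rule permutes_comp_transpose[OF g bd(1,2)])
  have 1: "num_cycles E (inv \<tau> \<circ> ?g) = num_cycles E (inv \<tau> \<circ> \<gamma>) + 1"
    using cycles_split(2)[OF K fin bd(1,2) o bd(3)] by (simp add: comp_assoc)
  have 2: "num_cycles E ?g = num_cycles E \<gamma> + 1"
    using cycles_split(2)[OF g fin bd(1,2) og bd(3)] .
  note pt = cycle_partition_partition[OF t fin] and pg = cycle_partition_partition[OF g' fin]
  let ?J = "part_join E (cycle_partition E \<tau>) (cycle_partition E ?g)"
  note J = part_join_is_join[OF pt pg]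
  have s: "num_cycles E \<tau> + num_cycles E (inv \<tau> \<circ> ?g) = card E + num_cycles E ?g"
    using 1 2 nc unfolding nc_le_def by simp
  have "num_cycles E ?g \<le> card ?J"
    using genus_inequality[OF it g' fin] s num_cycles_inv[OF t fin] cycle_partition_inv[OF t fin] by simp
  then have "cycle_partition E ?g = ?J"
    using refines_card_eq[OF fin J(2)] unfolding num_cycles_def by simp
  then show "nc_le E \<tau> ?g" using J(1) s unfolding nc_le_def by simp
qed

text \<open>The transposition removes at most one cycle from \<open>\<tau>\<^sup>-\<^sup>1 \<gamma>\<close>, and nonnegativity of the genus
  forces it to remove at least one.\<close>

lemma nc_le_split_lower:
  assumes t: "\<tau> permutes E" and g: "\<gamma> permutes E" and fin: "finite E" and nc: "nc_le E \<tau> \<gamma>"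
    and bd: "b \<in> E" "d \<in> E" "b \<noteq> d" and o: "d \<in> orbit \<tau> b"
  shows "nc_le E (\<tau> \<circ> transpose b d) \<gamma>"
proof -
  let ?t = "\<tau> \<circ> transpose b d"
  have t': "?t permutes E" by (rule permutes_comp_transpose[OF t bd(1,2)])
  have tr: "transpose b d permutes E" by (rule permutes_swap_id[OF bd(1,2)])
  note it = permutes_inv[OF t] and it' = permutes_inv[OF t']
  note sp = cycles_split[OF t fin bd(1,2) o bd(3)]
  have r: "refines E (cycle_partition E ?t) (cycle_partition E \<gamma>)"
    using refines_trans[OF sp(3)] nc unfolding nc_le_def by blast
  have "inv ?t = transpose b d \<circ> inv \<tau>"
    using permutes_bij[OF t] permutes_bij[OF tr] by (simp add: o_inv_distrib)
  then have 1: "num_cycles E (inv ?t \<circ> \<gamma>) = num_cycles E ((inv \<tau> \<circ> \<gamma>) \<circ> transpose b d)"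
    using num_cycles_comp_commute[OF tr permutes_compose[OF g it] fin] by (simp add: comp_assoc)
  have 2: "num_cycles E (inv \<tau> \<circ> \<gamma>) \<le> num_cycles E ((inv \<tau> \<circ> \<gamma>) \<circ> transpose b d) + 1"
    by (rule num_cycles_comp_transpose_ge[OF permutes_compose[OF g it] fin bd(1,2)])
  have 3: "num_cycles E ?t + num_cycles E \<gamma> + num_cycles E (inv ?t \<circ> \<gamma>) \<le> card E + 2 * num_cycles E \<gamma>"
    using genus_inequality[OF it' g fin] part_join_absorb[OF r]
      num_cycles_inv[OF t' fin] cycle_partition_inv[OF t' fin] by (simp add: num_cycles_def)
  show ?thesis using 1 2 3 r sp(2) nc unfolding nc_le_def by linarith
qed

text \<open>Descends from \<open>\<gamma>\<close> towards \<open>\<tau>\<close>: any point moved by \<open>\<tau>\<^sup>-\<^sup>1 \<gamma>\<close>, with its image, gives a split.\<close>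

lemma nc_le_induct_step:
  assumes t: "\<tau> permutes E" and g: "\<gamma> permutes E" and fin: "finite E" and nc: "nc_le E \<tau> \<gamma>"
    and ne: "\<tau> \<noteq> \<gamma>"
  obtains b d where "b \<in> E" "d \<in> E" "b \<noteq> d" "d \<in> orbit \<gamma> b" "nc_le E \<tau> (\<gamma> \<circ> transpose b d)"
proof -
  have "inv \<tau> \<circ> \<gamma> \<noteq> id"
  proof
    assume i: "inv \<tau> \<circ> \<gamma> = id"
    have "\<tau> = \<tau> \<circ> (inv \<tau> \<circ> \<gamma>)" by (simp only: i comp_id)
    also have "\<dots> = \<gamma>" using permutes_inv_o(1)[OF t] by (simp add: comp_assoc[symmetric])
    finally show False using ne by simp
  qed
  then obtain b where b: "(inv \<tau> \<circ> \<gamma>) b \<noteq> b" by (auto simp: fun_eq_iff)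
  have K: "(inv \<tau> \<circ> \<gamma>) permutes E" by (rule permutes_compose[OF g permutes_inv[OF t]])
  have bE: "b \<in> E" using b permutes_not_in[OF K] by blast
  have dE: "(inv \<tau> \<circ> \<gamma>) b \<in> E" using bE permutes_in_image[OF K] by blast
  show thesis
    using that[OF bE dE b[symmetric]] nc_le_step[OF t g fin nc bE dE b[symmetric] orbit.base] by blast
qed

text \<open>Each cycle of \<open>\<sigma>\<close> leaves \<open>A\<close> at most once. For an arc \<open>A\<close> of a cycle of \<open>\<gamma>\<close> this holds for \<open>\<gamma>\<close>
  itself; that it is inherited by all non-crossing \<open>\<tau>\<close> is the form in which planarity enters the
  uniqueness proof.\<close>

definition unique_exit :: "('a \<Rightarrow> 'a) \<Rightarrow> 'a set \<Rightarrow> bool" where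
  "unique_exit \<sigma> A \<longleftrightarrow>
    (\<forall>x y. x \<in> A \<and> y \<in> A \<and> y \<in> orbit \<sigma> x \<and> \<sigma> x \<notin> A \<and> \<sigma> y \<notin> A \<longrightarrow> x = y)"

text \<open>Splitting a cycle at \<open>b\<close> and \<open>d\<close> creates the new steps \<open>d \<mapsto> \<gamma> b\<close> and \<open>b \<mapsto> \<gamma> d\<close>. If the half
  containing \<open>d\<close> left \<open>A\<close> both at \<open>d\<close> and at an old exit \<open>e\<close>, the other half would start inside
  \<open>A\<close> at \<open>\<gamma> d\<close>, end outside \<open>A\<close> at \<open>b\<close>, and yet have no exit, \<open>e\<close> being the only one of the
  original cycle.\<close>

lemma unique_exit_split:
  assumes g: "\<gamma> permutes E" and fin: "finite E" and bd: "b \<in> E" "d \<in> E" "b \<noteq> d"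
    and o: "d \<in> orbit \<gamma> b" and U: "unique_exit \<gamma> A"
  shows "unique_exit (\<gamma> \<circ> transpose b d) A"
proof -
  have *: False
    if bd: "b \<in> E" "d \<in> E" "b \<noteq> d" and o: "d \<in> orbit \<gamma> b"
      and d: "d \<in> A" "\<gamma> b \<notin> A" and e: "e \<in> orbit (\<gamma> \<circ> transpose b d) d" "e \<noteq> d" "e \<in> A" 
      "(\<gamma> \<circ> transpose b d) e \<notin> A" for b d e
  proof -
    let ?g = "\<gamma> \<circ> transpose b d"
    have g': "?g permutes E" by (rule permutes_comp_transpose[OF g bd(1,2)])
    have n: "d \<notin> orbit ?g b" by (rule orbit_comp_transpose_splits[OF g fin o bd(3)])
    have oe: "orbit ?g e = orbit ?g d" by (rule orbit_eq_of_mem[OF g' fin e(1)])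
    have eb: "e \<noteq> b" using n oe self_in_orbit[OF g' fin, of d] by auto
    have ge: "\<gamma> e \<notin> A" using e eb by simp
    have eE: "e \<in> E" using permutes_orbit_subset[OF g' bd(2)] e by blast
    have "orbit ?g d \<subseteq> orbit \<gamma> d"
      using refines_block_subset[OF cycles_split(3)[OF g fin bd(1,2) o bd(3)], of d]
      by (simp only: block_cycle_partition[OF g' fin bd(2)] block_cycle_partition[OF g fin bd(2)])
    then have ed: "e \<in> orbit \<gamma> d" using e by blast
    then have eb': "e \<in> orbit \<gamma> b" using orbit_eq_of_mem[OF g fin o] by simp
    \<comment> \<open>Otherwise \<open>b\<close>, respectively \<open>d\<close>, would be a second exit of the original cycle besides \<open>e\<close>.\<close>
    have bA: "b \<notin> A" using U eb' eb d ge e(3) unfolding unique_exit_def by blast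
    have dA: "\<gamma> d \<in> A" using U ed e(2,3) d ge unfolding unique_exit_def by blast
    have "orbit ?g (\<gamma> d) \<subseteq> A \<inter> orbit ?g b"
    proof (rule orbit_subset_closed)
      show "\<gamma> d \<in> A \<inter> orbit ?g b" using dA orbit.base[of ?g b] by simp
      fix y assume y: "y \<in> A \<inter> orbit ?g b"
      have "y \<noteq> b" "y \<noteq> d" using y bA n by auto
      then have gy: "?g y = \<gamma> y" by simp
      have "\<gamma> y \<in> A"
      proof (rule ccontr)
        assume a: "\<gamma> y \<notin> A"
        have "orbit ?g b \<subseteq> orbit \<gamma> b"
          using refines_block_subset[OF cycles_split(3)[OF g fin bd(1,2) o bd(3)], of b]
          by (simp only: block_cycle_partition[OF g' fin bd(1)] block_cycle_partition[OF g fin bd(1)])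
        then have "y \<in> orbit \<gamma> b" using y by blast
        then have "orbit \<gamma> y = orbit \<gamma> b" by (rule orbit_eq_of_mem[OF g fin])
        then have "e \<in> orbit \<gamma> y" using eb' by simp
        then have "y = e" using U y a e(3) ge unfolding unique_exit_def by blast
        then have "orbit ?g d = orbit ?g b" using y orbit_eq_of_mem[OF g' fin, of y b] oe by simp
        then show False using n self_in_orbit[OF g' fin, of d] by simp
      qed
      moreover have "?g y \<in> orbit ?g b" using y by (meson IntD2 orbit.step)
      ultimately show "?g y \<in> A \<inter> orbit ?g b" using gy by simp
    qed
    moreover have "b \<in> orbit ?g (\<gamma> d)"
    proof -
      have "\<gamma> d \<in> orbit ?g b" using orbit.base[of ?g b] by simp
      from orbit_eq_of_mem[OF g' fin this] show ?thesis using self_in_orbit[OF g' fin, of b] by simp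
    qed
    ultimately show False using bA by blast
  qed
  let ?g = "\<gamma> \<circ> transpose b d"
  have g': "?g permutes E" by (rule permutes_comp_transpose[OF g bd(1,2)])
  have n: "d \<notin> orbit ?g b" by (rule orbit_comp_transpose_splits[OF g fin o bd(3)])
  have n': "b \<notin> orbit ?g d"
  proof
    assume "b \<in> orbit ?g d"
    from orbit_eq_of_mem[OF g' fin this] show False using n self_in_orbit[OF g' fin, of d] by simp
  qed
  have o': "b \<in> orbit \<gamma> d" using orbit_eq_of_mem[OF g fin o] self_in_orbit[OF g fin, of b] by simp
  have half: False if x: "x = b \<or> x = d" and xy: "x \<in> A" "y \<in> A" "y \<in> orbit ?g x" "?g x \<notin> A" "?g y \<notin> A" "x \<noteq> y" for x y
    using x
  proof
    assume x: "x = d"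
    show False by (rule *[OF bd o, of y]) (use x xy in auto)
  next
    assume x: "x = b"
    have tc: "transpose b d = transpose d b" by (rule transpose_commute)
    show False by (rule *[OF bd(2,1) bd(3)[symmetric] o', of y]) (use x xy tc in auto)
  qed
  show ?thesis unfolding unique_exit_def
  proof (intro allI impI, elim conjE, rule ccontr)
    fix x y assume xy: "x \<in> A" "y \<in> A" "y \<in> orbit ?g x" "?g x \<notin> A" "?g y \<notin> A" "x \<noteq> y"
    have "x \<in> orbit ?g y" using orbit_eq_of_mem[OF g' fin xy(3)] self_in_orbit[OF g' fin, of x] by simp
    then have "x \<noteq> b" "x \<noteq> d" "y \<noteq> b" "y \<noteq> d" using half[of x y] half[of y x] xy by auto
    then have gxy: "\<gamma> x \<notin> A" "\<gamma> y \<notin> A" using xy by auto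
    have xE: "x \<in> E"
    proof (rule ccontr)
      assume "x \<notin> E"
      then have "\<gamma> x = x" using permutes_not_in[OF g] by blast
      then show False using gxy xy by simp
    qed
    have "orbit ?g x \<subseteq> orbit \<gamma> x"
      using refines_block_subset[OF cycles_split(3)[OF g fin bd(1,2) o bd(3)], of x]
      by (simp only: block_cycle_partition[OF g' fin xE] block_cycle_partition[OF g fin xE])
    then show False using U xy gxy unfolding unique_exit_def by blast
  qed
qed

lemma nc_le_unique_exit:
  assumes t: "\<tau> permutes E" and "\<gamma> permutes E" and fin: "finite E" and "nc_le E \<tau> \<gamma>"
    and "unique_exit \<gamma> A"
  shows "unique_exit \<tau> A"
  using assms(2,4,5)
proof (induction "card E - num_cycles E \<gamma>" arbitrary: \<gamma> rule: less_induct)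
  case less
  show ?case
  proof (cases "\<tau> = \<gamma>")
    case True then show ?thesis using less.prems by simp
  next
    case False
    then obtain b d where bd: "b \<in> E" "d \<in> E" "b \<noteq> d" "d \<in> orbit \<gamma> b" "nc_le E \<tau> (\<gamma> \<circ> transpose b d)"
      using nc_le_induct_step[OF t less.prems(1) fin less.prems(2)] by blast
    have "num_cycles E (\<gamma> \<circ> transpose b d) \<le> card E" unfolding num_cycles_def cycle_partition_def
      by (rule card_image_le[OF fin])
    then show ?thesis
      using less.hyps[OF _ permutes_comp_transpose[OF less.prems(1) bd(1,2)] bd(5)]
        cycles_split(2)[OF less.prems(1) fin bd(1,2,4,3)]
        unique_exit_split[OF less.prems(1) fin bd(1,2,3,4) less.prems(3)] by simp
  qed
qed

section \<open>Cutting white vertices\<close>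

text \<open>No component of the hypermap \<open>(\<tau>, \<nu>)\<close> has a white cut-vertex.\<close>

definition nonsep :: "'a set \<Rightarrow> ('a \<Rightarrow> 'a) \<Rightarrow> ('a \<Rightarrow> 'a) \<Rightarrow> bool" where
  "nonsep E \<tau> \<nu> \<longleftrightarrow> (\<forall>b\<in>E. \<forall>d\<in>E. b \<noteq> d \<and> d \<in> orbit \<tau> b \<longrightarrow>
     part_join E (cycle_partition E (\<tau> \<circ> transpose b d)) (cycle_partition E \<nu>)
       = part_join E (cycle_partition E \<tau>) (cycle_partition E \<nu>))"

text \<open>The cycles of \<open>\<gamma>\<close> are cut in a planar way into those of \<open>\<tau>\<close>, and the components of the resulting
  planar map hang together in a tree-like manner: the incidence graph between components and
  cycles of \<open>\<gamma>\<close>, with the cycles of \<open>\<tau>\<close> as edges, is a forest.\<close>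

definition cutting :: "'a set \<Rightarrow> ('a \<Rightarrow> 'a) \<Rightarrow> ('a \<Rightarrow> 'a) \<Rightarrow> ('a \<Rightarrow> 'a) \<Rightarrow> bool" where
  "cutting E \<gamma> \<nu> \<tau> \<longleftrightarrow> \<tau> permutes E \<and> nc_le E \<tau> \<gamma> \<and> genus E \<nu> \<tau> = 0
     \<and> L_defect E (part_join E (cycle_partition E \<tau>) (cycle_partition E \<nu>))
         (cycle_partition E \<gamma>) (cycle_partition E \<tau>) = 0"

lemma part_join_absorb_mid:
  assumes r: "refines E T G" and N: "partition_on E N"
  shows "part_join E (part_join E T N) G = part_join E G N"
proof -
  note p = refines_partition[OF r]
  have "part_join E (part_join E T N) G = part_join E (part_join E N T) G"
    by (simp only: part_join_commute)
  also have "\<dots> = part_join E N (part_join E T G)" by (rule part_join_assoc[OF N p])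
  also have "\<dots> = part_join E N G" by (simp only: part_join_absorb[OF r])
  finally show ?thesis by (simp only: part_join_commute)
qed

lemma join_split_cycle:
  assumes g: "\<gamma> permutes E" and n: "\<nu> permutes E" and fin: "finite E"
    and bd: "b \<in> E" "d \<in> E" "b \<noteq> d" and o: "d \<in> orbit \<gamma> b"
  shows "part_join E (cycle_partition E \<gamma>) (cycle_partition E \<nu>)
    = merge (part_join E (cycle_partition E (\<gamma> \<circ> transpose b d)) (cycle_partition E \<nu>)) b d"
proof -
  note pn = cycle_partition_partition[OF n fin]
    and pg = cycle_partition_partition[OF permutes_comp_transpose[OF g bd(1,2)] fin]
  show ?thesis
    using part_join_merge[OF pg pn bd(1,2)] cycles_split(1)[OF g fin bd(1,2) o bd(3)] by simp
qed

lemma separating_card: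
  assumes g: "\<gamma> permutes E" and n: "\<nu> permutes E" and fin: "finite E"
    and bd: "b \<in> E" "d \<in> E" "b \<noteq> d" and o: "d \<in> orbit \<gamma> b"
    and ne: "part_join E (cycle_partition E (\<gamma> \<circ> transpose b d)) (cycle_partition E \<nu>)
       \<noteq> part_join E (cycle_partition E \<gamma>) (cycle_partition E \<nu>)"
  shows "d \<notin> block (part_join E (cycle_partition E (\<gamma> \<circ> transpose b d)) (cycle_partition E \<nu>)) b"
    and "card (part_join E (cycle_partition E (\<gamma> \<circ> transpose b d)) (cycle_partition E \<nu>))
      = card (part_join E (cycle_partition E \<gamma>) (cycle_partition E \<nu>)) + 1"
proof -
  note pn = cycle_partition_partition[OF n fin]
    and pg = cycle_partition_partition[OF permutes_comp_transpose[OF g bd(1,2)] fin]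
  note pJ = partition_on_part_join[OF pg pn]
  note m = join_split_cycle[OF g n fin bd o]
  show *: "d \<notin> block (part_join E (cycle_partition E (\<gamma> \<circ> transpose b d)) (cycle_partition E \<nu>)) b"
    using merge_same[OF pJ bd(1)] ne m by metis
  show "card (part_join E (cycle_partition E (\<gamma> \<circ> transpose b d)) (cycle_partition E \<nu>))
      = card (part_join E (cycle_partition E \<gamma>) (cycle_partition E \<nu>)) + 1"
    using card_merge[OF fin pJ bd(1,2)] * unfolding m by simp
qed

lemma cutting_refl:
  assumes g: "\<gamma> permutes E" and n: "\<nu> permutes E" and fin: "finite E" and "genus E \<gamma> \<nu> = 0"
  shows "cutting E \<gamma> \<nu> \<gamma>"
proof -
  note pn = cycle_partition_partition[OF n fin] and pg = cycle_partition_partition[OF g fin]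
  have "part_join E (part_join E (cycle_partition E \<gamma>) (cycle_partition E \<nu>)) (cycle_partition E \<gamma>)
    = part_join E (cycle_partition E \<gamma>) (cycle_partition E \<nu>)"
    by (rule part_join_absorb_mid[OF refines_refl[OF pg] pn])
  then show ?thesis unfolding cutting_def L_defect_def
    using g nc_le_refl[OF g fin] assms(4) genus_commute[OF n g fin] by simp
qed

text \<open>A split that disconnects adds one cycle to \<open>\<tau>\<close> and one component, so the forest condition
  persists. The points \<open>b\<close> and \<open>d\<close> end up in different components, hence in different cycles of
  \<open>\<nu> \<tau> (b d)\<close>, so this product gains a cycle and the genus stays zero.\<close>

lemma cutting_split:
  assumes g: "\<gamma> permutes E" and n: "\<nu> permutes E" and fin: "finite E" and c: "cutting E \<gamma> \<nu> \<tau>"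
    and bd: "b \<in> E" "d \<in> E" "b \<noteq> d" and o: "d \<in> orbit \<tau> b"
    and ne: "part_join E (cycle_partition E (\<tau> \<circ> transpose b d)) (cycle_partition E \<nu>)
       \<noteq> part_join E (cycle_partition E \<tau>) (cycle_partition E \<nu>)"
  shows "cutting E \<gamma> \<nu> (\<tau> \<circ> transpose b d)"
proof -
  have t: "\<tau> permutes E" and nc: "nc_le E \<tau> \<gamma>" using c unfolding cutting_def by auto
  let ?t = "\<tau> \<circ> transpose b d"
  have t': "?t permutes E" by (rule permutes_comp_transpose[OF t bd(1,2)])
  have nc': "nc_le E ?t \<gamma>" by (rule nc_le_split_lower[OF t g fin nc bd o])
  note sc = separating_card[OF t n fin bd o ne]
  note sp = cycles_split[OF t fin bd(1,2) o bd(3)]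
  note pn = cycle_partition_partition[OF n fin] and pt' = cycle_partition_partition[OF t' fin]
  note J = part_join_is_join[OF pt' pn] and pJ = partition_on_part_join[OF pt' pn]
  have r: "refines E (cycle_partition E \<tau>) (cycle_partition E \<gamma>)"
    "refines E (cycle_partition E ?t) (cycle_partition E \<gamma>)"
    using nc nc' unfolding nc_le_def by auto
  have L: "L_defect E (part_join E (cycle_partition E ?t) (cycle_partition E \<nu>))
         (cycle_partition E \<gamma>) (cycle_partition E ?t) = 0"
    using c sc(2) sp(2) part_join_absorb_mid[OF r(1) pn] part_join_absorb_mid[OF r(2) pn]
    unfolding cutting_def L_defect_def num_cycles_def by simp
  have nt: "(\<nu> \<circ> ?t) permutes E" by (rule permutes_compose[OF t' n])
  have "refines E (cycle_partition E (\<nu> \<circ> ?t))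
    (part_join E (cycle_partition E ?t) (cycle_partition E \<nu>))"
    by (rule refines_comp[OF n t' fin J(2,1)])
  then have "d \<notin> orbit (\<nu> \<circ> ?t) b"
    using refines_cycle_partitionD(2)[OF nt fin _ bd(1)] sc(1) by blast
  from cycles_join(2)[OF nt fin bd(1,2) this]
  have "num_cycles E (\<nu> \<circ> ?t) = num_cycles E (\<nu> \<circ> \<tau>) + 1" by (simp add: comp_assoc)
  then have "genus E \<nu> ?t = 0"
    using c sc(2) sp(2) unfolding cutting_def genus_0_iff
    by (simp add: part_join_commute[of E "cycle_partition E \<nu>"])
  then show ?thesis unfolding cutting_def using t' nc' L by blast
qed

text \<open>The cutting with all cycles of \<open>\<gamma>\<close> intact can be split as long as some vertex separates, and
  the number of cycles bounds the number of splits.\<close>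

lemma nonseparable_cutting_exists:
  assumes g: "\<gamma> permutes E" and n: "\<nu> permutes E" and fin: "finite E" and "genus E \<gamma> \<nu> = 0"
  shows "\<exists>\<tau>. cutting E \<gamma> \<nu> \<tau> \<and> nonsep E \<tau> \<nu>"
proof -
  have "\<exists>\<tau>'. cutting E \<gamma> \<nu> \<tau>' \<and> nonsep E \<tau>' \<nu>" if "cutting E \<gamma> \<nu> \<tau>" for \<tau>
    using that
  proof (induction "card E - num_cycles E \<tau>" arbitrary: \<tau> rule: less_induct)
    case less
    show ?case
    proof (cases "nonsep E \<tau> \<nu>")
      case True then show ?thesis using less.prems by blast
    next
      case False
      then obtain b d where bd: "b \<in> E" "d \<in> E" "b \<noteq> d" "d \<in> orbit \<tau> b"
        "part_join E (cycle_partition E (\<tau> \<circ> transpose b d)) (cycle_partition E \<nu>)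
          \<noteq> part_join E (cycle_partition E \<tau>) (cycle_partition E \<nu>)"
        unfolding nonsep_def by blast
      have t: "\<tau> permutes E" using less.prems unfolding cutting_def by blast
      have "num_cycles E (\<tau> \<circ> transpose b d) \<le> card E" unfolding num_cycles_def cycle_partition_def
        by (rule card_image_le[OF fin])
      then show ?thesis
        using less.hyps[OF _ cutting_split[OF g n fin less.prems bd]]
          cycles_split(2)[OF t fin bd(1,2,4,3)] by simp
    qed
  qed
  then show ?thesis using cutting_refl[OF assms] by blast
qed

text \<open>A nontrivial cutting starts with some split of \<open>\<gamma>\<close> above \<open>\<tau>\<close>. The forest condition for \<open>\<gamma>\<close>
  passes to the split permutation, and comparing the two counts shows that the number of
  components has grown.\<close>

lemma cutting_separating:
  assumes g: "\<gamma> permutes E" and n: "\<nu> permutes E" and fin: "finite E" and c: "cutting E \<gamma> \<nu> \<tau>"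
    and ne: "\<tau> \<noteq> \<gamma>"
  obtains b d where "b \<in> E" "d \<in> E" "b \<noteq> d" "d \<in> orbit \<gamma> b"
    "part_join E (cycle_partition E (\<gamma> \<circ> transpose b d)) (cycle_partition E \<nu>)
       \<noteq> part_join E (cycle_partition E \<gamma>) (cycle_partition E \<nu>)"
proof -
  have t: "\<tau> permutes E" and nc: "nc_le E \<tau> \<gamma>" using c unfolding cutting_def by auto
  obtain b d where bd: "b \<in> E" "d \<in> E" "b \<noteq> d" "d \<in> orbit \<gamma> b" "nc_le E \<tau> (\<gamma> \<circ> transpose b d)"
    using nc_le_induct_step[OF t g fin nc ne] by blast
  let ?g = "\<gamma> \<circ> transpose b d" and ?S = "part_join E (cycle_partition E \<tau>) (cycle_partition E \<nu>)"
  note pn = cycle_partition_partition[OF n fin] and pt = cycle_partition_partition[OF t fin]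
  note J = part_join_is_join[OF pt pn]
  note sp = cycles_split[OF g fin bd(1,2,4,3)]
  have r: "refines E (cycle_partition E \<tau>) (cycle_partition E \<gamma>)"
    "refines E (cycle_partition E \<tau>) (cycle_partition E ?g)"
    using nc bd(5) unfolding nc_le_def by auto
  have L: "L_defect E (cycle_partition E \<gamma>) ?S (cycle_partition E \<tau>) = 0"
    using c L_defect_commute unfolding cutting_def by metis
  have "L_defect E (cycle_partition E ?g) ?S (cycle_partition E \<tau>) = 0"
    by (rule L_defect_refine[OF fin r(2) sp(3) J(1) L])
  then have "card (part_join E (cycle_partition E ?g) (cycle_partition E \<nu>))
    = card (part_join E (cycle_partition E \<gamma>) (cycle_partition E \<nu>)) + 1"
    using L sp(2) part_join_absorb_mid[OF r(1) pn] part_join_absorb_mid[OF r(2) pn]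
    unfolding L_defect_def num_cycles_def
    by (simp add: part_join_commute[of E _ ?S])
  then have "part_join E (cycle_partition E ?g) (cycle_partition E \<nu>)
    \<noteq> part_join E (cycle_partition E \<gamma>) (cycle_partition E \<nu>)" by (metis n_not_Suc_n Suc_eq_plus1)
  then show thesis by (rule that[OF bd(1-4)])
qed

lemma exit_exists:
  assumes "x \<in> S" "y \<in> orbit \<sigma> x" "y \<notin> S" "x \<in> orbit \<sigma> x"
  shows "\<exists>z\<in>orbit \<sigma> x. z \<in> S \<and> \<sigma> z \<notin> S"
proof (rule ccontr)
  assume n: "\<not> ?thesis"
  have "orbit \<sigma> x \<subseteq> S \<inter> orbit \<sigma> x"
    by (rule orbit_subset_closed) (use n assms(1,4) orbit.step[of _ \<sigma> x] in auto)
  then show False using assms by blast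
qed

text \<open>Let \<open>A\<close> and \<open>A'\<close> be the two arcs into which the split divides a cycle of \<open>\<gamma>\<close>. If some cycle \<open>W\<close>
  of \<open>\<tau>\<close> crossed from one to the other, it would do so exactly once in each direction, say after
  \<open>b'\<close> and after \<open>d'\<close>. Then \<open>\<tau> (b' d')\<close> respects the arcs on \<open>W\<close>. By the forest condition \<open>W\<close> is the only
  cycle of \<open>\<tau>\<close> in its component that belongs to this cycle of \<open>\<gamma>\<close>, so the component falls apart
  along the disconnection caused by the split of \<open>\<gamma>\<close>, against non-separability. Therefore \<open>\<tau>\<close>
  refines the split permutation.\<close>

lemma cutting_descends:
  assumes g: "\<gamma> permutes E" and n: "\<nu> permutes E" and fin: "finite E" and c: "cutting E \<gamma> \<nu> \<tau>"
    and ns: "nonsep E \<tau> \<nu>" and bd: "b \<in> E" "d \<in> E" "b \<noteq> d" and o: "d \<in> orbit \<gamma> b"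
    and ne: "part_join E (cycle_partition E (\<gamma> \<circ> transpose b d)) (cycle_partition E \<nu>)
       \<noteq> part_join E (cycle_partition E \<gamma>) (cycle_partition E \<nu>)"
  shows "cutting E (\<gamma> \<circ> transpose b d) \<nu> \<tau>"
proof -
  have t: "\<tau> permutes E" and nc: "nc_le E \<tau> \<gamma>"
    and L: "L_defect E (part_join E (cycle_partition E \<tau>) (cycle_partition E \<nu>))
         (cycle_partition E \<gamma>) (cycle_partition E \<tau>) = 0"
    using c unfolding cutting_def by auto
  let ?g = "\<gamma> \<circ> transpose b d" and ?S = "part_join E (cycle_partition E \<tau>) (cycle_partition E \<nu>)"
  have g': "?g permutes E" by (rule permutes_comp_transpose[OF g bd(1,2)])
  let ?J = "part_join E (cycle_partition E ?g) (cycle_partition E \<nu>)"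
  note pn = cycle_partition_partition[OF n fin] and pt = cycle_partition_partition[OF t fin]
    and pg = cycle_partition_partition[OF g fin] and pg' = cycle_partition_partition[OF g' fin]
  note S = part_join_is_join[OF pt pn] and pS = partition_on_part_join[OF pt pn]
  note J = part_join_is_join[OF pg' pn] and pJ = partition_on_part_join[OF pg' pn]
  note sp = cycles_split[OF g fin bd(1,2) o bd(3)]
  have r: "refines E (cycle_partition E \<tau>) (cycle_partition E \<gamma>)" using nc unfolding nc_le_def by auto
  note sc = separating_card[OF g n fin bd o ne]
  define A A' where "A = orbit ?g d" and "A' = orbit ?g b"
  have dA: "d \<in> A" and bA': "b \<in> A'" unfolding A_def A'_def using self_in_orbit[OF g' fin] by auto
  have AA': "A \<inter> A' = {}"
  proof (rule ccontr)
    assume "A \<inter> A' \<noteq> {}"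
    then have "A = A'" unfolding A_def A'_def using orbit_eq_of_mem[OF g' fin] by blast
    then show False using dA orbit_comp_transpose_splits[OF g fin o bd(3)] unfolding A'_def by blast
  qed
  have AE: "A \<subseteq> E" "A' \<subseteq> E" unfolding A_def A'_def using permutes_orbit_subset[OF g'] bd by auto
  have bg: "block (cycle_partition E \<gamma>) z = (if z \<in> A \<union> A' then A \<union> A' else orbit ?g z)" if "z \<in> E" for z
    unfolding sp(1) block_merge[OF pg' bd(1,2) that] block_cycle_partition[OF g' fin bd(1)]
      block_cycle_partition[OF g' fin bd(2)] block_cycle_partition[OF g' fin that] A_def A'_def
    by (simp add: Un_commute)
  have exitA: "x = d" if "x \<in> A" "\<gamma> x \<notin> A" for x
  proof (rule ccontr)
    assume "x \<noteq> d"
    moreover have "x \<noteq> b" using that AA' bA' by blast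
    ultimately have "?g x = \<gamma> x" by simp
    moreover have "?g x \<in> A" using that(1) unfolding A_def by (rule orbit.step)
    ultimately show False using that by simp
  qed
  have exitA': "x = b" if "x \<in> A'" "\<gamma> x \<notin> A'" for x
  proof (rule ccontr)
    assume "x \<noteq> b"
    moreover have "x \<noteq> d" using that AA' dA by blast
    ultimately have "?g x = \<gamma> x" by simp
    moreover have "?g x \<in> A'" using that(1) unfolding A'_def by (rule orbit.step)
    ultimately show False using that by simp
  qed
  have "unique_exit \<gamma> A" "unique_exit \<gamma> A'"
    unfolding unique_exit_def using exitA exitA' by blast+
  then have U: "unique_exit \<tau> A" "unique_exit \<tau> A'"
    using nc_le_unique_exit[OF t g fin nc] by blast+
  have main: "\<tau> x \<in> orbit ?g x" if x: "x \<in> E" for x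
  proof (rule ccontr)
    assume nx: "\<tau> x \<notin> orbit ?g x"
    have tx: "\<tau> x \<in> block (cycle_partition E \<gamma>) x" by (rule refines_cycle_partitionD(1)[OF t fin r x])
    have xAA: "x \<in> A \<union> A'" using tx nx bg[OF x] by (auto split: if_splits)
    then have txAA: "\<tau> x \<in> A \<union> A'" using tx bg[OF x] by simp
    have cross: "\<tau> x \<notin> A" if "x \<in> A"
    proof -
      have "orbit ?g x = A" using that orbit_eq_of_mem[OF g' fin] unfolding A_def by blast
      then show ?thesis using nx by simp
    qed
    have cross': "\<tau> x \<notin> A'" if "x \<in> A'"
    proof -
      have "orbit ?g x = A'" using that orbit_eq_of_mem[OF g' fin] unfolding A'_def by blast
      then show ?thesis using nx by simp
    qed
    define W where "W = orbit \<tau> x"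
    have WAA: "W \<subseteq> A \<union> A'"
      unfolding W_def using refines_cycle_partitionD(2)[OF t fin r x] bg[OF x] xAA by simp
    have xW: "x \<in> W" "\<tau> x \<in> W" unfolding W_def using self_in_orbit[OF t fin] orbit.base[of \<tau> x] by auto
    obtain u v where uv: "u \<in> W" "u \<in> A" "v \<in> W" "v \<in> A'"
      using xW xAA txAA cross cross' by blast
    have ow: "orbit \<tau> w = W" if "w \<in> W" for w
      using that orbit_eq_of_mem[OF t fin] unfolding W_def by blast
    \<comment> \<open>The unique points of \<open>W\<close> at which \<open>\<tau>\<close> crosses between the arcs.\<close>
    obtain b' where b': "b' \<in> W" "b' \<in> A" "\<tau> b' \<notin> A"
      using exit_exists[of u A v \<tau>] uv AA' ow[OF uv(1)] by auto
    obtain d' where d': "d' \<in> W" "d' \<in> A'" "\<tau> d' \<notin> A'"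
      using exit_exists[of v A' u \<tau>] uv AA' ow[OF uv(3)] by auto
    have WE: "W \<subseteq> E" using WAA AE by blast
    have bd': "b' \<in> E" "d' \<in> E" "b' \<noteq> d'" using b' d' WE AA' by auto
    have o': "d' \<in> orbit \<tau> b'" using ow[OF b'(1)] d' by simp
    have td: "\<tau> d' \<in> A"
      using d' WAA ow[OF d'(1)] orbit.base[of \<tau> d'] by auto
    let ?t = "\<tau> \<circ> transpose b' d'"
    have t': "?t permutes E" by (rule permutes_comp_transpose[OF t bd'(1,2)])
    note pt' = cycle_partition_partition[OF t' fin]
    have nsS: "part_join E (cycle_partition E ?t) (cycle_partition E \<nu>) = ?S"
      using ns bd' o' unfolding nonsep_def by blast
    note S' = part_join_is_join(1)[OF pt' pn, unfolded nsS]
    have stay: "?t z \<in> A" if "z \<in> W" "z \<in> A" for z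
    proof (cases "z = b'")
      case True then show ?thesis using td by simp
    next
      case False
      have "z \<noteq> d'" using that d' AA' by blast
      then have e: "?t z = \<tau> z" using False by simp
      have "z \<in> orbit \<tau> b'" using that ow[OF b'(1)] by simp
      then show ?thesis using U(1) b' that False unfolding unique_exit_def e by blast
    qed
    define X where "X = block ?J d"
    define C where "C = block ?S b'"
    have AX: "A \<subseteq> X" unfolding A_def X_def by (rule refines_cycle_partitionD(2)[OF g' fin J(1) bd(2)])
    have A'X: "A' \<inter> X = {}"
    proof (rule ccontr)
      assume "A' \<inter> X \<noteq> {}"
      moreover have "A' \<subseteq> block ?J b" unfolding A'_def by (rule refines_cycle_partitionD(2)[OF g' fin J(1) bd(1)])
      ultimately obtain z where "z \<in> block ?J b" "z \<in> block ?J d" unfolding X_def by blast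
      then have "block ?J b = block ?J d" using block_eq_of_mem[OF pJ] by metis
      then show False using sc(1) block_in(2)[OF pJ bd(2)] by simp
    qed
    have XE: "X \<subseteq> E" "C \<subseteq> E" unfolding X_def C_def using block_subset[OF pJ] block_subset[OF pS] by auto
    have bXz: "block ?J z = X" if "z \<in> X" for z using that block_eq_of_mem[OF pJ] unfolding X_def by blast
    have bCz: "block ?S z = C" if "z \<in> C" for z using that block_eq_of_mem[OF pS] unfolding C_def by blast
    have b'C: "b' \<in> C" unfolding C_def using block_in(2)[OF pS bd'(1)] .
    \<comment> \<open>On the component \<open>C\<close>, the split of \<open>\<tau>\<close> stays on the side \<open>X\<close> of the disconnection.\<close>
    have closed: "?t z \<in> C \<inter> X" if z: "z \<in> C \<inter> X" for z
    proof
      have zE: "z \<in> E" using z XE by blast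
      show "?t z \<in> C" using refines_cycle_partitionD(1)[OF t' fin S' zE] bCz z by blast
      show "?t z \<in> X"
      proof (cases "z \<in> A \<union> A'")
        case True
        then have zA: "z \<in> A" using A'X z by blast
        have "z \<in> block (cycle_partition E \<gamma>) b'" using bg[OF bd'(1)] b' True by simp
        then have "z \<in> block (cycle_partition E \<tau>) b'"
          using L_defect_0_unique_edge[OF fin S(1) r L bd'(1)] z unfolding C_def by blast
        then have "z \<in> W" using block_cycle_partition[OF t fin bd'(1)] ow[OF b'(1)] by simp
        then show ?thesis using stay zA AX by blast
      next
        case False
        then have "z \<noteq> b'" "z \<noteq> d'" using b' d' by auto
        then have "?t z = \<tau> z" by simp
        moreover have "\<tau> z \<in> orbit ?g z"
          using refines_cycle_partitionD(1)[OF t fin r zE] bg[OF zE] False by simp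
        moreover have "orbit ?g z \<subseteq> block ?J z" by (rule refines_cycle_partitionD(2)[OF g' fin J(1) zE])
        ultimately show ?thesis using bXz z by auto
      qed
    qed
    have "block ?S b' \<subseteq> C \<inter> X"
    proof (subst nsS[symmetric], rule block_join_invariant[OF pt' pn])
      show "C \<inter> X \<subseteq> E" using XE by blast
      show "b' \<in> C \<inter> X" using b'C b' AX by blast
      fix z assume z: "z \<in> C \<inter> X"
      then have zE: "z \<in> E" using XE by blast
      show "block (cycle_partition E ?t) z \<subseteq> C \<inter> X"
        unfolding block_cycle_partition[OF t' fin zE] by (rule orbit_subset_closed[OF z closed])
      show "block (cycle_partition E \<nu>) z \<subseteq> C \<inter> X"
        using refines_block_subset[OF S(2), of z] refines_block_subset[OF J(2), of z] bXz bCz z by blast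
    qed
    moreover have "d' \<in> block ?S b'" using refines_cycle_partitionD(2)[OF t fin S(1) bd'(1)] o' by blast
    ultimately show False using A'X d' by blast
  qed
  have r': "refines E (cycle_partition E \<tau>) (cycle_partition E ?g)"
    by (rule refines_cycle_partitionI[OF t fin pg']) (use main block_cycle_partition[OF g' fin] in simp)
  note it = permutes_inv[OF t]
  have K: "(inv \<tau> \<circ> ?g) permutes E" by (rule permutes_compose[OF g' it])
  have "refines E (cycle_partition E (inv \<tau> \<circ> ?g)) (cycle_partition E ?g)"
    by (rule refines_comp[OF it g' fin]) (use r' cycle_partition_inv[OF t fin] refines_refl[OF pg'] in auto)
  from refines_cycle_partitionD(2)[OF K fin this bd(1)]
  have "d \<notin> orbit (inv \<tau> \<circ> ?g) b"
    using orbit_comp_transpose_splits[OF g fin o bd(3)] block_cycle_partition[OF g' fin bd(1)] by blast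
  from cycles_join(2)[OF K fin bd(1,2) this]
  have "num_cycles E (inv \<tau> \<circ> ?g) = num_cycles E (inv \<tau> \<circ> \<gamma>) + 1" by (simp add: comp_assoc)
  then have nc': "nc_le E \<tau> ?g" using r' nc sp(2) unfolding nc_le_def by simp
  have "L_defect E (cycle_partition E ?g) ?S (cycle_partition E \<tau>) = 0"
    by (rule L_defect_refine[OF fin r' sp(3) S(1)]) (use L L_defect_commute in metis)
  then show ?thesis using c nc' L_defect_commute unfolding cutting_def by metis
qed

text \<open>As long as \<open>\<gamma>\<close> has a separating pair, both cuttings descend to the same split of \<open>\<gamma>\<close>; once it has
  none, both equal \<open>\<gamma>\<close>.\<close>

lemma nonseparable_cutting_unique:
  assumes "\<gamma> permutes E" and n: "\<nu> permutes E" and fin: "finite E"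
    and "cutting E \<gamma> \<nu> \<tau>1" and ns1: "nonsep E \<tau>1 \<nu>"
    and "cutting E \<gamma> \<nu> \<tau>2" and ns2: "nonsep E \<tau>2 \<nu>"
  shows "\<tau>1 = \<tau>2"
  using assms(1,4,6)
proof (induction "card E - num_cycles E \<gamma>" arbitrary: \<gamma> rule: less_induct)
  case less
  note g = less.prems(1)
  show ?case
  proof (cases "\<exists>b\<in>E. \<exists>d\<in>E. b \<noteq> d \<and> d \<in> orbit \<gamma> b \<and>
      part_join E (cycle_partition E (\<gamma> \<circ> transpose b d)) (cycle_partition E \<nu>)
       \<noteq> part_join E (cycle_partition E \<gamma>) (cycle_partition E \<nu>)")
    case True
    then obtain b d where bd: "b \<in> E" "d \<in> E" "b \<noteq> d" "d \<in> orbit \<gamma> b"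
      "part_join E (cycle_partition E (\<gamma> \<circ> transpose b d)) (cycle_partition E \<nu>)
       \<noteq> part_join E (cycle_partition E \<gamma>) (cycle_partition E \<nu>)" by blast
    have "num_cycles E (\<gamma> \<circ> transpose b d) \<le> card E" unfolding num_cycles_def cycle_partition_def
      by (rule card_image_le[OF fin])
    then show ?thesis
      using less.hyps[OF _ permutes_comp_transpose[OF g bd(1,2)]
          cutting_descends[OF g n fin less.prems(2) ns1 bd]
          cutting_descends[OF g n fin less.prems(3) ns2 bd]]
        cycles_split(2)[OF g fin bd(1,2,4,3)] by simp
  next
    case False
    then have "\<tau>1 = \<gamma>" "\<tau>2 = \<gamma>"
      using cutting_separating[OF g n fin less.prems(2)] cutting_separating[OF g n fin less.prems(3)]
      by metis+
    then show ?thesis by simp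
  qed
qed

section \<open>Transfer of the defect conditions\<close>

lemma part_join_absorb_left:
  assumes NP: "refines E N P" and T: "partition_on E T"
  shows "part_join E P (part_join E T N) = part_join E P T"
proof -
  note p = refines_partition[OF NP]
  have "part_join E P (part_join E T N) = part_join E P (part_join E N T)"
    by (simp only: part_join_commute)
  also have "\<dots> = part_join E (part_join E P N) T" by (rule part_join_assoc[OF p(2,1) T, symmetric])
  also have "part_join E P N = P" using part_join_absorb[OF NP] by (simp only: part_join_commute)
  finally show ?thesis .
qed

text \<open>Given the cutting, the defect of \<open>(\<gamma>, \<nu>, P)\<close> is the sum of the two defects in the conclusion, both of
  which are nonnegative.\<close>

lemma cutting_defects:
  assumes g: "\<gamma> permutes E" and n: "\<nu> permutes E" and fin: "finite E" and c: "cutting E \<gamma> \<nu> \<tau>"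
    and r: "refines E (cycle_partition E \<nu>) P" and j: "part_join E P (cycle_partition E \<gamma>) = {E}"
    and L: "L_defect E P (part_join E (cycle_partition E \<gamma>) (cycle_partition E \<nu>)) (cycle_partition E \<nu>) = 0"
  shows "part_join E (part_join E P (cycle_partition E \<tau>)) (cycle_partition E \<gamma>) = {E}"
    and "L_defect E (part_join E P (cycle_partition E \<tau>)) (cycle_partition E \<gamma>) (cycle_partition E \<tau>) = 0"
    and "L_defect E P (part_join E (cycle_partition E \<tau>) (cycle_partition E \<nu>)) (cycle_partition E \<nu>) = 0"
proof -
  have t: "\<tau> permutes E" and nc: "refines E (cycle_partition E \<tau>) (cycle_partition E \<gamma>)"
    and Lc: "L_defect E (part_join E (cycle_partition E \<tau>) (cycle_partition E \<nu>))
         (cycle_partition E \<gamma>) (cycle_partition E \<tau>) = 0"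
    using c unfolding cutting_def nc_le_def by auto
  note pn = cycle_partition_partition[OF n fin] and pt = cycle_partition_partition[OF t fin]
    and pg = cycle_partition_partition[OF g fin] and pP = refines_partition(2)[OF r]
  have "part_join E (part_join E P (cycle_partition E \<tau>)) (cycle_partition E \<gamma>)
    = part_join E (part_join E (cycle_partition E \<tau>) P) (cycle_partition E \<gamma>)"
    by (simp only: part_join_commute)
  also have "\<dots> = part_join E (cycle_partition E \<gamma>) P" by (rule part_join_absorb_mid[OF nc pP])
  also have "\<dots> = {E}" using j by (simp only: part_join_commute)
  finally show 1: "part_join E (part_join E P (cycle_partition E \<tau>)) (cycle_partition E \<gamma>) = {E}" .
  have 2: "part_join E P (part_join E (cycle_partition E \<gamma>) (cycle_partition E \<nu>)) = {E}"
    using part_join_absorb_left[OF r pg] j by simp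
  note 3 = part_join_absorb_left[OF r pt]
  note 4 = part_join_absorb_mid[OF nc pn]
  have "0 \<le> L_defect E (part_join E P (cycle_partition E \<tau>)) (cycle_partition E \<gamma>) (cycle_partition E \<tau>)"
    by (rule L_defect_nonneg[OF fin part_join_is_join(2)[OF pP pt] nc])
  moreover have "0 \<le> L_defect E P (part_join E (cycle_partition E \<tau>) (cycle_partition E \<nu>)) (cycle_partition E \<nu>)"
    by (rule L_defect_nonneg[OF fin r part_join_is_join(2)[OF pt pn]])
  ultimately show
    "L_defect E (part_join E P (cycle_partition E \<tau>)) (cycle_partition E \<gamma>) (cycle_partition E \<tau>) = 0"
    "L_defect E P (part_join E (cycle_partition E \<tau>) (cycle_partition E \<nu>)) (cycle_partition E \<nu>) = 0"
    using L Lc unfolding L_defect_def 1 2 3 4 by auto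
qed

text \<open>The forest condition for the components follows from that for \<open>P \<or> \<Pi>(\<tau>)\<close>, since the components
  are finer. The genus of \<open>(\<gamma>, \<nu>)\<close> is at most zero by subadditivity applied to the factorization
  \<open>\<gamma> \<nu> = (\<gamma> \<tau>\<^sup>-\<^sup>1) (\<tau> \<nu>)\<close>.\<close>

lemma cutting_from_defects:
  assumes g: "\<gamma> permutes E" and n: "\<nu> permutes E" and t: "\<tau> permutes E" and fin: "finite E"
    and nc: "nc_le E \<tau> \<gamma>" and ge: "genus E \<nu> \<tau> = 0"
    and r: "refines E (cycle_partition E \<nu>) P"
    and j: "part_join E (part_join E P (cycle_partition E \<tau>)) (cycle_partition E \<gamma>) = {E}"
    and L1: "L_defect E (part_join E P (cycle_partition E \<tau>)) (cycle_partition E \<gamma>) (cycle_partition E \<tau>) = 0"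
    and L2: "L_defect E P (part_join E (cycle_partition E \<tau>) (cycle_partition E \<nu>)) (cycle_partition E \<nu>) = 0"
  shows "cutting E \<gamma> \<nu> \<tau>" "genus E \<gamma> \<nu> = 0" "part_join E P (cycle_partition E \<gamma>) = {E}"
    "L_defect E P (part_join E (cycle_partition E \<gamma>) (cycle_partition E \<nu>)) (cycle_partition E \<nu>) = 0"
proof -
  note pn = cycle_partition_partition[OF n fin] and pt = cycle_partition_partition[OF t fin]
    and pg = cycle_partition_partition[OF g fin] and pP = refines_partition(2)[OF r]
  have tg: "refines E (cycle_partition E \<tau>) (cycle_partition E \<gamma>)" using nc unfolding nc_le_def by blast
  let ?S = "part_join E (cycle_partition E \<tau>) (cycle_partition E \<nu>)"
  note S = part_join_is_join[OF pt pn]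
  have "part_join E (part_join E P (cycle_partition E \<tau>)) (cycle_partition E \<gamma>)
    = part_join E (part_join E (cycle_partition E \<tau>) P) (cycle_partition E \<gamma>)"
    by (simp only: part_join_commute)
  also have "\<dots> = part_join E (cycle_partition E \<gamma>) P" by (rule part_join_absorb_mid[OF tg pP])
  finally show jP: "part_join E P (cycle_partition E \<gamma>) = {E}"
    using j by (simp only: part_join_commute)
  have 2: "part_join E P (part_join E (cycle_partition E \<gamma>) (cycle_partition E \<nu>)) = {E}"
    using part_join_absorb_left[OF r pg] jP by simp
  note 3 = part_join_absorb_left[OF r pt]
  note 4 = part_join_absorb_mid[OF tg pn]
  note PJ = part_join_is_join[OF pP pt]
  have "refines E ?S (part_join E P (cycle_partition E \<tau>))"
    by (rule S(3)[OF PJ(2) refines_trans[OF r PJ(1)]])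
  from L_defect_refine[OF fin S(1) this tg L1]
  have L: "L_defect E ?S (cycle_partition E \<gamma>) (cycle_partition E \<tau>) = 0" .
  then show "cutting E \<gamma> \<nu> \<tau>" unfolding cutting_def using t nc ge by blast
  show "L_defect E P (part_join E (cycle_partition E \<gamma>) (cycle_partition E \<nu>)) (cycle_partition E \<nu>) = 0"
    using L L1 L2 unfolding L_defect_def 2 3 4 j by auto
  note it = permutes_inv[OF t]
  have gti: "(\<gamma> \<circ> inv \<tau>) permutes E" by (rule permutes_compose[OF it g])
  have tn: "(\<tau> \<circ> \<nu>) permutes E" by (rule permutes_compose[OF n t])
  have "(\<gamma> \<circ> inv \<tau>) \<circ> (\<tau> \<circ> \<nu>) = \<gamma> \<circ> (inv \<tau> \<circ> \<tau>) \<circ> \<nu>" by (simp only: comp_assoc)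
  also have "\<dots> = \<gamma> \<circ> \<nu>" unfolding permutes_inv_o(2)[OF t] by simp
  finally have e: "(\<gamma> \<circ> inv \<tau>) \<circ> (\<tau> \<circ> \<nu>) = \<gamma> \<circ> \<nu>" .
  \<comment> \<open>These four counts bound the genus above by zero.\<close>
  have a: "num_cycles E (\<gamma> \<circ> inv \<tau>) + num_cycles E (\<tau> \<circ> \<nu>) \<le> card E + num_cycles E (\<gamma> \<circ> \<nu>)"
    using num_cycles_comp_ge[OF gti tn fin] unfolding e .
  have b: "num_cycles E (\<gamma> \<circ> inv \<tau>) + num_cycles E \<tau> = card E + num_cycles E \<gamma>"
    using nc num_cycles_comp_commute[OF g it fin] unfolding nc_le_def by simp
  have c: "num_cycles E \<nu> + num_cycles E \<tau> + num_cycles E (\<tau> \<circ> \<nu>) = card E + 2 * card ?S"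
    using ge num_cycles_comp_commute[OF n t fin] unfolding genus_0_iff
    by (simp add: part_join_commute)
  have d: "num_cycles E \<tau> + card (part_join E (cycle_partition E \<gamma>) (cycle_partition E \<nu>))
    = card ?S + num_cycles E \<gamma>"
    using L unfolding L_defect_def 4 num_cycles_def by linarith
  show "genus E \<gamma> \<nu> = 0" unfolding genus_0_iff
    using a b c d genus_inequality[OF g n fin] by linarith
qed

section \<open>Non-separable components\<close>

text \<open>Splitting a cycle inside a component affects no other component, so the absence of cut-vertices
  can be tested globally.\<close>

lemma nonseparable_components_iff:
  assumes t: "\<tau> permutes E" and n: "\<nu> permutes E" and fin: "finite E"
  shows "(\<forall>C \<in> part_join E (cycle_partition E \<tau>) (cycle_partition E \<nu>).
      perm_restrict \<nu> C \<in> NS C (perm_restrict \<tau> C))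
    \<longleftrightarrow> genus E \<nu> \<tau> = 0 \<and> nonsep E \<tau> \<nu>"
proof -
  note pn = cycle_partition_partition[OF n fin] and pt = cycle_partition_partition[OF t fin]
  let ?S = "part_join E (cycle_partition E \<tau>) (cycle_partition E \<nu>)"
  note S = part_join_is_join[OF pt pn] and pS = partition_on_part_join[OF pt pn]
  have ge: "genus E \<nu> \<tau> = 0 \<longleftrightarrow> (\<forall>C\<in>?S. genus C (perm_restrict \<nu> C) (perm_restrict \<tau> C) = 0)"
    by (rule genus_0_blocks[OF n t fin S(2,1)])
  have cut: "part_join C (cycle_partition C (perm_restrict \<tau> C \<circ> transpose b d))
        (cycle_partition C (perm_restrict \<nu> C)) = {C} \<longleftrightarrow>
      part_join E (cycle_partition E (\<tau> \<circ> transpose b d)) (cycle_partition E \<nu>) = ?S"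
    if C: "C \<in> ?S" and bd: "b \<in> C" "d \<in> C" "b \<noteq> d" and o: "d \<in> orbit \<tau> b" for C b d
  proof -
    have CE: "C \<subseteq> E" using C pS unfolding partition_on_def by blast
    then have bdE: "b \<in> E" "d \<in> E" using bd by auto
    let ?t = "\<tau> \<circ> transpose b d"
    have t': "?t permutes E" by (rule permutes_comp_transpose[OF t bdE])
    note pt' = cycle_partition_partition[OF t' fin]
    let ?J = "part_join E (cycle_partition E ?t) (cycle_partition E \<nu>)"
    have r: "refines E (cycle_partition E ?t) ?S"
      by (rule refines_trans[OF cycles_split(3)[OF t fin bdE o bd(3)] S(1)])
    note pJ = partition_on_part_join[OF pt' pn] and JS = part_join_is_join(3)[OF pt' pn r S(2)]
    have "perm_restrict (\<tau> \<circ> transpose b d) C = perm_restrict \<tau> C \<circ> perm_restrict (transpose b d) C"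
      by (rule perm_restrict_comp_closed) (use bd in \<open>auto simp: transpose_def\<close>)
    moreover have "perm_restrict (transpose b d) C = transpose b d"
      using bd by (auto simp: perm_restrict_def transpose_def fun_eq_iff)
    ultimately have "part_join C (cycle_partition C (perm_restrict \<tau> C \<circ> transpose b d))
        (cycle_partition C (perm_restrict \<nu> C)) = blocks_in ?J C"
      using part_join_perm_restrict[OF t' n fin r S(2) C] by simp
    moreover have "blocks_in ?J C = {C} \<longleftrightarrow> ?J = ?S"
    proof
      assume "?J = ?S"
      then show "blocks_in ?J C = {C}" using blocks_in_self[OF pS C] by simp
    next
      assume "blocks_in ?J C = {C}"
      then have "C \<in> ?J" unfolding blocks_in_def by blast
      then have "d \<in> block ?J b" using block_eq[OF pJ _ bd(1)] bd(2) by simp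
      then show "?J = ?S"
        using join_split_cycle[OF t n fin bdE bd(3) o] merge_same[OF pJ bdE(1)] by simp
    qed
    ultimately show ?thesis by simp
  qed
  have NS: "perm_restrict \<nu> C \<in> NS C (perm_restrict \<tau> C) \<longleftrightarrow>
      genus C (perm_restrict \<nu> C) (perm_restrict \<tau> C) = 0 \<and>
      (\<forall>b\<in>C. \<forall>d\<in>C. b \<noteq> d \<and> d \<in> orbit \<tau> b \<longrightarrow>
        part_join E (cycle_partition E (\<tau> \<circ> transpose b d)) (cycle_partition E \<nu>) = ?S)"
    if C: "C \<in> ?S" for C
  proof -
    have 1: "perm_restrict \<nu> C permutes C" by (rule perm_restrict_permutes[OF n fin S(2) C])
    have 2: "part_join C (cycle_partition C (perm_restrict \<tau> C)) (cycle_partition C (perm_restrict \<nu> C)) = {C}"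
      using part_join_perm_restrict[OF t n fin S(1,2) C] blocks_in_self[OF pS C] by simp
    have 3: "orbit (perm_restrict \<tau> C) b = orbit \<tau> b" if "b \<in> C" for b
      by (rule orbit_perm_restrict[OF t fin S(1) C that])
    show ?thesis unfolding NS_def using 1 2 3 cut[OF C] by simp
  qed
  show ?thesis
  proof
    assume a: "\<forall>C\<in>?S. perm_restrict \<nu> C \<in> NS C (perm_restrict \<tau> C)"
    have "nonsep E \<tau> \<nu>" unfolding nonsep_def
    proof (intro ballI impI)
      fix b d assume bd: "b \<in> E" "d \<in> E" "b \<noteq> d \<and> d \<in> orbit \<tau> b"
      have C: "block ?S b \<in> ?S" "b \<in> block ?S b" using block_in[OF pS bd(1)] by auto
      moreover have "d \<in> block ?S b" using refines_cycle_partitionD(2)[OF t fin S(1) bd(1)] bd(3) by blast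
      ultimately show "part_join E (cycle_partition E (\<tau> \<circ> transpose b d)) (cycle_partition E \<nu>) = ?S"
        using NS[OF C(1)] a bd(3) by blast
    qed
    then show "genus E \<nu> \<tau> = 0 \<and> nonsep E \<tau> \<nu>" using ge a NS by blast
  next
    assume a: "genus E \<nu> \<tau> = 0 \<and> nonsep E \<tau> \<nu>"
    show "\<forall>C\<in>?S. perm_restrict \<nu> C \<in> NS C (perm_restrict \<tau> C)"
    proof
      fix C assume C: "C \<in> ?S"
      have "C \<subseteq> E" using C pS unfolding partition_on_def by blast
      then show "perm_restrict \<nu> C \<in> NS C (perm_restrict \<tau> C)"
        unfolding NS[OF C] using a ge C unfolding nonsep_def by blast
    qed
  qed
qed

text \<open>If \<open>\<nu> c\<close> moved \<open>b\<close> to \<open>d \<noteq> b\<close>, splitting \<open>c\<close> at \<open>b\<close> and \<open>d\<close> would add a cycle to both \<open>c\<close> and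
  \<open>\<nu> c\<close>, and nonnegativity of the genus would force the split map to be disconnected.\<close>

lemma NS_single_cycle:
  assumes c: "c permutes C" and cyc: "cycle_partition C c = {C}" and fin: "finite C" 
  shows "NS C c = {inv c}"
proof -
  note ic = permutes_inv[OF c]
  have num: "num_cycles C c = 1" unfolding num_cycles_def cyc by simp
  have ne: "C \<noteq> {}" using cyc unfolding cycle_partition_def by auto
  have full: "part_join C (cycle_partition C c) (cycle_partition C n) = {C}" if n: "n permutes C" for n
    unfolding cyc using part_join_absorb[OF refines_one_block[OF cycle_partition_partition[OF n fin] ne]]
    by (simp add: part_join_commute)
  have "\<nu> = inv c" if nu: "\<nu> \<in> NS C c" for \<nu>
  proof -
    have n: "\<nu> permutes C" and ge: "genus C \<nu> c = 0"
      and cut: "\<And>b d. b \<in> C \<Longrightarrow> d \<in> C \<Longrightarrow> b \<noteq> d \<Longrightarrow> d \<in> orbit c b \<Longrightarrow>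
        part_join C (cycle_partition C (c \<circ> transpose b d)) (cycle_partition C \<nu>) = {C}"
      using nu unfolding NS_def by auto
    have K: "(\<nu> \<circ> c) permutes C" by (rule permutes_compose[OF c n])
    have "\<nu> \<circ> c = id"
    proof (rule ccontr)
      assume "\<nu> \<circ> c \<noteq> id"
      then obtain b where b: "(\<nu> \<circ> c) b \<noteq> b" by (auto simp: fun_eq_iff)
      define d where "d = (\<nu> \<circ> c) b"
      have bC: "b \<in> C" using b permutes_not_in[OF K] by blast
      have dC: "d \<in> C" unfolding d_def using bC permutes_in_image[OF K] by blast
      have bd: "b \<noteq> d" using b d_def by simp
      have od: "d \<in> orbit (\<nu> \<circ> c) b" unfolding d_def by (rule orbit.base)
      have "orbit c b = C" using block_cycle_partition[OF c fin bC] block_in(1)[OF cycle_partition_partition[OF c fin] bC]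
        unfolding cyc by simp
      then have oc: "d \<in> orbit c b" using dC by simp
      have c': "(c \<circ> transpose b d) permutes C" by (rule permutes_comp_transpose[OF c bC dC])
      have "num_cycles C (\<nu> \<circ> (c \<circ> transpose b d)) = num_cycles C (\<nu> \<circ> c) + 1"
        using cycles_split(2)[OF K fin bC dC od bd] by (simp add: comp_assoc)
      moreover have "card (part_join C (cycle_partition C \<nu>) (cycle_partition C (c \<circ> transpose b d))) = 1"
        using cut[OF bC dC bd oc] by (simp add: part_join_commute)
      moreover have "card (part_join C (cycle_partition C \<nu>) (cycle_partition C c)) = 1"
        using full[OF n] by (simp add: part_join_commute)
      ultimately show False
        using genus_inequality[OF n c' fin] ge cycles_split(2)[OF c fin bC dC oc bd] num
        unfolding genus_0_iff by simp
    qed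
    then have "\<nu> \<circ> (c \<circ> inv c) = inv c" by (simp add: comp_assoc[symmetric])
    then show ?thesis unfolding permutes_inv_o(1)[OF c] by simp
  qed
  moreover have "inv c \<in> NS C c"
  proof -
    have "genus C (inv c) c = 0"
      unfolding genus_0_iff permutes_inv_o(2)[OF c] num_cycles_id num_cycles_inv[OF c fin] num
      using full[OF ic] by (simp add: part_join_commute)
    moreover have "part_join C (cycle_partition C (c \<circ> transpose b d)) (cycle_partition C (inv c)) = {C}"
      if "b \<in> C" "d \<in> C" for b d
      unfolding cycle_partition_inv[OF c fin] cyc
      by (rule part_join_absorb, rule refines_one_block[OF _ ne],
          rule cycle_partition_partition[OF permutes_comp_transpose[OF c that] fin])
    ultimately show ?thesis unfolding NS_def using ic full[OF ic] by blast
  qed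
  ultimately show ?thesis by blast
qed

section \<open>Gluing along a partition\<close>

lemma L_defect_sum_blocks:
  assumes fin: "finite E" and TP: "refines E T P" and TQ: "refines E T Q"
    and PR: "refines E P R" and QR: "refines E Q R"
  shows "L_defect E P Q T = (\<Sum>B\<in>R. L_defect B (blocks_in P B) (blocks_in Q B) (blocks_in T B))"
proof -
  note p = refines_partition(1)[OF PR] refines_partition(1)[OF QR]
  have "card (part_join E P Q) = (\<Sum>B\<in>R. card (part_join B (blocks_in P B) (blocks_in Q B)))"
    unfolding card_blocks_in[OF fin part_join_is_join(3)[OF p PR QR]]
    by (rule sum.cong) (use part_join_blocks_in[OF PR QR] in auto)
  then show ?thesis unfolding L_defect_def
    unfolding card_blocks_in[OF fin PR] card_blocks_in[OF fin QR] card_blocks_in[OF fin refines_trans[OF TP PR]]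
    by (simp add: sum.distrib sum_subtractf)
qed

lemma L_defect_0_blocks:
  assumes fin: "finite E" and TP: "refines E T P" and TQ: "refines E T Q"
    and PR: "refines E P R" and QR: "refines E Q R"
  shows "L_defect E P Q T = 0 \<longleftrightarrow> (\<forall>B\<in>R. L_defect B (blocks_in P B) (blocks_in Q B) (blocks_in T B) = 0)"
proof -
  note pR = refines_partition(2)[OF PR]
  have fR: "finite R" using fin pR finite_elements by blast
  have "0 \<le> L_defect B (blocks_in P B) (blocks_in Q B) (blocks_in T B)" if B: "B \<in> R" for B
    by (rule L_defect_nonneg[OF finite_partition_block[OF pR fin B]
          refines_blocks_in[OF TP PR B] refines_blocks_in[OF TQ QR B]])
  then show ?thesis
    by (subst L_defect_sum_blocks[OF assms]) (rule sum_nonneg_eq_0_iff[OF fR])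
qed

lemma blocks_in_eqI:
  assumes "refines E P R" "refines E Q R" "\<And>B. B \<in> R \<Longrightarrow> blocks_in P B = blocks_in Q B"
  shows "P = Q"
proof -
  have "P = (\<Union>B\<in>R. blocks_in P B)" using Union_blocks_in[OF assms(1)] by simp
  also have "\<dots> = (\<Union>B\<in>R. blocks_in Q B)" using assms(3) by simp
  also have "\<dots> = Q" by (rule Union_blocks_in[OF assms(2)])
  finally show ?thesis .
qed

lemma glue_partitions:
  assumes R: "partition_on E R" and h: "\<And>B. B \<in> R \<Longrightarrow> partition_on B (h B)"
  shows "refines E (\<Union>B\<in>R. h B) R" and "\<And>B. B \<in> R \<Longrightarrow> blocks_in (\<Union>B\<in>R. h B) B = h B"
proof -
  have hB: "X \<subseteq> B" "X \<noteq> {}" if "B \<in> R" "X \<in> h B" for X B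
    using h[OF that(1)] that(2) unfolding partition_on_def by auto
  have same: "B = B'" if "B \<in> R" "B' \<in> R" "X \<in> h B" "X \<inter> B' \<noteq> {}" for X B B'
    using disjointD[OF partition_onD2[OF R] that(1,2)] hB[OF that(1,3)] that(4) by blast
  have "partition_on E (\<Union>B\<in>R. h B)"
  proof (rule partition_onI)
    have "\<Union>(\<Union>B\<in>R. h B) = (\<Union>B\<in>R. \<Union>(h B))" by blast
    also have "\<dots> = \<Union>R" using partition_onD1[OF h] by auto
    finally show "\<Union>(\<Union>B\<in>R. h B) = E" using partition_onD1[OF R] by simp
    show "{} \<notin> (\<Union>B\<in>R. h B)" using hB(2) by blast
    fix X Y assume "X \<in> (\<Union>B\<in>R. h B)" "Y \<in> (\<Union>B\<in>R. h B)" and XY: "X \<noteq> Y"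
    then obtain B B' where B: "B \<in> R" "X \<in> h B" "B' \<in> R" "Y \<in> h B'" by blast
    show "disjnt X Y"
    proof (cases "B = B'")
      case True
      then show ?thesis using disjointD[OF partition_onD2[OF h[OF B(1)]] B(2) _ XY] B(4)
        unfolding disjnt_def by blast
    next
      case False
      then show ?thesis using same[OF B(1,3,2)] hB(1)[OF B(3,4)] unfolding disjnt_def by blast
    qed
  qed
  then show "refines E (\<Union>B\<in>R. h B) R" unfolding refines_def using R hB(1) by blast
  fix B assume B: "B \<in> R"
  show "blocks_in (\<Union>B\<in>R. h B) B = h B"
  proof
    show "h B \<subseteq> blocks_in (\<Union>B\<in>R. h B) B" unfolding blocks_in_def using B hB(1) by blast
    show "blocks_in (\<Union>B\<in>R. h B) B \<subseteq> h B"
    proof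
      fix X assume "X \<in> blocks_in (\<Union>B\<in>R. h B) B"
      then obtain B' where X: "B' \<in> R" "X \<in> h B'" "X \<subseteq> B" unfolding blocks_in_def by blast
      then have "B' = B" using same[OF X(1) B X(2)] hB(2)[OF X(1,2)] by blast
      then show "X \<in> h B" using X by simp
    qed
  qed
qed

definition glue :: "'a set set \<Rightarrow> ('a set \<Rightarrow> 'a \<Rightarrow> 'a) \<Rightarrow> 'a \<Rightarrow> 'a" where
  "glue R s x = (if x \<in> \<Union>R then s (block R x) x else x)"

lemma glue_permutes:
  assumes R: "partition_on E R" and fin: "finite E" and s: "\<And>B. B \<in> R \<Longrightarrow> s B permutes B"
  shows "glue R s permutes E" and "\<And>B. B \<in> R \<Longrightarrow> perm_restrict (glue R s) B = s B"
    and "\<And>B x. B \<in> R \<Longrightarrow> x \<in> B \<Longrightarrow> glue R s x = s B x"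
proof -
  have g: "glue R s x = s B x" if "B \<in> R" "x \<in> B" for B x
    using that block_eq[OF R that] unfolding glue_def by auto
  then show "\<And>B x. B \<in> R \<Longrightarrow> x \<in> B \<Longrightarrow> glue R s x = s B x" .
  show "perm_restrict (glue R s) B = s B" if B: "B \<in> R" for B
    using g[OF B] permutes_not_in[OF s[OF B]] by (auto simp: perm_restrict_def fun_eq_iff)
  have stay: "glue R s x \<in> block R x" if "x \<in> E" for x
    using g[OF block_in[OF R that]] permutes_in_image[OF s[OF block_in(1)[OF R that]]]
      block_in(2)[OF R that] by simp
  have inj: "inj_on (glue R s) E"
  proof (rule inj_onI)
    fix x y assume xy: "x \<in> E" "y \<in> E" "glue R s x = glue R s y"
    have "glue R s x \<in> block R x" "glue R s x \<in> block R y"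
      using stay[OF xy(1)] stay[OF xy(2)] xy(3) by auto
    then have e: "block R x = block R y" using block_eq_of_mem[OF R] by metis
    have "s (block R x) x = s (block R x) y"
      using g[OF block_in[OF R xy(1)]] g[OF block_in[OF R xy(2)]] xy(3) e by simp
    then show "x = y" using permutes_inj[OF s[OF block_in(1)[OF R xy(1)]]] by (simp add: inj_eq)
  qed
  have "glue R s ` E = E"
    by (rule endo_inj_surj[OF fin _ inj]) (use stay block_subset[OF R] in blast)
  then have "bij_betw (glue R s) E E" using inj unfolding bij_betw_def by blast
  then show "glue R s permutes E"
    by (rule bij_imp_permutes) (use partition_onD1[OF R] in \<open>auto simp: glue_def\<close>)
qed

text \<open>The pairs that index the block function: \<open>\<nu>\<close> makes every component of \<open>(\<tau>, \<nu>)\<close> planar and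
  non-separable, and \<open>P\<close> connects \<open>B\<close> in a tree-like way. The partition of the set of cycles met
  by \<open>B\<close> is not part of the data, as it is determined by \<open>\<nu>\<close>.\<close>

definition ns_data :: "'a set \<Rightarrow> ('a \<Rightarrow> 'a) \<Rightarrow> (('a \<Rightarrow> 'a) \<times> 'a set set) set" where
  "ns_data B \<tau> = {(\<nu>, P). \<nu> permutes B
     \<and> (\<forall>C \<in> part_join B (cycle_partition B \<tau>) (cycle_partition B \<nu>). perm_restrict \<nu> C \<in> NS C (perm_restrict \<tau> C))
     \<and> refines B (cycle_partition B \<nu>) P \<and> part_join B P (cycle_partition B \<tau>) = {B}
     \<and> L_defect B P (part_join B (cycle_partition B \<tau>) (cycle_partition B \<nu>)) (cycle_partition B \<nu>) = 0}"

text \<open>The global counterpart of \<open>ns_data\<close>, in which the one-block partition is replaced by \<open>R\<close>.\<close>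

definition glued_data :: "'a set \<Rightarrow> ('a \<Rightarrow> 'a) \<Rightarrow> 'a set set \<Rightarrow> (('a \<Rightarrow> 'a) \<times> 'a set set) set" where
  "glued_data E \<tau> R = {(\<nu>, P). \<nu> permutes E \<and> genus E \<nu> \<tau> = 0 \<and> nonsep E \<tau> \<nu>
     \<and> refines E (cycle_partition E \<nu>) P \<and> part_join E P (cycle_partition E \<tau>) = R
     \<and> L_defect E P (part_join E (cycle_partition E \<tau>) (cycle_partition E \<nu>)) (cycle_partition E \<nu>) = 0}"

text \<open>All conditions are local: genus, defect and joins decompose over the blocks of \<open>R\<close>, and the
  vanishing of a sum of nonnegative terms is the vanishing of each.\<close>

lemma glued_data_iff:
  assumes t: "\<tau> permutes E" and fin: "finite E" and tR: "refines E (cycle_partition E \<tau>) R"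
    and n: "\<nu> permutes E" and nP: "refines E (cycle_partition E \<nu>) P" and PR: "refines E P R"
  shows "(\<nu>, P) \<in> glued_data E \<tau> R \<longleftrightarrow>
    (\<forall>B\<in>R. (perm_restrict \<nu> B, blocks_in P B) \<in> ns_data B (perm_restrict \<tau> B))"
proof -
  note nR = refines_trans[OF nP PR]
  note pn = cycle_partition_partition[OF n fin] and pt = cycle_partition_partition[OF t fin]
    and pP = refines_partition(1)[OF PR] and pR = refines_partition(2)[OF PR]
  let ?S = "part_join E (cycle_partition E \<tau>) (cycle_partition E \<nu>)"
  note S = part_join_is_join[OF pt pn]
  note SR = S(3)[OF tR nR]
  note ct = cycle_partition_perm_restrict[OF t fin tR] and cn = cycle_partition_perm_restrict[OF n fin nR]
  have 1: "genus E \<nu> \<tau> = 0 \<and> nonsep E \<tau> \<nu> \<longleftrightarrow>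
    (\<forall>B\<in>R. \<forall>C\<in>blocks_in ?S B. perm_restrict (perm_restrict \<nu> B) C \<in> NS C (perm_restrict (perm_restrict \<tau> B) C))"
  proof -
    have "perm_restrict (perm_restrict s B) C = perm_restrict s C" if "C \<in> blocks_in ?S B" for s :: "'a \<Rightarrow> 'a" and B C
      using that unfolding perm_restrict_perm_restrict blocks_in_def by (simp add: Int_absorb1)
    then have "(\<forall>B\<in>R. \<forall>C\<in>blocks_in ?S B. perm_restrict (perm_restrict \<nu> B) C \<in> NS C (perm_restrict (perm_restrict \<tau> B) C))
      \<longleftrightarrow> (\<forall>B\<in>R. \<forall>C\<in>blocks_in ?S B. perm_restrict \<nu> C \<in> NS C (perm_restrict \<tau> C))" by simp
    also have "\<dots> \<longleftrightarrow> (\<forall>C\<in>(\<Union>B\<in>R. blocks_in ?S B). perm_restrict \<nu> C \<in> NS C (perm_restrict \<tau> C))" by blast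
    also have "\<dots> \<longleftrightarrow> genus E \<nu> \<tau> = 0 \<and> nonsep E \<tau> \<nu>"
      unfolding Union_blocks_in[OF SR] by (rule nonseparable_components_iff[OF t n fin])
    finally show ?thesis by simp
  qed
  have 2: "part_join E P (cycle_partition E \<tau>) = R \<longleftrightarrow>
    (\<forall>B\<in>R. part_join B (blocks_in P B) (blocks_in (cycle_partition E \<tau>) B) = {B})"
  proof -
    note JR = part_join_is_join(3)[OF pP pt PR tR]
    have "part_join E P (cycle_partition E \<tau>) = R \<longleftrightarrow>
      (\<forall>B\<in>R. blocks_in (part_join E P (cycle_partition E \<tau>)) B = {B})"
      using blocks_in_eqI[OF JR refines_refl[OF pR]] blocks_in_self[OF pR] by metis
    then show ?thesis using part_join_blocks_in[OF PR tR] by simp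
  qed
  have 3: "L_defect E P ?S (cycle_partition E \<nu>) = 0 \<longleftrightarrow>
    (\<forall>B\<in>R. L_defect B (blocks_in P B) (blocks_in ?S B) (blocks_in (cycle_partition E \<nu>) B) = 0)"
    by (rule L_defect_0_blocks[OF fin nP S(2) PR SR])
  have 4: "perm_restrict \<nu> B permutes B" "refines B (blocks_in (cycle_partition E \<nu>) B) (blocks_in P B)"
    if "B \<in> R" for B
    using perm_restrict_permutes[OF n fin nR that] refines_blocks_in[OF nP PR that] .
  have global: "(\<nu>, P) \<in> glued_data E \<tau> R \<longleftrightarrow> (genus E \<nu> \<tau> = 0 \<and> nonsep E \<tau> \<nu>)
    \<and> part_join E P (cycle_partition E \<tau>) = R \<and> L_defect E P ?S (cycle_partition E \<nu>) = 0"
    unfolding glued_data_def using n nP by blast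
  have "(perm_restrict \<nu> B, blocks_in P B) \<in> ns_data B (perm_restrict \<tau> B) \<longleftrightarrow>
    (\<forall>C\<in>blocks_in ?S B. perm_restrict (perm_restrict \<nu> B) C \<in> NS C (perm_restrict (perm_restrict \<tau> B) C))
    \<and> part_join B (blocks_in P B) (blocks_in (cycle_partition E \<tau>) B) = {B}
    \<and> L_defect B (blocks_in P B) (blocks_in ?S B) (blocks_in (cycle_partition E \<nu>) B) = 0" if B: "B \<in> R" for B
    unfolding ns_data_def using 4[OF B] by (simp add: part_join_blocks_in[OF tR nR B] ct[OF B] cn[OF B])
  then have "(\<forall>B\<in>R. (perm_restrict \<nu> B, blocks_in P B) \<in> ns_data B (perm_restrict \<tau> B)) \<longleftrightarrow>
    (\<forall>B\<in>R. (\<forall>C\<in>blocks_in ?S B. perm_restrict (perm_restrict \<nu> B) C \<in> NS C (perm_restrict (perm_restrict \<tau> B) C))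
    \<and> part_join B (blocks_in P B) (blocks_in (cycle_partition E \<tau>) B) = {B}
    \<and> L_defect B (blocks_in P B) (blocks_in ?S B) (blocks_in (cycle_partition E \<nu>) B) = 0)"
    by (rule ball_cong[OF refl])
  then show ?thesis unfolding global 1 2 3 by (simp only: ball_conj_distrib)
qed

text \<open>The product of the sums is multiplied out, and a choice of data on every block of \<open>R\<close> is the same
  as data on the whole set.\<close>

lemma sum_glued_data:
  fixes F :: "'a set set \<Rightarrow> ('a \<Rightarrow> 'a) \<Rightarrow> 'c::comm_ring_1"
  assumes t: "\<tau> permutes E" and fin: "finite E" and tR: "refines E (cycle_partition E \<tau>) R"
    and mult: "\<And>\<nu> P. \<nu> permutes E \<Longrightarrow> refines E (cycle_partition E \<nu>) P \<Longrightarrow> refines E P R \<Longrightarrow>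
      F P \<nu> = (\<Prod>B\<in>R. F (blocks_in P B) (perm_restrict \<nu> B))"
  shows "(\<Prod>B\<in>R. \<Sum>(\<nu>, P)\<in>ns_data B (perm_restrict \<tau> B). F P \<nu>) = (\<Sum>(\<nu>, P)\<in>glued_data E \<tau> R. F P \<nu>)"
proof -
  note pR = refines_partition(2)[OF tR] and pt = cycle_partition_partition[OF t fin]
  have fR: "finite R" using fin pR finite_elements by blast
  let ?D = "\<lambda>B. ns_data B (perm_restrict \<tau> B)"
  have fD: "finite (?D B)" if B: "B \<in> R" for B
  proof -
    have fB: "finite B" by (rule finite_partition_block[OF pR fin B])
    have "?D B \<subseteq> {s. s permutes B} \<times> {P. partition_on B P}"
      unfolding ns_data_def using refines_partition(2) by fast
    then show ?thesis
      using finite_permutations[OF fB] finitely_many_partition_on[OF fB] finite_subset finite_cartesian_product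
      by blast
  qed
  let ?j = "\<lambda>(\<nu>, P). restrict (\<lambda>B. (perm_restrict \<nu> B, blocks_in P B)) R"
  let ?i = "\<lambda>h. (glue R (\<lambda>B. fst (h B)), \<Union>B\<in>R. snd (h B))"
  have G: "\<nu> permutes E \<and> refines E (cycle_partition E \<nu>) P \<and> refines E P R" 
    if "(\<nu>, P) \<in> glued_data E \<tau> R" for \<nu> P
    using that part_join_is_join(1)[OF _ pt] refines_partition(2) unfolding glued_data_def by blast
  have "(\<Prod>B\<in>R. \<Sum>(\<nu>, P)\<in>?D B. F P \<nu>) = (\<Prod>B\<in>R. \<Sum>x\<in>?D B. F (snd x) (fst x))"
    by (simp add: case_prod_beta)
  also have "\<dots> = (\<Sum>h\<in>PiE R ?D. \<Prod>B\<in>R. F (snd (h B)) (fst (h B)))"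
    by (rule prod_sum_PiE[OF fR]) (use fD in auto)
  also have "\<dots> = (\<Sum>(\<nu>, P)\<in>glued_data E \<tau> R. F P \<nu>)"
  proof (rule sum.reindex_bij_witness[where i = ?j and j = ?i])
    fix h assume h: "h \<in> PiE R ?D"
    have hB: "fst (h B) permutes B" "refines B (cycle_partition B (fst (h B))) (snd (h B))" if "B \<in> R" for B
      using PiE_mem[OF h that] unfolding ns_data_def by auto
    have gl: "glue R (\<lambda>B. fst (h B)) permutes E"
      "\<And>B. B \<in> R \<Longrightarrow> perm_restrict (glue R (\<lambda>B. fst (h B))) B = fst (h B)"
      "\<And>B x. B \<in> R \<Longrightarrow> x \<in> B \<Longrightarrow> glue R (\<lambda>B. fst (h B)) x = fst (h B) x"
      using glue_permutes[OF pR fin, of "\<lambda>B. fst (h B)"] hB(1) by auto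
    have gp: "refines E (\<Union>B\<in>R. snd (h B)) R"
      "\<And>B. B \<in> R \<Longrightarrow> blocks_in (\<Union>B\<in>R. snd (h B)) B = snd (h B)"
      using glue_partitions[OF pR, of "\<lambda>B. snd (h B)"] refines_partition(2)[OF hB(2)] by auto
    have nP: "refines E (cycle_partition E (fst (?i h))) (snd (?i h))"
      unfolding fst_conv snd_conv
    proof (rule refines_cycle_partitionI[OF gl(1) fin refines_partition(1)[OF gp(1)]])
      fix x assume x: "x \<in> E"
      note B = block_in[OF pR x]
      have "finite (block R x)" by (rule finite_partition_block[OF pR fin B(1)])
      from refines_cycle_partitionD(1)[OF hB(1)[OF B(1)] this hB(2)[OF B(1)] B(2)]
      show "glue R (\<lambda>B. fst (h B)) x \<in> block (\<Union>B\<in>R. snd (h B)) x"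
        using gl(3)[OF B] gp(2)[OF B(1)] block_blocks_in[OF gp(1) B] by simp
    qed
    show "?i h \<in> glued_data E \<tau> R"
      using glued_data_iff[OF t fin tR gl(1) nP[unfolded fst_conv snd_conv] gp(1)] gl(2) gp(2) PiE_mem[OF h] by simp
    show "?j (?i h) = h"
    proof (rule extensionalityI[of _ R])
      show "?j (?i h) \<in> extensional R" by simp
      show "h \<in> extensional R" using h by (simp add: PiE_iff)
    qed (use gl(2) gp(2) in simp)
    show "(case ?i h of (\<nu>, P) \<Rightarrow> F P \<nu>) = (\<Prod>B\<in>R. F (snd (h B)) (fst (h B)))"
      using mult[OF gl(1) nP[unfolded fst_conv snd_conv] gp(1)] gl(2) gp(2) by simp
  next
    fix x assume x: "x \<in> glued_data E \<tau> R"
    obtain \<nu> P where xe: "x = (\<nu>, P)" by fastforce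
    note g = G[OF x[unfolded xe]]
    show "?j x \<in> PiE R ?D"
      using glued_data_iff[OF t fin tR] g x unfolding xe by auto
    have "glue R (\<lambda>B. fst (?j x B)) = \<nu>"
    proof
      fix y show "glue R (\<lambda>B. fst (?j x B)) y = \<nu> y"
      proof (cases "y \<in> E")
        case True
        then show ?thesis using block_in[OF pR True] unfolding glue_def xe
          by (auto simp: perm_restrict_def)
      next
        case False
        then show ?thesis using g permutes_not_in partition_onD1[OF pR] unfolding glue_def by metis
      qed
    qed
    moreover have "(\<Union>B\<in>R. snd (?j x B)) = P" using Union_blocks_in[of E P R] g unfolding xe by simp
    ultimately show "?i (?j x) = x" unfolding xe by simp
  qed
  finally show ?thesis .
qed

section \<open>Multiplicative functions\<close>

lemma multiplicative_prod:
  assumes m: "multiplicative f" and n: "\<nu> permutes E" and fin: "finite E" and ne: "E \<noteq> {}"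
    and nP: "refines E (cycle_partition E \<nu>) P"
  shows "f P \<nu> = (\<Prod>G\<in>P. f {G} (perm_restrict \<nu> G))"
proof -
  note m1 = m[unfolded multiplicative_def, THEN conjunct1, THEN spec, of E, THEN spec, of P,
      THEN spec, of \<nu>]
  show ?thesis by (rule m1[THEN mp]) (intro conjI assms)
qed

lemma multiplicative_cycle_lengths:
  assumes m: "multiplicative f" and n: "\<nu> permutes E" "\<nu>' permutes E'" and fin: "finite E" "finite E'"
    and ne: "E \<noteq> {}" "E' \<noteq> {}" and l: "cycle_lengths E \<nu> = cycle_lengths E' \<nu>'"
  shows "f {E} \<nu> = f {E'} \<nu>'"
proof -
  note m2 = m[unfolded multiplicative_def, THEN conjunct2, THEN spec, of E, THEN spec, of E',
      THEN spec, of \<nu>, THEN spec, of \<nu>']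
  show ?thesis by (rule m2[THEN mp]) (intro conjI assms)
qed

lemma multiplicative_blocks:
  assumes m: "multiplicative f" and n: "\<nu> permutes E" and fin: "finite E" and ne: "E \<noteq> {}"
    and nP: "refines E (cycle_partition E \<nu>) P" and PR: "refines E P R"
  shows "f P \<nu> = (\<Prod>B\<in>R. f (blocks_in P B) (perm_restrict \<nu> B))"
proof -
  note nR = refines_trans[OF nP PR]
  note pR = refines_partition(2)[OF PR] and pP = refines_partition(1)[OF PR]
  have fR: "finite R" and fP: "finite P" using fin pR pP finite_elements by blast+
  then have fb: "finite (blocks_in P B)" for B by (simp add: blocks_in_def)
  have B: "f (blocks_in P B) (perm_restrict \<nu> B) = (\<Prod>G\<in>blocks_in P B. f {G} (perm_restrict \<nu> G))"
    if B: "B \<in> R" for B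
  proof -
    have "finite B" "B \<noteq> {}"
      using finite_partition_block[OF pR fin B] partition_onD3[OF pR] B by auto
    moreover have "refines B (cycle_partition B (perm_restrict \<nu> B)) (blocks_in P B)"
      unfolding cycle_partition_perm_restrict[OF n fin nR B] by (rule refines_blocks_in[OF nP PR B])
    ultimately have "f (blocks_in P B) (perm_restrict \<nu> B)
      = (\<Prod>G\<in>blocks_in P B. f {G} (perm_restrict (perm_restrict \<nu> B) G))"
      by (intro multiplicative_prod[OF m perm_restrict_permutes[OF n fin nR B]])
    then show ?thesis
      unfolding perm_restrict_perm_restrict by (simp add: blocks_in_def Int_absorb1)
  qed
  have "f P \<nu> = (\<Prod>G\<in>P. f {G} (perm_restrict \<nu> G))"
    by (rule multiplicative_prod[OF m n fin ne nP])
  also have "\<dots> = (\<Prod>G\<in>(\<Union>B\<in>R. blocks_in P B). f {G} (perm_restrict \<nu> G))"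
    unfolding Union_blocks_in[OF PR] ..
  also have "\<dots> = (\<Prod>B\<in>R. \<Prod>G\<in>blocks_in P B. f {G} (perm_restrict \<nu> G))"
    by (rule prod.UNION_disjoint) (use fR fb disjoint_blocks_in[OF PR] in auto)
  also have "\<dots> = (\<Prod>B\<in>R. f (blocks_in P B) (perm_restrict \<nu> B))"
    using B by simp
  finally show ?thesis .
qed

lemma multiplicative_inv_one_block:
  assumes m: "multiplicative f" and n: "\<nu> permutes E" and fin: "finite E" and ne: "E \<noteq> {}"
  shows "f {E} (inv \<nu>) = f {E} \<nu>"
proof -
  have "cycle_lengths E (inv \<nu>) = cycle_lengths E \<nu>"
    unfolding cycle_lengths_def cycle_partition_inv[OF n fin] ..
  then show ?thesis by (rule multiplicative_cycle_lengths[OF m permutes_inv[OF n] n fin fin ne ne])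
qed

lemma multiplicative_inv:
  assumes m: "multiplicative f" and n: "\<nu> permutes E" and fin: "finite E" and ne: "E \<noteq> {}"
    and nP: "refines E (cycle_partition E \<nu>) P"
  shows "f P (inv \<nu>) = f P \<nu>"
proof -
  note pP = refines_partition(2)[OF nP]
  have "f P (inv \<nu>) = (\<Prod>G\<in>P. f {G} (perm_restrict (inv \<nu>) G))"
    by (rule multiplicative_prod[OF m permutes_inv[OF n] fin ne])
      (simp add: cycle_partition_inv[OF n fin] nP)
  also have "\<dots> = (\<Prod>G\<in>P. f {G} (perm_restrict \<nu> G))"
  proof (rule prod.cong[OF refl])
    fix G assume G: "G \<in> P"
    have "finite G" "G \<noteq> {}"
      using finite_partition_block[OF pP fin G] partition_onD3[OF pP] G by auto
    then show "f {G} (perm_restrict (inv \<nu>) G) = f {G} (perm_restrict \<nu> G)"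
      unfolding perm_restrict_inv[OF n fin nP G]
      by (intro multiplicative_inv_one_block[OF m perm_restrict_permutes[OF n fin nP G]])
  qed
  also have "\<dots> = f P \<nu>" by (rule multiplicative_prod[OF m n fin ne nP, symmetric])
  finally show ?thesis .
qed

section \<open>The block function as a sum over non-separable data\<close>

lemma index_mem_iff:
  assumes S: "partition_on B (S ` I)" and inj: "inj_on S I"
    and i: "i \<in> I" "x \<in> S i" and G: "G \<subseteq> I"
  shows "x \<in> (\<Union>j\<in>G. S j) \<longleftrightarrow> i \<in> G"
proof
  assume "x \<in> (\<Union>j\<in>G. S j)"
  then obtain j where j: "j \<in> G" "x \<in> S j" by blast
  then have "S j = S i" using block_eq[OF S, of "S i" x] block_eq[OF S, of "S j" x] i G by auto
  then show "i \<in> G" using inj i(1) j(1) G unfolding inj_on_def by blast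
qed (use i in blast)

text \<open>If the sets \<open>S i\<close> are the distinct blocks of a partition, the partitions of the index set
  correspond to the coarser partitions. This translates between partitions of the set of cycles of
  \<open>\<gamma>\<close> met by a block and partitions above the cycle partition of \<open>\<tau>\<close>.\<close>

lemma index_partition_image:
  assumes S: "partition_on B (S ` I)" and inj: "inj_on S I" and Q: "partition_on I Q"
  shows "refines B (S ` I) ((\<lambda>G. \<Union>i\<in>G. S i) ` Q)"
    and "\<And>G. G \<in> Q \<Longrightarrow> {i \<in> I. S i \<subseteq> (\<Union>j\<in>G. S j)} = G"
proof -
  let ?U = "\<lambda>G. \<Union>i\<in>G. S i"
  have sub: "G \<subseteq> I" "G \<noteq> {}" if "G \<in> Q" for G using Q that unfolding partition_on_def by auto
  have ne: "S i \<noteq> {}" if "i \<in> I" for i using S that unfolding partition_on_def by auto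
  note mem = index_mem_iff[OF S inj]
  have "partition_on B (?U ` Q)"
  proof (rule partition_onI)
    have "\<Union>(?U ` Q) = \<Union>(S ` \<Union>Q)" by blast
    then show "\<Union>(?U ` Q) = B" using partition_onD1[OF Q] partition_onD1[OF S] by simp
    show "{} \<notin> ?U ` Q"
    proof
      assume "{} \<in> ?U ` Q"
      then obtain G where G: "G \<in> Q" "?U G = {}" by force
      obtain i where i: "i \<in> G" using sub(2)[OF G(1)] by blast
      then have "S i \<noteq> {}" using ne sub(1)[OF G(1)] by blast
      then show False using i G(2) by blast
    qed
    fix X Y assume "X \<in> ?U ` Q" "Y \<in> ?U ` Q" "X \<noteq> Y"
    then obtain G H where GH: "G \<in> Q" "H \<in> Q" "X = ?U G" "Y = ?U H" "G \<noteq> H" by blast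
    have "G \<inter> H = {}" using disjointD[OF partition_onD2[OF Q] GH(1,2,5)] .
    then show "disjnt X Y" unfolding disjnt_def GH(3,4)
      using mem[OF _ _ sub(1)[OF GH(2)]] sub(1)[OF GH(1)] by blast
  qed
  moreover have "\<exists>Y\<in>?U ` Q. S i \<subseteq> Y" if i: "i \<in> I" for i
  proof -
    obtain G where "G \<in> Q" "i \<in> G" using i partition_onD1[OF Q] by blast
    then show ?thesis by blast
  qed
  ultimately show "refines B (S ` I) (?U ` Q)" unfolding refines_def using S by blast
  show "{i \<in> I. S i \<subseteq> ?U G} = G" if G: "G \<in> Q" for G
  proof
    show "G \<subseteq> {i \<in> I. S i \<subseteq> ?U G}" using sub(1)[OF G] by blast
    show "{i \<in> I. S i \<subseteq> ?U G} \<subseteq> G"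
    proof
      fix i assume "i \<in> {i \<in> I. S i \<subseteq> ?U G}"
      then have i: "i \<in> I" "S i \<subseteq> ?U G" by auto
      then obtain x where x: "x \<in> S i" using ne by blast
      then show "i \<in> G" using mem[OF i(1) x sub(1)[OF G]] i(2) by blast
    qed
  qed
qed

lemma index_partition_inj:
  assumes S: "partition_on B (S ` I)" and inj: "inj_on S I"
    and Q: "partition_on I Q" "partition_on I Q'"
    and e: "(\<lambda>G. \<Union>i\<in>G. S i) ` Q = (\<lambda>G. \<Union>i\<in>G. S i) ` Q'"
  shows "Q = Q'"
proof -
  let ?U = "\<lambda>G. \<Union>i\<in>G. S i"
  have "(\<lambda>C. {i \<in> I. S i \<subseteq> C}) ` (?U ` P) = P" if "partition_on I P" for P
  proof -
    have "(\<lambda>C. {i \<in> I. S i \<subseteq> C}) ` (?U ` P) = (\<lambda>G. G) ` P"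
      unfolding image_image by (rule image_cong[OF refl index_partition_image(2)[OF S inj that]])
    then show ?thesis by simp
  qed
  from this[OF Q(1)] this[OF Q(2)] show ?thesis unfolding e by simp
qed

lemma index_partition_surj:
  assumes r: "refines B (S ` I) T"
  obtains Q where "partition_on I Q" "(\<lambda>G. \<Union>i\<in>G. S i) ` Q = T"
proof -
  note S = refines_partition(1)[OF r] and T = refines_partition(2)[OF r]
  let ?V = "\<lambda>C. {i \<in> I. S i \<subseteq> C}"
  have ne: "S i \<noteq> {}" if "i \<in> I" for i using S that unfolding partition_on_def by auto
  have UV: "(\<Union>i\<in>?V C. S i) = C" if C: "C \<in> T" for C
  proof
    show "C \<subseteq> (\<Union>i\<in>?V C. S i)"
    proof
      fix x assume x: "x \<in> C"
      then have "x \<in> B" using partition_onD1[OF T] C by blast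
      then obtain i where i: "i \<in> I" "x \<in> S i" using partition_onD1[OF S] by blast
      then have "S i \<subseteq> C" using refines_subset_block[OF r _ C i(2) x] by blast
      then show "x \<in> (\<Union>i\<in>?V C. S i)" using i by blast
    qed
  qed blast
  have "partition_on I (?V ` T)"
  proof (rule partition_onI)
    have "\<exists>C\<in>T. S i \<subseteq> C" if "i \<in> I" for i using r that unfolding refines_def by simp
    then show "\<Union>(?V ` T) = I" by blast
    show "{} \<notin> ?V ` T"
    proof
      assume "{} \<in> ?V ` T"
      then obtain C where C: "C \<in> T" "?V C = {}" by force
      have "C = {}" using UV[OF C(1)] unfolding C(2) by simp
      then show False using C(1) partition_onD3[OF T] by blast
    qed
    fix X Y assume "X \<in> ?V ` T" "Y \<in> ?V ` T" "X \<noteq> Y"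
    then obtain C D where CD: "C \<in> T" "D \<in> T" "X = ?V C" "Y = ?V D" "C \<noteq> D" by blast
    have "C \<inter> D = {}" using disjointD[OF partition_onD2[OF T] CD(1,2,5)] .
    then show "disjnt X Y" unfolding disjnt_def CD(3,4) using ne by blast
  qed
  moreover have "(\<lambda>G. \<Union>i\<in>G. S i) ` (?V ` T) = T"
  proof -
    have "(\<lambda>G. \<Union>i\<in>G. S i) ` (?V ` T) = (\<lambda>C. C) ` T"
      unfolding image_image by (rule image_cong[OF refl UV])
    then show ?thesis by simp
  qed
  ultimately show thesis by (rule that)
qed

text \<open>Non-separable hypermaps on the blocks of \<open>T\<close> are connected, so these blocks are the components
  of their product, which is why \<open>T\<close> can be recovered from \<open>\<nu>\<close>.\<close>

lemma NS_product_iff: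
  assumes t: "\<tau> permutes B" and fin: "finite B" and r: "refines B (cycle_partition B \<tau>) T"
    and n: "\<nu> permutes B"
  shows "(\<forall>C\<in>T. perm_restrict \<nu> C \<in> NS C (perm_restrict \<tau> C)) \<longleftrightarrow>
    part_join B (cycle_partition B \<tau>) (cycle_partition B \<nu>) = T \<and>
    (\<forall>C \<in> part_join B (cycle_partition B \<tau>) (cycle_partition B \<nu>).
      perm_restrict \<nu> C \<in> NS C (perm_restrict \<tau> C))"
proof
  assume a: "\<forall>C\<in>T. perm_restrict \<nu> C \<in> NS C (perm_restrict \<tau> C)"
  note pT = refines_partition(2)[OF r]
  note pn = cycle_partition_partition[OF n fin] and pt = cycle_partition_partition[OF t fin]
  have nT: "refines B (cycle_partition B \<nu>) T"
  proof (rule refines_cycle_partitionI[OF n fin pT])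
    fix x assume x: "x \<in> B"
    note b = block_in[OF pT x]
    have "perm_restrict \<nu> (block T x) permutes (block T x)" using a b(1) unfolding NS_def by blast
    from permutes_in_image[OF this, of x] show "\<nu> x \<in> block T x" using b(2) by (simp add: perm_restrict_def)
  qed
  have "part_join B (cycle_partition B \<tau>) (cycle_partition B \<nu>) = T"
  proof (rule blocks_in_eqI[OF part_join_is_join(3)[OF pt pn r nT] refines_refl[OF pT]])
    fix C assume C: "C \<in> T"
    have "part_join C (cycle_partition C (perm_restrict \<tau> C)) (cycle_partition C (perm_restrict \<nu> C)) = {C}"
      using a C unfolding NS_def by blast
    then show "blocks_in (part_join B (cycle_partition B \<tau>) (cycle_partition B \<nu>)) C = blocks_in T C"
      using part_join_perm_restrict[OF t n fin r nT C] blocks_in_self[OF pT C] by simp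
  qed
  then show "part_join B (cycle_partition B \<tau>) (cycle_partition B \<nu>) = T \<and>
    (\<forall>C \<in> part_join B (cycle_partition B \<tau>) (cycle_partition B \<nu>).
      perm_restrict \<nu> C \<in> NS C (perm_restrict \<tau> C))" using a by simp
qed auto

lemma singleton_or_nontriv_partitions:
  assumes "finite I"
  shows "{Q. partition_on I Q} = insert ((\<lambda>i. {i}) ` I) (nontriv_partitions I)"
    and "(\<lambda>i. {i}) ` I \<notin> nontriv_partitions I"
proof -
  have c: "card ((\<lambda>i. {i}) ` I) = card I" by (simp add: card_image)
  show "(\<lambda>i. {i}) ` I \<notin> nontriv_partitions I" unfolding nontriv_partitions_def using c by simp
  show "{Q. partition_on I Q} = insert ((\<lambda>i. {i}) ` I) (nontriv_partitions I)"
  proof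
    show "{Q. partition_on I Q} \<subseteq> insert ((\<lambda>i. {i}) ` I) (nontriv_partitions I)"
    proof
      fix Q assume "Q \<in> {Q. partition_on I Q}"
      then have Q: "partition_on I Q" by simp
      show "Q \<in> insert ((\<lambda>i. {i}) ` I) (nontriv_partitions I)"
        using refines_card_eq[OF assms refines_singletons[OF Q]] Q c
        unfolding nontriv_partitions_def by fastforce
    qed
    show "insert ((\<lambda>i. {i}) ` I) (nontriv_partitions I) \<subseteq> {Q. partition_on I Q}"
      unfolding nontriv_partitions_def using partition_on_singletons by blast
  qed
qed

text \<open>The hypothesis on the cycle partition says that each cycle of \<open>\<gamma>\<close> met by \<open>B\<close> contributes a single
  cycle of \<open>\<tau>\<close>, so the partitions of the met cycles sort the non-separable \<open>\<nu>\<close> by their components.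
  The singleton partition contributes \<open>\<nu> = \<tau>\<^sup>-\<^sup>1\<close>, for which \<open>{B}\<close> is the only admissible
  partition, and this term is \<open>f {B} \<tau>\<close>.\<close>

lemma g_block_eq_sum:
  fixes f :: "nat set set \<Rightarrow> (nat \<Rightarrow> nat) \<Rightarrow> 'c::comm_ring_1"
  assumes m: "multiplicative f" and fin: "finite B" and ne: "B \<noteq> {}" and t: "\<tau> permutes B"
    and cyc: "cycle_partition B \<tau> = (\<lambda>i. B \<inter> cycle_supp l i) ` met_cycles p l B"
    and inj: "inj_on (\<lambda>i. B \<inter> cycle_supp l i) (met_cycles p l B)"
  shows "g_block f p l B \<tau> = (\<Sum>(\<nu>, P)\<in>ns_data B \<tau>. f P \<nu>)"
proof -
  define I where "I = met_cycles p l B"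
  define S where "S = (\<lambda>i. B \<inter> cycle_supp l i)"
  define U where "U = (\<lambda>G. \<Union>i\<in>G. S i)"
  define V where "V = {\<nu>. \<nu> permutes B \<and> (\<forall>C \<in> part_join B (cycle_partition B \<tau>) (cycle_partition B \<nu>).
      perm_restrict \<nu> C \<in> NS C (perm_restrict \<tau> C))}"
  define W where "W = (\<lambda>\<nu>. {P. refines B (cycle_partition B \<nu>) P \<and> part_join B P (cycle_partition B \<tau>) = {B}
     \<and> L_defect B P (part_join B (cycle_partition B \<tau>) (cycle_partition B \<nu>)) (cycle_partition B \<nu>) = 0})"
  define N where "N = (\<lambda>Q. {\<nu>. \<nu> permutes B \<and> (\<forall>G\<in>Q. perm_restrict \<nu> (U G) \<in> NS (U G) (perm_restrict \<tau> (U G)))})"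
  have fI: "finite I" unfolding I_def met_cycles_def by simp
  have pt: "partition_on B (S ` I)" and cS: "cycle_partition B \<tau> = S ` I"
    using cycle_partition_partition[OF t fin] cyc unfolding S_def I_def by auto
  have injS: "inj_on S I" using inj unfolding S_def I_def .
  note ref = index_partition_image(1)[OF pt injS, folded U_def]
  have fN: "finite (N Q)" for Q
    by (rule finite_subset[OF _ finite_permutations[OF fin]]) (auto simp: N_def)
  have fW: "finite (W \<nu>)" for \<nu>
    by (rule finite_subset[OF _ finitely_many_partition_on[OF fin]])
      (use refines_partition(2) in \<open>fastforce simp: W_def\<close>)
  have fV: "finite V"
    by (rule finite_subset[OF _ finite_permutations[OF fin]]) (auto simp: V_def)
  have N_iff: "\<nu> \<in> N Q \<longleftrightarrow> \<nu> \<in> V \<and> part_join B (cycle_partition B \<tau>) (cycle_partition B \<nu>) = U ` Q"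
    if Q: "partition_on I Q" for \<nu> Q
  proof (cases "\<nu> permutes B")
    case True
    then show ?thesis
      using NS_product_iff[OF t fin ref[OF Q, folded cS] True] unfolding N_def V_def by auto
  qed (simp add: N_def V_def)
  have gbar: "g_bar f l B Q \<tau> = (\<Sum>\<nu>\<in>N Q. \<Sum>P\<in>W \<nu>. f P \<nu>)" for Q
    unfolding g_bar_def N_def W_def U_def S_def Let_def ..
  have VN: "V = (\<Union>Q\<in>{Q. partition_on I Q}. N Q)"
  proof
    show "(\<Union>Q\<in>{Q. partition_on I Q}. N Q) \<subseteq> V" using N_iff by blast
    show "V \<subseteq> (\<Union>Q\<in>{Q. partition_on I Q}. N Q)"
    proof
      fix \<nu> assume v: "\<nu> \<in> V"
      then have n: "\<nu> permutes B" unfolding V_def by blast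
      have "refines B (S ` I) (part_join B (cycle_partition B \<tau>) (cycle_partition B \<nu>))"
        using part_join_is_join(1)[OF cycle_partition_partition[OF t fin] cycle_partition_partition[OF n fin]]
        unfolding cS .
      then obtain Q where "partition_on I Q" "U ` Q = part_join B (cycle_partition B \<tau>) (cycle_partition B \<nu>)"
        unfolding U_def by (rule index_partition_surj)
      then show "\<nu> \<in> (\<Union>Q\<in>{Q. partition_on I Q}. N Q)" using N_iff v by auto
    qed
  qed
  have "(\<Sum>(\<nu>, P)\<in>ns_data B \<tau>. f P \<nu>) = (\<Sum>(\<nu>, P)\<in>Sigma V W. f P \<nu>)"
    by (rule sum.cong) (auto simp: ns_data_def V_def W_def)
  also have "\<dots> = (\<Sum>\<nu>\<in>V. \<Sum>P\<in>W \<nu>. f P \<nu>)"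
    by (rule sum.Sigma[symmetric]) (use fV fW in auto)
  also have "\<dots> = (\<Sum>Q\<in>{Q. partition_on I Q}. \<Sum>\<nu>\<in>N Q. \<Sum>P\<in>W \<nu>. f P \<nu>)"
    unfolding VN
  proof (rule sum.UNION_disjoint[OF finitely_many_partition_on[OF fI]])
    show "\<forall>Q\<in>{Q. partition_on I Q}. finite (N Q)" using fN by blast
    show "\<forall>Q\<in>{Q. partition_on I Q}. \<forall>Q'\<in>{Q. partition_on I Q}. Q \<noteq> Q' \<longrightarrow> N Q \<inter> N Q' = {}"
    proof (intro ballI impI, rule ccontr)
      fix Q Q' assume Q: "Q \<in> {Q. partition_on I Q}" "Q' \<in> {Q. partition_on I Q}" "Q \<noteq> Q'"
      assume "N Q \<inter> N Q' \<noteq> {}"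
      then obtain \<nu> where v: "\<nu> \<in> N Q" "\<nu> \<in> N Q'" by blast
      have "U ` Q = U ` Q'" using N_iff[of Q \<nu>] N_iff[of Q' \<nu>] v Q by simp
      then show False using index_partition_inj[OF pt injS, folded U_def, of Q Q'] Q by simp
    qed
  qed
  also have "\<dots> = (\<Sum>\<nu>\<in>N ((\<lambda>i. {i}) ` I). \<Sum>P\<in>W \<nu>. f P \<nu>)
      + (\<Sum>Q\<in>nontriv_partitions I. g_bar f l B Q \<tau>)"
  proof -
    have "finite (nontriv_partitions I)"
      using finitely_many_partition_on[OF fI] by (rule rev_finite_subset) (auto simp: nontriv_partitions_def)
    then show ?thesis
      unfolding singleton_or_nontriv_partitions(1)[OF fI] gbar
      using singleton_or_nontriv_partitions(2)[OF fI] by simp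
  qed
  also have "N ((\<lambda>i. {i}) ` I) = {inv \<tau>}"
  proof -
    note tt = refines_refl[OF cycle_partition_partition[OF t fin]]
    have Si: "NS (S i) (perm_restrict \<tau> (S i)) = {perm_restrict (inv \<tau>) (S i)}" if "i \<in> I" for i
    proof -
      have i: "S i \<in> cycle_partition B \<tau>" unfolding cS using that by simp
      have "cycle_partition (S i) (perm_restrict \<tau> (S i)) = {S i}"
        unfolding cycle_partition_perm_restrict[OF t fin tt i]
        by (rule blocks_in_self[OF cycle_partition_partition[OF t fin] i])
      moreover have "finite (S i)" using fin unfolding S_def by simp
      ultimately show ?thesis
        unfolding perm_restrict_inv[OF t fin tt i]
        by (intro NS_single_cycle perm_restrict_permutes[OF t fin tt i])
    qed
    have "N ((\<lambda>i. {i}) ` I) = {\<nu>. \<nu> permutes B \<and> (\<forall>i\<in>I. perm_restrict \<nu> (S i) = perm_restrict (inv \<tau>) (S i))}"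
      unfolding N_def U_def using Si by auto
    also have "\<dots> = {inv \<tau>}"
    proof -
      have "\<nu> = inv \<tau>" if n: "\<nu> permutes B"
        and a: "\<forall>i\<in>I. perm_restrict \<nu> (S i) = perm_restrict (inv \<tau>) (S i)" for \<nu>
      proof
        fix x show "\<nu> x = inv \<tau> x"
        proof (cases "x \<in> B")
          case True
          then obtain i where "i \<in> I" "x \<in> S i" using partition_onD1[OF pt] by blast
          then show ?thesis using a perm_restrict_simps(1) by metis
        next
          case False
          then show ?thesis using permutes_not_in[OF n] permutes_not_in[OF permutes_inv[OF t]] by simp
        qed
      qed
      then show ?thesis using permutes_inv[OF t] by blast
    qed
    finally show ?thesis .
  qed
  finally have sum: "(\<Sum>(\<nu>, P)\<in>ns_data B \<tau>. f P \<nu>) = (\<Sum>\<nu>\<in>{inv \<tau>}. \<Sum>P\<in>W \<nu>. f P \<nu>)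
      + (\<Sum>Q\<in>nontriv_partitions I. g_bar f l B Q \<tau>)" .
  have "W (inv \<tau>) = {{B}}"
  proof -
    note pc = cycle_partition_partition[OF t fin]
    have "P = {B}" if "P \<in> W (inv \<tau>)" for P
    proof -
      have r: "refines B (cycle_partition B \<tau>) P" and "part_join B P (cycle_partition B \<tau>) = {B}"
        using that unfolding W_def cycle_partition_inv[OF t fin] by auto
      then show ?thesis using part_join_absorb[OF r] by (simp add: part_join_commute)
    qed
    moreover have "{B} \<in> W (inv \<tau>)"
      unfolding W_def cycle_partition_inv[OF t fin] L_defect_def
      using refines_one_block[OF pc ne] part_join_absorb[OF refines_one_block[OF pc ne]]
        part_join_absorb[OF refines_refl[OF pc]] by (simp add: part_join_commute[of B "{B}"])
    ultimately show ?thesis by blast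
  qed
  then show ?thesis
    unfolding sum g_block_def I_def using multiplicative_inv_one_block[OF m t fin ne] by simp
qed

section \<open>The cycles of gamma\<close>

lemma orbit_cycle_of_list:
  assumes d: "distinct cs" and x: "x \<in> set cs"
  shows "orbit (cycle_of_list cs) x = set cs"
proof
  show "orbit (cycle_of_list cs) x \<subseteq> set cs" by (rule permutes_orbit_subset[OF cycle_permutes x])
  show "set cs \<subseteq> orbit (cycle_of_list cs) x"
  proof
    fix y assume "y \<in> set cs"
    then obtain j k where jk: "j < length cs" "y = cs ! j" "k < length cs" "x = cs ! k"
      using x by (metis in_set_conv_nth)
    \<comment> \<open>Rotating by \<open>j - k\<close>, made positive by adding the length.\<close>
    let ?n = "j + (length cs - k)"
    have "(cycle_of_list cs ^^ ?n) x = map (cycle_of_list cs ^^ ?n) cs ! k" using jk by simp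
    also have "\<dots> = rotate ?n cs ! k" unfolding cyclic_rotation[OF d] ..
    also have "\<dots> = y" using jk by (simp add: nth_rotate)
    finally have "(cycle_of_list cs ^^ ?n) x = y" .
    moreover have "0 < ?n" using jk by simp
    ultimately show "y \<in> orbit (cycle_of_list cs) x" unfolding orbit_altdef by blast
  qed
qed

lemma foldr_comp_snoc: "foldr (\<circ>) (xs @ [g]) id = foldr (\<circ>) xs id \<circ> g"
  by (induction xs) (auto simp: comp_assoc)

lemma cycle_supp_disjoint:
  assumes "i < j" shows "cycle_supp l i \<inter> cycle_supp l j = {}"
proof -
  have "(\<Sum>k=1..i. l k) \<le> (\<Sum>k=1..<j. l k)" by (rule sum_mono2) (use assms in auto)
  then show ?thesis unfolding cycle_supp_def by auto
qed

lemma gamma_cycles: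
  assumes "\<forall>i\<in>{1..p}. l i \<ge> 1"
  shows "gamma p l permutes {1..(\<Sum>i=1..p. l i)}
    \<and> cycle_partition {1..(\<Sum>i=1..p. l i)} (gamma p l) = cycle_supp l ` {1..p}"
  using assms
proof (induction p)
  case 0
  then show ?case by (auto simp: gamma_def cycle_partition_def permutes_def)
next
  case (Suc p)
  define E where "E = {1..(\<Sum>i=1..p. l i)}"
  define D where "D = cycle_supp l (Suc p)"
  define c where "c = cycle_of_list (sorted_list_of_set D)"
  have IH: "gamma p l permutes E" "cycle_partition E (gamma p l) = cycle_supp l ` {1..p}"
    using Suc unfolding E_def by auto
  have D: "D = {(\<Sum>i=1..p. l i)<..(\<Sum>i=1..p. l i) + l (Suc p)}"
    unfolding D_def cycle_supp_def using atLeastLessThanSuc_atLeastAtMost[of 1 p] by simp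
  have ED: "{1..(\<Sum>i=1..Suc p. l i)} = E \<union> D" "E \<inter> D = {}" unfolding E_def D by auto
  have "1 \<le> l (Suc p)" using Suc.prems by (rule bspec) simp
  then have neD: "D \<noteq> {}" unfolding D by simp
  have c: "c permutes D"
    using cycle_permutes[of "sorted_list_of_set D"] unfolding c_def D by simp
  have oc: "orbit c x = D" if "x \<in> D" for x
    using orbit_cycle_of_list[of "sorted_list_of_set D" x] that unfolding c_def D by simp
  have g: "gamma (Suc p) l = gamma p l \<circ> c"
  proof -
    have "gamma (Suc p) l = foldr (\<circ>) (map (\<lambda>i. cycle_of_list (sorted_list_of_set (cycle_supp l i))) [1..<Suc p] @ [c]) id"
      unfolding gamma_def c_def D_def by simp
    then show ?thesis unfolding foldr_comp_snoc gamma_def .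
  qed
  have pE: "gamma p l permutes E \<union> D" "c permutes E \<union> D"
    using permutes_subset[OF IH(1)] permutes_subset[OF c] by auto
  have 1: "orbit (gamma p l \<circ> c) x = orbit (gamma p l) x" if "x \<in> E" for x
  proof (rule orbit_cong0[symmetric, OF that])
    show "gamma p l \<in> E \<rightarrow> E" using permutes_in_image[OF IH(1)] by auto
    fix y assume "y \<in> E"
    then have "y \<notin> D" using ED(2) by blast
    then show "gamma p l y = (gamma p l \<circ> c) y" using permutes_not_in[OF c] by simp
  qed
  have 2: "orbit (gamma p l \<circ> c) x = orbit c x" if "x \<in> D" for x
  proof (rule orbit_cong0[symmetric, OF that])
    show "c \<in> D \<rightarrow> D" using permutes_in_image[OF c] by auto
    fix y assume "y \<in> D"
    then have "c y \<in> D" using permutes_in_image[OF c] by simp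
    then have "c y \<notin> E" using ED(2) by blast
    then show "c y = (gamma p l \<circ> c) y" using permutes_not_in[OF IH(1)] by simp
  qed
  have "cycle_partition (E \<union> D) (gamma p l \<circ> c) = cycle_partition E (gamma p l) \<union> {D}"
  proof -
    have "orbit (gamma p l \<circ> c) ` E = cycle_partition E (gamma p l)"
      unfolding cycle_partition_def by (rule image_cong[OF refl 1])
    moreover have "orbit (gamma p l \<circ> c) ` D = {D}"
    proof -
      have "orbit (gamma p l \<circ> c) x = D" if "x \<in> D" for x using 2[OF that] oc[OF that] by simp
      then show ?thesis using neD by auto
    qed
    ultimately show ?thesis unfolding cycle_partition_def image_Un by simp
  qed
  moreover have "cycle_supp l ` {1..Suc p} = cycle_supp l ` {1..p} \<union> {D}"
    unfolding D_def by (auto simp: atLeastAtMostSuc_conv)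
  ultimately show ?case
    unfolding ED(1) g using IH(2) permutes_compose[OF pE(2,1)] by (simp del: comp_apply o_apply)
qed

section \<open>The decomposition of the sum\<close>

theorem theorem4p2:
  fixes f :: "nat set set \<Rightarrow> (nat \<Rightarrow> nat) \<Rightarrow> 'c::comm_ring_1"
    and p :: nat and l :: "nat \<Rightarrow> nat"
  assumes "multiplicative f"
    and "p \<ge> 1" and "\<forall>i\<in>{1..p}. l i \<ge> 1"
  shows "beta f p l =
    (let E = {1..(\<Sum>i=1..p. l i)}; cyc = cycle_partition E; \<gamma> = gamma p l in
     \<Sum>\<tau>\<in>NC_product p l.
     \<Sum>\<pi>' | refines E (cyc \<tau>) \<pi>' \<and> part_join E \<pi>' (cyc \<gamma>) = {E}
           \<and> L_defect E \<pi>' (cyc \<gamma>) (cyc \<tau>) = 0.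
       g_fun f p l \<pi>' \<tau>)"
proof -
  define E where "E = {1..(\<Sum>i=1..p. l i)}"
  define \<gamma> where "\<gamma> = gamma p l"
  let ?c = "cycle_partition E"
  have fin: "finite E" unfolding E_def by simp
  have "l 1 \<le> (\<Sum>i=1..p. l i)" by (rule member_le_sum) (use assms in auto)
  moreover have "1 \<le> l 1" using assms by simp
  ultimately have "1 \<in> E" unfolding E_def by simp
  then have ne: "E \<noteq> {}" by blast
  have g: "\<gamma> permutes E" and cg: "?c \<gamma> = cycle_supp l ` {1..p}"
    using gamma_cycles[OF assms(3)] unfolding E_def \<gamma>_def by auto
  note pg = cycle_partition_partition[OF g fin]
  define T where "T = {\<nu>. \<nu> permutes E \<and> genus E \<gamma> \<nu> = 0}"
  define A where "A = (\<lambda>\<nu>. {P. refines E (?c \<nu>) P \<and> part_join E P (?c \<gamma>) = {E}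
           \<and> L_defect E P (part_join E (?c \<gamma>) (?c \<nu>)) (?c \<nu>) = 0})"
  define Z where "Z = (\<lambda>\<tau>. {R. refines E (?c \<tau>) R \<and> part_join E R (?c \<gamma>) = {E}
           \<and> L_defect E R (?c \<gamma>) (?c \<tau>) = 0})"
  have fT: "finite T"
    by (rule finite_subset[OF _ finite_permutations[OF fin]]) (auto simp: T_def)
  have fA: "finite (A \<nu>)" for \<nu>
    by (rule finite_subset[OF _ finitely_many_partition_on[OF fin]])
      (use refines_partition(2) in \<open>fastforce simp: A_def\<close>)
  have fZ: "finite (Z \<tau>)" for \<tau>
    by (rule finite_subset[OF _ finitely_many_partition_on[OF fin]])
      (use refines_partition(2) in \<open>fastforce simp: Z_def\<close>)
  have NC: "NC_product p l = {\<tau>. \<tau> permutes E \<and> nc_le E \<tau> \<gamma>}"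
  proof -
    have "(\<forall>i\<in>{1..p}. perm_restrict \<tau> (cycle_supp l i)
        \<in> NC (cycle_supp l i) (perm_restrict \<gamma> (cycle_supp l i))) \<longleftrightarrow> nc_le E \<tau> \<gamma>"
      if t: "\<tau> permutes E" and r: "refines E (?c \<tau>) (?c \<gamma>)" for \<tau>
    proof -
      note gg = refines_refl[OF pg]
      have igg: "refines E (?c (inv \<gamma>)) (?c \<gamma>)" unfolding cycle_partition_inv[OF g fin] by (rule gg)
      have "(\<forall>i\<in>{1..p}. perm_restrict \<tau> (cycle_supp l i)
        \<in> NC (cycle_supp l i) (perm_restrict \<gamma> (cycle_supp l i))) \<longleftrightarrow>
        (\<forall>C\<in>?c \<gamma>. perm_restrict \<tau> C \<in> NC C (perm_restrict \<gamma> C))"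
        unfolding cg by simp
      also have "\<dots> \<longleftrightarrow> (\<forall>C\<in>?c \<gamma>. genus C (perm_restrict \<tau> C) (perm_restrict (inv \<gamma>) C) = 0)"
        by (rule ball_cong[OF refl])
          (simp add: NC_def perm_restrict_permutes[OF t fin r] perm_restrict_inv[OF g fin gg])
      also have "\<dots> \<longleftrightarrow> genus E \<tau> (inv \<gamma>) = 0"
        using genus_0_blocks[OF t permutes_inv[OF g] fin r igg] by simp
      also have "\<dots> \<longleftrightarrow> nc_le E \<tau> \<gamma>" using nc_le_iff_genus[OF t g fin r] by simp
      finally show ?thesis .
    qed
    then show ?thesis unfolding NC_product_def Let_def E_def[symmetric] \<gamma>_def[symmetric]
      by (auto simp: nc_le_def)
  qed
  have fNC: "finite (NC_product p l)" unfolding NC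
    by (rule finite_subset[OF _ finite_permutations[OF fin]]) auto

  have "beta f p l = (\<Sum>\<tau> | \<tau> permutes E \<and> genus E \<gamma> (inv \<tau>) = 0. \<Sum>P\<in>A \<tau>. f P \<tau>)"
    unfolding beta_def Let_def A_def E_def \<gamma>_def ..
  also have "\<dots> = (\<Sum>\<nu>\<in>T. \<Sum>P\<in>A \<nu>. f P \<nu>)"
  proof (rule sum.reindex_bij_witness[where i = inv and j = inv])
    fix s assume "s \<in> {\<tau>. \<tau> permutes E \<and> genus E \<gamma> (inv \<tau>) = 0}"
    then have s: "s permutes E" "genus E \<gamma> (inv s) = 0" by auto
    show "inv (inv s) = s" by (rule permutes_inv_inv[OF s(1)])
    show "inv s \<in> T" unfolding T_def using permutes_inv[OF s(1)] s(2) by blast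
    have "A (inv s) = A s" unfolding A_def cycle_partition_inv[OF s(1) fin] ..
    then show "(\<Sum>P\<in>A (inv s). f P (inv s)) = (\<Sum>P\<in>A s. f P s)"
      using multiplicative_inv[OF assms(1) s(1) fin ne] by (auto simp: A_def intro: sum.cong)
  next
    fix s assume "s \<in> T"
    then have s: "s permutes E" "genus E \<gamma> s = 0" unfolding T_def by auto
    show "inv (inv s) = s" by (rule permutes_inv_inv[OF s(1)])
    then show "inv s \<in> {\<tau>. \<tau> permutes E \<and> genus E \<gamma> (inv \<tau>) = 0}"
      using permutes_inv[OF s(1)] s(2) by simp
  qed
  also have "\<dots> = (\<Sum>(\<nu>, P)\<in>Sigma T A. f P \<nu>)"
    by (rule sum.Sigma) (use fT fA in auto)
  finally have lhs: "beta f p l = (\<Sum>(\<nu>, P)\<in>Sigma T A. f P \<nu>)" .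

  have gfun: "g_fun f p l R \<tau> = (\<Sum>(\<nu>, P)\<in>glued_data E \<tau> R. f P \<nu>)"
    if tN: "\<tau> \<in> NC_product p l" and R: "R \<in> Z \<tau>" for \<tau> R
  proof -
    have t: "\<tau> permutes E" and tg: "refines E (?c \<tau>) (?c \<gamma>)" using tN unfolding NC nc_le_def by auto
    have tR: "refines E (?c \<tau>) R" and L: "L_defect E R (?c \<gamma>) (?c \<tau>) = 0" using R unfolding Z_def by auto
    note pR = refines_partition(2)[OF tR] and pt = cycle_partition_partition[OF t fin]
    \<comment> \<open>The forest condition for \<open>R\<close> makes the trace of a cycle of \<open>\<gamma>\<close> on a block a single cycle of \<open>\<tau>\<close>.\<close>
    have block: "g_block f p l B (perm_restrict \<tau> B) = (\<Sum>(\<nu>, P)\<in>ns_data B (perm_restrict \<tau> B). f P \<nu>)"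
      if B: "B \<in> R" for B
    proof (rule g_block_eq_sum[OF assms(1)])
      show "finite B" by (rule finite_partition_block[OF pR fin B])
      show "B \<noteq> {}" using B partition_onD3[OF pR] by blast
      show "perm_restrict \<tau> B permutes B" by (rule perm_restrict_permutes[OF t fin tR B])
      have BE: "B \<subseteq> E" using B pR unfolding partition_on_def by blast
      have key: "block (?c \<tau>) x = B \<inter> cycle_supp l i"
        if x: "x \<in> B" "x \<in> cycle_supp l i" and i: "i \<in> {1..p}" for x i
      proof -
        have xE: "x \<in> E" using x BE by blast
        have b: "block R x = B" "block (?c \<gamma>) x = cycle_supp l i"
          using block_eq[OF pR B x(1)] block_eq[OF pg _ x(2)] i unfolding cg by auto
        then show ?thesis
          using refines_block_subset[OF tR, of x] refines_block_subset[OF tg, of x]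
            L_defect_0_unique_edge[OF fin tR tg L xE] by blast
      qed
      have cb: "cycle_partition B (perm_restrict \<tau> B) = block (?c \<tau>) ` B"
        unfolding cycle_partition_def
      proof (rule image_cong[OF refl])
        fix x assume x: "x \<in> B"
        show "orbit (perm_restrict \<tau> B) x = block (orbit \<tau> ` E) x"
          using orbit_perm_restrict[OF t fin tR B x] block_cycle_partition[OF t fin] x BE
          unfolding cycle_partition_def by auto
      qed
      show "cycle_partition B (perm_restrict \<tau> B) = (\<lambda>i. B \<inter> cycle_supp l i) ` met_cycles p l B"
        unfolding cb
      proof
        show "block (?c \<tau>) ` B \<subseteq> (\<lambda>i. B \<inter> cycle_supp l i) ` met_cycles p l B"
        proof
          fix X assume "X \<in> block (?c \<tau>) ` B"
          then obtain x where x: "x \<in> B" "X = block (?c \<tau>) x" by blast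
          then have "x \<in> \<Union>(?c \<gamma>)" using BE partition_onD1[OF pg] by blast
          then obtain i where i: "i \<in> {1..p}" "x \<in> cycle_supp l i" unfolding cg by blast
          then have "i \<in> met_cycles p l B" unfolding met_cycles_def using x by blast
          then show "X \<in> (\<lambda>i. B \<inter> cycle_supp l i) ` met_cycles p l B"
            using key[OF x(1) i(2,1)] x(2) by blast
        qed
        show "(\<lambda>i. B \<inter> cycle_supp l i) ` met_cycles p l B \<subseteq> block (?c \<tau>) ` B"
        proof
          fix X assume "X \<in> (\<lambda>i. B \<inter> cycle_supp l i) ` met_cycles p l B"
          then obtain i x where "i \<in> {1..p}" "x \<in> B" "x \<in> cycle_supp l i" "X = B \<inter> cycle_supp l i"
            unfolding met_cycles_def by blast
          then show "X \<in> block (?c \<tau>) ` B" using key by blast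
        qed
      qed
      show "inj_on (\<lambda>i. B \<inter> cycle_supp l i) (met_cycles p l B)"
      proof (rule inj_onI)
        fix i j assume "i \<in> met_cycles p l B" "B \<inter> cycle_supp l i = B \<inter> cycle_supp l j"
        then have "cycle_supp l i \<inter> cycle_supp l j \<noteq> {}" unfolding met_cycles_def by blast
        then show "i = j" using cycle_supp_disjoint[of i j l] cycle_supp_disjoint[of j i l]
          by (metis Int_commute linorder_neqE_nat)
      qed
    qed
    have "g_fun f p l R \<tau> = (\<Prod>B\<in>R. \<Sum>(\<nu>, P)\<in>ns_data B (perm_restrict \<tau> B). f P \<nu>)"
      unfolding g_fun_def using block by simp
    also have "\<dots> = (\<Sum>(\<nu>, P)\<in>glued_data E \<tau> R. f P \<nu>)"
      by (rule sum_glued_data[OF t fin tR]) (rule multiplicative_blocks[OF assms(1) _ fin ne])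
    finally show ?thesis .
  qed

  \<comment> \<open>The quadruples \<open>(\<tau>, \<pi>', \<nu>, \<pi>'')\<close>; forgetting \<open>\<tau>\<close> and \<open>\<pi>'\<close> is a bijection onto the index set of
    the left side.\<close>
  define M where "M = Sigma (Sigma (NC_product p l) Z) (\<lambda>(\<tau>, R). glued_data E \<tau> R)"
  have fG: "finite (glued_data E \<tau> R)" for \<tau> R
  proof -
    have "glued_data E \<tau> R \<subseteq> {s. s permutes E} \<times> {P. partition_on E P}"
      unfolding glued_data_def using refines_partition(2) by fast
    then show ?thesis
      using finite_permutations[OF fin] finitely_many_partition_on[OF fin] finite_subset finite_cartesian_product
      by blast
  qed
  have "(\<Sum>\<tau>\<in>NC_product p l. \<Sum>R\<in>Z \<tau>. g_fun f p l R \<tau>)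
    = (\<Sum>\<tau>\<in>NC_product p l. \<Sum>R\<in>Z \<tau>. \<Sum>(\<nu>, P)\<in>glued_data E \<tau> R. f P \<nu>)"
    using gfun by (intro sum.cong) auto
  also have "\<dots> = (\<Sum>(\<tau>, R)\<in>Sigma (NC_product p l) Z. \<Sum>(\<nu>, P)\<in>glued_data E \<tau> R. f P \<nu>)"
    by (rule sum.Sigma) (use fNC fZ in auto)
  also have "\<dots> = (\<Sum>x\<in>Sigma (NC_product p l) Z. \<Sum>y\<in>(case x of (\<tau>, R) \<Rightarrow> glued_data E \<tau> R).
      f (snd y) (fst y))"
    by (rule sum.cong) (auto simp: case_prod_beta)
  also have "\<dots> = (\<Sum>(x, y)\<in>M. f (snd y) (fst y))"
    unfolding M_def by (rule sum.Sigma) (use fNC fZ fG in auto)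
  also have "\<dots> = (\<Sum>z\<in>M. (\<lambda>y. f (snd y) (fst y)) (snd z))"
    by (simp add: case_prod_beta)
  also have "\<dots> = (\<Sum>y\<in>Sigma T A. f (snd y) (fst y))"
  proof (rule sum.reindex_bij_betw)
    have M: "\<tau> permutes E \<and> \<nu> permutes E \<and> cutting E \<gamma> \<nu> \<tau> \<and> nonsep E \<tau> \<nu> \<and> part_join E P (?c \<tau>) = R
        \<and> \<nu> \<in> T \<and> P \<in> A \<nu>"
      if "((\<tau>, R), (\<nu>, P)) \<in> M" for \<tau> R \<nu> P
    proof -
      have t: "\<tau> permutes E" "nc_le E \<tau> \<gamma>" 
        and R: "part_join E R (?c \<gamma>) = {E}" "L_defect E R (?c \<gamma>) (?c \<tau>) = 0"
        and n: "\<nu> permutes E" "genus E \<nu> \<tau> = 0" "nonsep E \<tau> \<nu>" "refines E (?c \<nu>) P"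
          "part_join E P (?c \<tau>) = R" "L_defect E P (part_join E (?c \<tau>) (?c \<nu>)) (?c \<nu>) = 0"
        using that unfolding M_def NC Z_def glued_data_def by auto
      from cutting_from_defects[OF g n(1) t(1) fin t(2) n(2,4) R[folded n(5)] n(6)]
      show ?thesis using t n unfolding T_def A_def by blast
    qed
    show "bij_betw snd M (Sigma T A)"
    proof (rule bij_betw_imageI)
      show "inj_on snd M"
      proof (rule inj_onI)
        fix z w assume zw: "z \<in> M" "w \<in> M" "snd z = snd w"
        obtain \<tau> R \<nu> P where z: "z = ((\<tau>, R), (\<nu>, P))" by (metis prod.collapse)
        obtain \<tau>' R' where w: "w = ((\<tau>', R'), (\<nu>, P))" using zw(3) z by (metis prod.collapse snd_conv)
        note Mz = M[OF zw(1)[unfolded z]] and Mw = M[OF zw(2)[unfolded w]]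
        have "\<tau> = \<tau>'" using nonseparable_cutting_unique[OF g _ fin] Mz Mw by blast
        then show "z = w" using Mz Mw z w by auto
      qed
      show "snd ` M = Sigma T A"
      proof
        show "snd ` M \<subseteq> Sigma T A"
        proof
          fix y assume "y \<in> snd ` M"
          then obtain \<tau> R \<nu> P where "((\<tau>, R), (\<nu>, P)) \<in> M" "y = (\<nu>, P)"
            by (metis imageE prod.collapse)
          then show "y \<in> Sigma T A" using M by blast
        qed
        show "Sigma T A \<subseteq> snd ` M"
        proof
          fix y assume "y \<in> Sigma T A"
          then obtain \<nu> P where y: "y = (\<nu>, P)" and n: "\<nu> permutes E" "genus E \<gamma> \<nu> = 0"
            and P: "refines E (?c \<nu>) P" "part_join E P (?c \<gamma>) = {E}"
              "L_defect E P (part_join E (?c \<gamma>) (?c \<nu>)) (?c \<nu>) = 0"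
            unfolding T_def A_def by blast
          obtain \<tau> where c: "cutting E \<gamma> \<nu> \<tau>" and ns: "nonsep E \<tau> \<nu>"
            using nonseparable_cutting_exists[OF g n(1) fin n(2)] by blast
          have t: "\<tau> permutes E" "nc_le E \<tau> \<gamma>" "genus E \<nu> \<tau> = 0" using c unfolding cutting_def by auto
          note d = cutting_defects[OF g n(1) fin c P]
          have "refines E (?c \<tau>) (part_join E P (?c \<tau>))"
            by (rule part_join_is_join(2)[OF refines_partition(2)[OF P(1)] cycle_partition_partition[OF t(1) fin]])
          then have "((\<tau>, part_join E P (?c \<tau>)), (\<nu>, P)) \<in> M"
            unfolding M_def NC Z_def glued_data_def using t n P ns d by simp
          then show "y \<in> snd ` M" unfolding y by (metis image_eqI snd_conv)
        qed
      qed
    qed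
  qed
  also have "\<dots> = beta f p l" unfolding lhs by (simp add: case_prod_beta)
  finally show ?thesis unfolding Let_def Z_def E_def \<gamma>_def by simp
qed

end
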